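(* Let $X$ be a decomposable scroll generated by $C_1,\dots,C_n$ over a smooth curve $C$, and let $\Phi_2(X)$ be its inflectional locus. Let $p\in C$. (1) The following three conditions are equivalent: (i) $\big(f_p\setminus\bigcup_{i=1}^n\langle p_1,\dots,\widehat{p_i},\dots,p_n\rangle\big)\cap\Phi_2(X)\ne\emptyset$; (ii) $p_i$ is a flex of $C_i$ for every $i=1,\dots,n$; (iii) $f_p\subseteq\Phi_2(X)$. (2) For each $i$, $p_i\in\Phi_2(X)$ if and only if $p_i$ is a flex of $C_i$. (3) Let $x\in\Phi_2(X)$: if $x\in f_p\setminus\langle p_1,\dots,\widehat{p_s},\dots,p_n\rangle$, then $p_s$ is a flex of $C_s$.
   Context: We work over $\mathbb{C}$. For a vector space $W$, $\mathbb{P}(W)$ is the set of codimension-one subspaces of $W$; $\langle\cdot\rangle$ denotes linear span and $\widehat{\ }$ denotes suppression. Decomposable scroll. Let $C$ be a smooth projective curve. For $i=1,\dots,n$ let $\mathcal{L}_i$ be a very ample line bundle on $C$ and $V_i\subseteq H^0(C,\mathcal{L}_i)$ a subspace such that $|V_i|$ gives an embedding $\varphi_i:C\to\mathbb{P}^{r_i}=\mathbb{P}(V_i)$; put $C_i=\varphi_i(C)$. Let $V=\bigoplus_i V_i$, $\mathcal{E}=\bigoplus_i\mathcal{L}_i$, $P=\mathbb{P}(\mathcal{E})$ and let $L$ be the tautological line bundle on $P$. Identifying $V$ with a subspace of $H^0(P,L)$ one gets an embedding $\varphi:P\to\mathbb{P}^N=\mathbb{P}(V)$, $N=\sum_i r_i+n-1$.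 Its image $X=\varphi(P)$ is called the decomposable scroll generated by $C_1,\dots,C_n$. For $p\in C$ put $p_i=\varphi_i(p)\in C_i\subset\mathbb{P}^{r_i}\subset \mathbb{P}^N$, the $\mathbb{P}^{r_i}$ being embedded as linearly independent subspaces spanning $\mathbb{P}^N$; the fibre of $X$ over $p$ is $f_p=\langle p_1,\dots,p_n\rangle\cong\mathbb{P}^{n-1}$. Osculating spaces and inflectional loci. For a smooth $Y\subset\mathbb{P}(W)$ with hyperplane bundle $L$ and $y\in Y$, let $j_{k,y}:W\to (J_kL)_y$ be the map sending a section to its $k$-th jet at $y$ ($J_kL$ the $k$-th jet bundle). The $k$-th osculating space is $\mathrm{Osc}^k_y(Y)=\mathbb{P}(\mathrm{Im}\, j_{k,y})\subseteq\mathbb{P}(W)$, a linear subspace of dimension $\mathrm{rk}(j_{k,y})-1$. If $Y$ is a scroll of dimension $n$ (a curve if $n=1$), then $\dim\mathrm{Osc}^k_y(Y)\le nk$, and the $k$-th inflectional locus is $\Phi_k(Y)=\{y\in Y:\dim\mathrm{Osc}^k_y(Y)<nk\}$. A flex of $Y$ is a point of $\Phi_2(Y)$ (so every point of a line is a flex of the line). For $C_i$ this is taken with respect to $C_i\subset\mathbb{P}^{r_i}=\mathbb{P}(V_i)$. *)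

theory Defs
  imports "HOL-Analysis.Analysis" "HOL-Library.Function_Algebras"
begin

section \<open>Complex vector spaces and projective spaces\<close>

text \<open>Every complex vector space below is a linear subspace, with pointwise operations, of
  \<open>'x \<Rightarrow> complex\<close> for some type \<open>'x\<close>.\<close>

type_synonym 'x cvec = "'x \<Rightarrow> complex"

definition cscale :: "complex \<Rightarrow> 'x cvec \<Rightarrow> 'x cvec"
  where "cscale c f = (\<lambda>x. c * f x)"

global_interpretation cv: vector_space "cscale :: complex \<Rightarrow> 'x cvec \<Rightarrow> 'x cvec"
  by unfold_locales (auto simp: cscale_def algebra_simps fun_eq_iff)

text \<open>\<open>codim W K\<close> is the dimension of \<open>W / K\<close>, as the least size of a generating set
  of the quotient (\<open>\<infinity>\<close> if there is no finite one, since \<open>Inf {} = \<infinity>\<close>).\<close>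

definition codim :: "'x cvec set \<Rightarrow> 'x cvec set \<Rightarrow> enat"
  where "codim W K = Inf {enat (card B) |B. finite B \<and> B \<subseteq> W \<and> W \<subseteq> cv.span (K \<union> B)}"

definition Proj :: "'x cvec set \<Rightarrow> 'x cvec set set"
  where "Proj W = {H. cv.subspace H \<and> H \<subseteq> W \<and> codim W H = 1}"

text \<open>The quotient \<open>W / K\<close> gives the linear subspace of all hyperplanes of \<open>W\<close> that
  contain \<open>K\<close>.\<close>

definition lin :: "'x cvec set \<Rightarrow> 'x cvec set \<Rightarrow> 'x cvec set set"
  where "lin W K = {H \<in> Proj W. K \<subseteq> H}"

definition linear_subspace :: "'x cvec set \<Rightarrow> 'x cvec set set \<Rightarrow> bool"
  where "linear_subspace W \<Lambda> \<longleftrightarrow> (\<exists>K. cv.subspace K \<and> K \<subseteq> W \<and> \<Lambda> = lin W K)"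

definition proj_span :: "'x cvec set \<Rightarrow> 'x cvec set set \<Rightarrow> 'x cvec set set"
  where "proj_span W S = \<Inter>{\<Lambda>. linear_subspace W \<Lambda> \<and> S \<subseteq> \<Lambda>}"

text \<open>For \<open>\<Lambda> = lin W K\<close> the intersection \<open>W \<inter> \<Inter>\<Lambda>\<close> is \<open>K\<close>; the value is in
  \<open>ereal\<close> so that the empty linear subspace has dimension \<open>-1\<close>.\<close>

definition proj_dim :: "'x cvec set \<Rightarrow> 'x cvec set set \<Rightarrow> ereal"
  where "proj_dim W \<Lambda> = ereal_of_enat (codim W (W \<inter> \<Inter>\<Lambda>)) - 1"


section \<open>Homogeneous forms and the Zariski topology\<close>

text \<open>A point \<open>y\<close> of \<open>Proj W\<close> is the kernel of a linear functional on \<open>W\<close>, unique up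
  to a nonzero factor: these functionals play the role of homogeneous coordinate
  vectors of \<open>y\<close>. Their values outside \<open>W\<close> are irrelevant.\<close>

definition functionals :: "'x cvec set \<Rightarrow> 'x cvec set \<Rightarrow> ('x cvec \<Rightarrow> complex) set"
  where "functionals W y =
    {l. (\<forall>s\<in>W. \<forall>t\<in>W. l (s + t) = l s + l t) \<and> (\<forall>c. \<forall>s\<in>W. l (cscale c s) = c * l s) \<and>
        {s \<in> W. l s = 0} = y}"

text \<open>\<open>form W d F\<close>: \<open>F\<close> is an element of the symmetric power \<open>Sym\<^sup>d W\<close>, viewed as a
  homogeneous polynomial function of degree \<open>d\<close> on functionals.\<close>

inductive form :: "'x cvec set \<Rightarrow> nat \<Rightarrow> (('x cvec \<Rightarrow> complex) \<Rightarrow> complex) \<Rightarrow> bool"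
  for W
  where
    form_const: "form W 0 (\<lambda>l. c)"
  | form_lin: "s \<in> W \<Longrightarrow> form W 1 (\<lambda>l. l s)"
  | form_add: "form W d F \<Longrightarrow> form W d G \<Longrightarrow> form W d (\<lambda>l. F l + G l)"
  | form_mult: "form W d F \<Longrightarrow> form W e G \<Longrightarrow> form W (d + e) (\<lambda>l. F l * G l)"

text \<open>The sets \<open>{F \<noteq> 0}\<close> are a basis of the Zariski topology.\<close>

definition zariski :: "'x cvec set \<Rightarrow> 'x cvec set topology"
  where "zariski W = topology_generated_by
    {{y \<in> Proj W. \<forall>l\<in>functionals W y. F l \<noteq> 0} |F. \<exists>d. form W d F}"

abbreviation zariski_on :: "'x cvec set \<Rightarrow> 'x cvec set set \<Rightarrow> 'x cvec set topology"
  where "zariski_on W Y \<equiv> subtopology (zariski W) Y"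


section \<open>Regular functions, morphisms, curves\<close>

text \<open>In all that follows, \<open>Y \<subseteq> Proj W\<close>, and \<open>Y\<close> carries the structure induced by
  \<open>Proj W\<close>.\<close>

definition regular :: "'x cvec set \<Rightarrow> 'x cvec set set \<Rightarrow> 'x cvec set set \<Rightarrow>
    ('x cvec set \<Rightarrow> complex) \<Rightarrow> bool"
  where "regular W Y N f \<longleftrightarrow> openin (zariski_on W Y) N \<and>
    (\<forall>y\<in>N. \<exists>M d F G. openin (zariski_on W Y) M \<and> y \<in> M \<and> M \<subseteq> N \<and> form W d F \<and> form W d G \<and>
       (\<forall>z\<in>M. \<forall>l\<in>functionals W z. G l \<noteq> 0 \<and> f z = F l / G l))"

text \<open>Sections over \<open>N\<close> of the hyperplane bundle \<open>O(1)\<close> of \<open>Y\<close>, as functions of degree one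
  on the functionals with kernel in \<open>N\<close>.\<close>

definition hyp_section :: "'x cvec set \<Rightarrow> 'x cvec set set \<Rightarrow> 'x cvec set set \<Rightarrow>
    (('x cvec \<Rightarrow> complex) \<Rightarrow> complex) \<Rightarrow> bool"
  where "hyp_section W Y N \<sigma> \<longleftrightarrow> openin (zariski_on W Y) N \<and>
    (\<forall>y\<in>N. \<exists>M d F G. openin (zariski_on W Y) M \<and> y \<in> M \<and> M \<subseteq> N \<and>
       form W (Suc d) F \<and> form W d G \<and>
       (\<forall>z\<in>M. \<forall>l\<in>functionals W z. G l \<noteq> 0 \<and> \<sigma> l = F l / G l))"

text \<open>Functions representing germs in the local ring \<open>O\<close> of \<open>Y\<close> at \<open>y\<close>, in its maximal
  ideal \<open>m\<close>, and in the powers of \<open>m\<close>. Functions with the same germ at \<open>y\<close> are not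
  identified, but all these sets are closed under equality of germs.\<close>

definition local_ring :: "'x cvec set \<Rightarrow> 'x cvec set set \<Rightarrow> 'x cvec set \<Rightarrow>
    ('x cvec set \<Rightarrow> complex) set"
  where "local_ring W Y y = {f. \<exists>N. y \<in> N \<and> regular W Y N f}"

definition max_ideal :: "'x cvec set \<Rightarrow> 'x cvec set set \<Rightarrow> 'x cvec set \<Rightarrow>
    ('x cvec set \<Rightarrow> complex) set"
  where "max_ideal W Y y = {f \<in> local_ring W Y y. f y = 0}"

primrec max_ideal_pow :: "'x cvec set \<Rightarrow> 'x cvec set set \<Rightarrow> 'x cvec set \<Rightarrow> nat \<Rightarrow>
    ('x cvec set \<Rightarrow> complex) set"
  where
    "max_ideal_pow W Y y 0 = local_ring W Y y"
  | "max_ideal_pow W Y y (Suc k) =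
      {h. \<exists>N (r::nat) f g. openin (zariski_on W Y) N \<and> y \<in> N \<and>
         (\<forall>i<r. f i \<in> max_ideal W Y y \<and> g i \<in> max_ideal_pow W Y y k) \<and>
         (\<forall>z\<in>N. h z = (\<Sum>i<r. f i z * g i z))}"

definition morphism :: "'x cvec set \<Rightarrow> 'x cvec set set \<Rightarrow> 'z cvec set \<Rightarrow> 'z cvec set set \<Rightarrow>
    ('x cvec set \<Rightarrow> 'z cvec set) \<Rightarrow> bool"
  where "morphism W Y W' Y' \<phi> \<longleftrightarrow> continuous_map (zariski_on W Y) (zariski_on W' Y') \<phi> \<and>
    (\<forall>N f. regular W' Y' N f \<longrightarrow> regular W Y {y \<in> Y. \<phi> y \<in> N} (f \<circ> \<phi>))"

definition isomorphism :: "'x cvec set \<Rightarrow> 'x cvec set set \<Rightarrow> 'z cvec set \<Rightarrow> 'z cvec set set \<Rightarrow>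
    ('x cvec set \<Rightarrow> 'z cvec set) \<Rightarrow> bool"
  where "isomorphism W Y W' Y' \<phi> \<longleftrightarrow> morphism W Y W' Y' \<phi> \<and>
    (\<exists>\<psi>. morphism W' Y' W Y \<psi> \<and> (\<forall>y\<in>Y. \<psi> (\<phi> y) = y) \<and> (\<forall>y\<in>Y'. \<phi> (\<psi> y) = y))"

definition embedding_into :: "'x cvec set \<Rightarrow> 'x cvec set set \<Rightarrow> 'z cvec set \<Rightarrow>
    ('x cvec set \<Rightarrow> 'z cvec set) \<Rightarrow> bool"
  where "embedding_into W Y W' \<phi> \<longleftrightarrow>
    \<phi> ` Y \<subseteq> Proj W' \<and> closedin (zariski W') (\<phi> ` Y) \<and> isomorphism W Y W' (\<phi> ` Y) \<phi>"

definition irreducible_in :: "'p topology \<Rightarrow> 'p set \<Rightarrow> bool"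
  where "irreducible_in T Z \<longleftrightarrow> Z \<noteq> {} \<and>
    (\<forall>A B. closedin T A \<and> closedin T B \<and> Z \<subseteq> A \<union> B \<longrightarrow> Z \<subseteq> A \<or> Z \<subseteq> B)"

definition krull_dim :: "'p topology \<Rightarrow> enat"
  where "krull_dim T = Sup {enat m |m. \<exists>Z :: nat \<Rightarrow> 'p set.
    (\<forall>i\<le>m. closedin T (Z i) \<and> irreducible_in T (Z i)) \<and> (\<forall>i<m. Z i \<subset> Z (Suc i))}"

definition projective_variety :: "'x cvec set \<Rightarrow> 'x cvec set set \<Rightarrow> bool"
  where "projective_variety W Y \<longleftrightarrow> cv.subspace W \<and> codim W {0} < \<infinity> \<and>
    closedin (zariski W) Y \<and> irreducible_in (zariski W) Y"

definition smooth_projective_curve :: "'x cvec set \<Rightarrow> 'x cvec set set \<Rightarrow> bool"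
  where "smooth_projective_curve W Y \<longleftrightarrow> projective_variety W Y \<and>
    krull_dim (zariski_on W Y) = 1 \<and>
    (\<forall>y\<in>Y. codim (max_ideal W Y y) (max_ideal_pow W Y y 2) = 1)"


section \<open>Jets, osculating spaces, inflectional loci\<close>

text \<open>The stalk at \<open>y\<close> of the hyperplane bundle \<open>L\<close> of \<open>Y\<close>, its submodules \<open>m\<^sup>k L\<close>,
  and the class of a local section in the fibre \<open>(J\<^sub>k L)\<^sub>y = L\<^sub>y / m\<^bsup>k+1\<^esup> L\<^sub>y\<close>.\<close>

definition hyp_stalk :: "'x cvec set \<Rightarrow> 'x cvec set set \<Rightarrow> 'x cvec set \<Rightarrow>
    (('x cvec \<Rightarrow> complex) \<Rightarrow> complex) set"
  where "hyp_stalk W Y y = {\<sigma>. \<exists>N. y \<in> N \<and> hyp_section W Y N \<sigma>}"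

definition hyp_stalk_pow :: "'x cvec set \<Rightarrow> 'x cvec set set \<Rightarrow> 'x cvec set \<Rightarrow> nat \<Rightarrow>
    (('x cvec \<Rightarrow> complex) \<Rightarrow> complex) set"
  where "hyp_stalk_pow W Y y k =
    {\<sigma>. \<exists>N (r::nat) f \<rho>. openin (zariski_on W Y) N \<and> y \<in> N \<and>
       (\<forall>i<r. f i \<in> max_ideal_pow W Y y k \<and> \<rho> i \<in> hyp_stalk W Y y) \<and>
       (\<forall>z\<in>N. \<forall>l\<in>functionals W z. \<sigma> l = (\<Sum>i<r. f i z * \<rho> i l))}"

definition jet_class :: "'x cvec set \<Rightarrow> 'x cvec set set \<Rightarrow> nat \<Rightarrow> 'x cvec set \<Rightarrow>
    (('x cvec \<Rightarrow> complex) \<Rightarrow> complex) \<Rightarrow> (('x cvec \<Rightarrow> complex) \<Rightarrow> complex) set"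
  where "jet_class W Y k y \<sigma> =
    {\<tau> \<in> hyp_stalk W Y y. (\<lambda>l. \<tau> l - \<sigma> l) \<in> hyp_stalk_pow W Y y (Suc k)}"

text \<open>The map \<open>j\<^bsub>k,y\<^esub>\<close>; \<open>s \<in> W\<close> is a section of the hyperplane bundle via \<open>l \<mapsto> l s\<close>.\<close>

definition jet :: "'x cvec set \<Rightarrow> 'x cvec set set \<Rightarrow> nat \<Rightarrow> 'x cvec set \<Rightarrow> 'x cvec \<Rightarrow>
    (('x cvec \<Rightarrow> complex) \<Rightarrow> complex) set"
  where "jet W Y k y s = jet_class W Y k y (\<lambda>l. l s)"

definition jet_ker :: "'x cvec set \<Rightarrow> 'x cvec set set \<Rightarrow> nat \<Rightarrow> 'x cvec set \<Rightarrow> 'x cvec set"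
  where "jet_ker W Y k y = {s \<in> W. jet W Y k y s = jet_class W Y k y (\<lambda>l. 0)}"

text \<open>The surjection from \<open>W\<close> to \<open>Im j\<^bsub>k,y\<^esub> = W / ker j\<^bsub>k,y\<^esub>\<close> embeds
  \<open>Proj (Im j\<^bsub>k,y\<^esub>)\<close> in \<open>Proj W\<close> as the following linear subspace.\<close>

definition Osc :: "'x cvec set \<Rightarrow> 'x cvec set set \<Rightarrow> nat \<Rightarrow> 'x cvec set \<Rightarrow> 'x cvec set set"
  where "Osc W Y k y = lin W (jet_ker W Y k y)"

text \<open>Here \<open>n\<close> is the dimension of \<open>Y\<close>, a curve or a scroll.\<close>

definition infl_locus :: "'x cvec set \<Rightarrow> nat \<Rightarrow> 'x cvec set set \<Rightarrow> nat \<Rightarrow> 'x cvec set set"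
  where "infl_locus W n Y k = {y \<in> Y. proj_dim W (Osc W Y k y) < ereal (real (n * k))}"

definition is_flex :: "'x cvec set \<Rightarrow> nat \<Rightarrow> 'x cvec set set \<Rightarrow> 'x cvec set \<Rightarrow> bool"
  where "is_flex W n Y y \<longleftrightarrow> y \<in> infl_locus W n Y 2"


section \<open>Line bundles\<close>

text \<open>A line bundle is given by a trivializing open cover and its transition functions.
  A section is the family of its local expressions, extended by \<open>0\<close> outside the cover; an
  element of the fibre at \<open>p\<close> is the family of its coordinates in the trivializations
  defined at \<open>p\<close>.\<close>

record ('a, 'p) line_bundle =
  lb_index :: "'a set"
  lb_open :: "'a \<Rightarrow> 'p set"
  lb_trans :: "'a \<Rightarrow> 'a \<Rightarrow> 'p \<Rightarrow> complex"

definition line_bundle_on :: "'x cvec set \<Rightarrow> 'x cvec set set \<Rightarrow>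
    ('a, 'x cvec set) line_bundle \<Rightarrow> bool"
  where "line_bundle_on W Y L \<longleftrightarrow>
    (\<forall>a\<in>lb_index L. openin (zariski_on W Y) (lb_open L a)) \<and>
    (\<Union>a\<in>lb_index L. lb_open L a) = Y \<and>
    (\<forall>a\<in>lb_index L. \<forall>b\<in>lb_index L.
       regular W Y (lb_open L a \<inter> lb_open L b) (lb_trans L a b) \<and>
       (\<forall>p\<in>lb_open L a \<inter> lb_open L b. lb_trans L a b p \<noteq> 0)) \<and>
    (\<forall>a\<in>lb_index L. \<forall>p\<in>lb_open L a. lb_trans L a a p = 1) \<and>
    (\<forall>a\<in>lb_index L. \<forall>b\<in>lb_index L. \<forall>c\<in>lb_index L.
       \<forall>p\<in>lb_open L a \<inter> lb_open L b \<inter> lb_open L c.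
         lb_trans L a b p * lb_trans L b c p = lb_trans L a c p)"

definition lb_fibre :: "('a, 'p) line_bundle \<Rightarrow> 'p \<Rightarrow> 'a cvec set"
  where "lb_fibre L p =
    {e. (\<forall>a. a \<notin> lb_index L \<or> p \<notin> lb_open L a \<longrightarrow> e a = 0) \<and>
        (\<forall>a\<in>lb_index L. \<forall>b\<in>lb_index L.
           p \<in> lb_open L a \<inter> lb_open L b \<longrightarrow> e a = lb_trans L a b p * e b)}"

definition sec_value :: "('a \<times> 'p) cvec \<Rightarrow> 'p \<Rightarrow> 'a cvec"
  where "sec_value s p = (\<lambda>a. s (a, p))"

definition H0 :: "'x cvec set \<Rightarrow> 'x cvec set set \<Rightarrow> ('a, 'x cvec set) line_bundle \<Rightarrow>
    ('a \<times> 'x cvec set) cvec set"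
  where "H0 W Y L =
    {s. (\<forall>p. sec_value s p \<in> lb_fibre L p) \<and>
        (\<forall>a\<in>lb_index L. regular W Y (lb_open L a) (\<lambda>p. s (a, p)))}"

text \<open>The map to \<open>Proj V\<close> defined by the linear system \<open>|V|\<close>, for a space \<open>V\<close> of sections.\<close>

definition sys_map :: "('a \<times> 'p) cvec set \<Rightarrow> 'p \<Rightarrow> ('a \<times> 'p) cvec set"
  where "sys_map V p = {s \<in> V. sec_value s p = 0}"

definition gives_embedding :: "'x cvec set \<Rightarrow> 'x cvec set set \<Rightarrow>
    ('a \<times> 'x cvec set) cvec set \<Rightarrow> bool"
  where "gives_embedding W Y V \<longleftrightarrow> embedding_into W Y V (sys_map V)"

definition very_ample :: "'x cvec set \<Rightarrow> 'x cvec set set \<Rightarrow>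
    ('a, 'x cvec set) line_bundle \<Rightarrow> bool"
  where "very_ample W Y L \<longleftrightarrow> line_bundle_on W Y L \<and> gives_embedding W Y (H0 W Y L)"


section \<open>Decomposable scrolls\<close>

definition component :: "nat \<Rightarrow> (nat \<times> 'x) cvec \<Rightarrow> 'x cvec"
  where "component i v = (\<lambda>x. v (i, x))"

definition direct_sum :: "nat \<Rightarrow> (nat \<Rightarrow> 'x cvec set) \<Rightarrow> (nat \<times> 'x) cvec set"
  where "direct_sum n V =
    {v. (\<forall>i\<in>{1..n}. component i v \<in> V i) \<and> (\<forall>i. i \<notin> {1..n} \<longrightarrow> component i v = 0)}"

text \<open>The points of \<open>P(\<E>)\<close>, \<open>\<E>\<close> the direct sum of the \<open>L i\<close>: pairs of a point \<open>p\<close> of \<open>C\<close>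
  and a hyperplane \<open>H\<close> of the fibre \<open>\<E>\<^sub>p\<close>. The fibre at \<open>(p, H)\<close> of the tautological
  bundle is \<open>\<E>\<^sub>p / H\<close>.\<close>

definition proj_bundle :: "'p set \<Rightarrow> nat \<Rightarrow> (nat \<Rightarrow> ('a, 'p) line_bundle) \<Rightarrow>
    ('p \<times> (nat \<times> 'a) cvec set) set"
  where "proj_bundle C n L = {(p, H). p \<in> C \<and> H \<in> Proj (direct_sum n (\<lambda>i. lb_fibre (L i) p))}"

definition fibre_value :: "(nat \<times> 'a \<times> 'p) cvec \<Rightarrow> 'p \<Rightarrow> (nat \<times> 'a) cvec"
  where "fibre_value v p = (\<lambda>(i, a). v (i, a, p))"

text \<open>The map given by the sections of the tautological bundle induced by the direct sum of
  the \<open>V i\<close>: such a section vanishes at \<open>(p, H)\<close> iff its value in \<open>\<E>\<^sub>p\<close> lies in \<open>H\<close>.\<close>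

definition scroll_map :: "nat \<Rightarrow> (nat \<Rightarrow> ('a \<times> 'p) cvec set) \<Rightarrow>
    'p \<times> (nat \<times> 'a) cvec set \<Rightarrow> (nat \<times> 'a \<times> 'p) cvec set"
  where "scroll_map n V x = {v \<in> direct_sum n V. fibre_value v (fst x) \<in> snd x}"

definition scroll :: "'p set \<Rightarrow> nat \<Rightarrow> (nat \<Rightarrow> ('a, 'p) line_bundle) \<Rightarrow>
    (nat \<Rightarrow> ('a \<times> 'p) cvec set) \<Rightarrow> (nat \<times> 'a \<times> 'p) cvec set set"
  where "scroll C n L V = scroll_map n V ` proj_bundle C n L"

text \<open>\<open>Proj (V i)\<close> as a linear subspace of \<open>Proj (direct_sum n V)\<close>, via the projection of
  \<open>direct_sum n V\<close> to \<open>V i\<close>; and the image \<open>p\<^sub>i\<close> of \<open>sys_map (V i) p\<close>.\<close>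

definition incl :: "nat \<Rightarrow> (nat \<Rightarrow> 'x cvec set) \<Rightarrow> nat \<Rightarrow> 'x cvec set \<Rightarrow> (nat \<times> 'x) cvec set"
  where "incl n V i H = {v \<in> direct_sum n V. component i v \<in> H}"

definition scroll_pt :: "nat \<Rightarrow> (nat \<Rightarrow> ('a \<times> 'p) cvec set) \<Rightarrow> 'p \<Rightarrow> nat \<Rightarrow>
    (nat \<times> 'a \<times> 'p) cvec set"
  where "scroll_pt n V p i = incl n V i (sys_map (V i) p)"

definition scroll_fibre :: "nat \<Rightarrow> (nat \<Rightarrow> ('a \<times> 'p) cvec set) \<Rightarrow> 'p \<Rightarrow>
    (nat \<times> 'a \<times> 'p) cvec set set"
  where "scroll_fibre n V p = proj_span (direct_sum n V) (scroll_pt n V p ` {1..n})"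

text \<open>The span of the points \<open>p\<^sub>1, \<dots>, p\<^sub>n\<close> with \<open>p\<^sub>i\<close> suppressed.\<close>

definition scroll_face :: "nat \<Rightarrow> (nat \<Rightarrow> ('a \<times> 'p) cvec set) \<Rightarrow> 'p \<Rightarrow> nat \<Rightarrow>
    (nat \<times> 'a \<times> 'p) cvec set set"
  where "scroll_face n V p i = proj_span (direct_sum n V) (scroll_pt n V p ` ({1..n} - {i}))"

end

theory Submission
  imports Defs
begin

text \<open>Near a point \<open>x\<close> of the fibre over \<open>p\<close> with homogeneous coordinates \<open>c\<close>, \<open>c s \<noteq> 0\<close>, a section
  \<open>v\<close> of the tautological bundle is \<open>\<Sum>i. u i * v i\<close>, where \<open>v i\<close> is a function of the uniformizer
  \<open>t\<close> of \<open>C\<close> at \<open>p\<close> and the \<open>u i\<close> are fibre coordinates with value \<open>c i\<close> at \<open>x\<close>. Its 2-jet at \<open>x\<close>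
  vanishes iff every \<open>v i\<close> vanishes to order 2 at \<open>p\<close> and \<open>\<Sum>i. c i * v i\<close> vanishes to order 3. Since
  each \<open>V i\<close> separates tangents, the first family of conditions has rank \<open>2 * n\<close>; so \<open>x\<close> is
  inflectional iff the last condition is redundant, that is, iff \<open>p\<^sub>i\<close> is a flex of \<open>C\<^sub>i\<close> whenever
  \<open>c i \<noteq> 0\<close>.\<close>

section \<open>Linear functionals and codimension\<close>

text \<open>The local ring of the scroll consists of quotients of ambient forms, so \<open>t\<close>
  and the \<open>u i\<close> have to be brought in from outside, on two sides. Restriction to curves
  \<open>q \<mapsto> point (u q) q\<close>, with \<open>u\<close> constant or with one coordinate
  changed to \<open>c j + t\<close>, gives the conditions necessary for a vanishing 2-jet. Pulling
  functions of \<open>C\<close> back along the projection of the scroll writes a section as an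
  explicit element of m^3 and gives sufficiency. These maps, like the embeddings of
  \<open>C\<close>, act only through rings of functions and neighbourhood filters, so powers of the
  maximal ideal m are treated once, in abstract rings of germs. The rank is certified by a dual
  system: a section nonzero at \<open>p\<close> and a tangent section for each summand. Redundancy
  of the last condition can be tested on one summand at a time, because a section may live in a
  single \<open>V i\<close>; there it says that vanishing of the coefficients of orders 0 and 1
  forces that of order 2, unless \<open>c i = 0\<close>.\<close>

lemma cscale_apply: "cscale c f x = c * f x"
  by (simp add: cscale_def)

definition linear_on :: "'x cvec set \<Rightarrow> ('x cvec \<Rightarrow> complex) \<Rightarrow> bool"
  where "linear_on W l \<longleftrightarrow> (\<forall>s\<in>W. \<forall>t\<in>W. l (s + t) = l s + l t) \<and> (\<forall>c. \<forall>s\<in>W. l (cscale c s) = c * l s)"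

lemma functionals_iff: "l \<in> functionals W y \<longleftrightarrow> linear_on W l \<and> {s \<in> W. l s = 0} = y"
  by (auto simp: functionals_def linear_on_def)

lemma linear_on_add: "linear_on W l \<Longrightarrow> s \<in> W \<Longrightarrow> t \<in> W \<Longrightarrow> l (s + t) = l s + l t"
  by (simp add: linear_on_def)

lemma linear_on_scale: "linear_on W l \<Longrightarrow> s \<in> W \<Longrightarrow> l (cscale c s) = c * l s"
  by (simp add: linear_on_def)

lemma minus_conv_cscale: "s - t = s + cscale (- 1) t" for s t :: "'x cvec"
  by (simp add: fun_eq_iff cscale_def)

lemma linear_on_diff:
  assumes "cv.subspace W" "linear_on W l" "s \<in> W" "t \<in> W"
  shows "l (s - t) = l s - l t"
proof -
  have "l (s - t) = l s + l (cscale (- 1) t)"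
    unfolding minus_conv_cscale[of s] using assms by (intro linear_on_add[OF assms(2)] cv.subspace_scale)
  then show ?thesis using linear_on_scale[OF assms(2,4), of "- 1"] by simp
qed

lemma linear_on_zero: "cv.subspace W \<Longrightarrow> linear_on W l \<Longrightarrow> l 0 = 0"
  using linear_on_scale[of W l 0 0] cv.subspace_0[of W] by auto

lemma linear_on_sum:
  assumes "cv.subspace W" "linear_on W l" "\<And>j. j \<in> J \<Longrightarrow> f j \<in> W"
  shows "l (\<Sum>j\<in>J. f j) = (\<Sum>j\<in>J. l (f j))"
  using assms(3)
proof (induction J rule: infinite_finite_induct)
  case (insert j J)
  have "l (f j + (\<Sum>j\<in>J. f j)) = l (f j) + l (\<Sum>j\<in>J. f j)"
    using insert by (intro linear_on_add[OF assms(2)] cv.subspace_sum[OF assms(1)]) auto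
  moreover have "l (\<Sum>j\<in>J. f j) = (\<Sum>j\<in>J. l (f j))" using insert by auto
  ultimately show ?case by (simp only: sum.insert[OF insert.hyps])
qed (simp_all add: linear_on_zero[OF assms(1,2)])

lemma subspace_ker:
  assumes "cv.subspace W" "\<And>a. a \<in> A \<Longrightarrow> linear_on W a"
  shows "cv.subspace {v \<in> W. \<forall>a\<in>A. a v = 0}"
proof -
  have "a (u + v) = 0" if "a \<in> A" "u \<in> W" "v \<in> W" "a u = 0" "a v = 0" for a u v
    using linear_on_add[OF assms(2)[OF that(1)] that(2,3)] that by simp
  moreover have "a (cscale c u) = 0" if "a \<in> A" "u \<in> W" "a u = 0" for a u c
    using linear_on_scale[OF assms(2)[OF that(1)] that(2)] that by simp
  ultimately show ?thesis
    unfolding cv.subspace_def using assms linear_on_zero[OF assms(1)]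
    by (auto simp: cv.subspace_add cv.subspace_scale cv.subspace_0)
qed

lemma Inf_enat_in: "A \<noteq> {} \<Longrightarrow> Inf A \<in> A" for A :: "enat set"
  unfolding Inf_enat_def by (metis LeastI ex_in_conv)

text \<open>\<open>enat\<close> is well ordered, so the infimum defining \<open>codim\<close> is
  attained; a finite bound therefore yields an actual generating set.\<close>

lemma codim_le_iff: "codim W K \<le> enat m \<longleftrightarrow>
    (\<exists>B. finite B \<and> card B \<le> m \<and> B \<subseteq> W \<and> W \<subseteq> cv.span (K \<union> B))"
proof
  let ?S = "{enat (card B) |B. finite B \<and> B \<subseteq> W \<and> W \<subseteq> cv.span (K \<union> B)}"
  assume le: "codim W K \<le> enat m"
  then have "?S \<noteq> {}" unfolding codim_def Inf_enat_def by (auto split: if_splits)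
  then have "Inf ?S \<in> ?S" by (rule Inf_enat_in)
  then obtain B where "finite B \<and> B \<subseteq> W \<and> W \<subseteq> cv.span (K \<union> B)" "codim W K = enat (card B)"
    unfolding codim_def by blast
  then show "\<exists>B. finite B \<and> card B \<le> m \<and> B \<subseteq> W \<and> W \<subseteq> cv.span (K \<union> B)"
    using le by auto
next
  assume "\<exists>B. finite B \<and> card B \<le> m \<and> B \<subseteq> W \<and> W \<subseteq> cv.span (K \<union> B)"
  then obtain B where B: "finite B" "card B \<le> m" "B \<subseteq> W" "W \<subseteq> cv.span (K \<union> B)" by auto
  then have "codim W K \<le> enat (card B)" unfolding codim_def by (intro Inf_lower) auto
  also have "\<dots> \<le> enat m" using B by simp
  finally show "codim W K \<le> enat m" .
qed

lemma codim_0_iff: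
  assumes "cv.subspace K"
  shows "codim W K = 0 \<longleftrightarrow> W \<subseteq> K"
proof -
  have "cv.span K = K" using assms by (simp add: cv.span_eq_iff)
  moreover have "codim W K = 0 \<longleftrightarrow> codim W K \<le> enat 0" by (simp add: zero_enat_def[symmetric])
  moreover have "(\<exists>B. finite B \<and> card B \<le> 0 \<and> B \<subseteq> W \<and> W \<subseteq> cv.span (K \<union> B)) \<longleftrightarrow> W \<subseteq> cv.span K"
  proof
    assume "\<exists>B. finite B \<and> card B \<le> 0 \<and> B \<subseteq> W \<and> W \<subseteq> cv.span (K \<union> B)"
    then obtain B where B: "finite B" "card B \<le> 0" "W \<subseteq> cv.span (K \<union> B)" by blast
    then have "B = {}" by simp
    then show "W \<subseteq> cv.span K" using B(3) by simp
  next
    assume "W \<subseteq> cv.span K"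
    then show "\<exists>B. finite B \<and> card B \<le> 0 \<and> B \<subseteq> W \<and> W \<subseteq> cv.span (K \<union> B)"
      by (intro exI[of _ "{}"]) simp
  qed
  ultimately show ?thesis by (simp only: codim_le_iff)
qed

text \<open>The span of a subspace and one vector consists of what a multiple of the vector moves
  into the subspace. Both hyperplanes and the cotangent space m/m^2 are used in this span-free
  form.\<close>

lemma codim_1_iff:
  assumes "cv.subspace K"
  shows "codim W K = 1 \<longleftrightarrow> \<not> W \<subseteq> K \<and> (\<exists>b\<in>W. \<forall>v\<in>W. \<exists>c. v - cscale c b \<in> K)"
proof -
  have span: "v \<in> cv.span (insert b K) \<longleftrightarrow> (\<exists>c. v - cscale c b \<in> K)" for v b
    using assms by (metis cv.span_breakdown_eq cv.span_eq_iff)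
  have "codim W K = 1 \<longleftrightarrow> codim W K \<noteq> 0 \<and> codim W K \<le> enat 1"
    by (cases "codim W K") (auto simp: one_enat_def zero_enat_def)
  also have "\<dots> \<longleftrightarrow> \<not> W \<subseteq> K \<and> (\<exists>b\<in>W. W \<subseteq> cv.span (insert b K))"
  proof (cases "W \<subseteq> K")
    case False
    have "(\<exists>B. finite B \<and> card B \<le> 1 \<and> B \<subseteq> W \<and> W \<subseteq> cv.span (K \<union> B))
      \<longleftrightarrow> (\<exists>b\<in>W. W \<subseteq> cv.span (insert b K))"
    proof
      assume "\<exists>B. finite B \<and> card B \<le> 1 \<and> B \<subseteq> W \<and> W \<subseteq> cv.span (K \<union> B)"
      then obtain B where B: "finite B" "card B \<le> 1" "B \<subseteq> W" "W \<subseteq> cv.span (K \<union> B)" by auto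
      have "B \<noteq> {}" using B(4) False assms by (metis Un_empty_right cv.span_eq_iff)
      then have "card B = 1" using B(1,2) by (metis card_0_eq le_neq_implies_less less_one)
      then obtain b where "B = {b}" by (auto simp: card_1_singleton_iff)
      then show "\<exists>b\<in>W. W \<subseteq> cv.span (insert b K)" using B by auto
    next
      assume "\<exists>b\<in>W. W \<subseteq> cv.span (insert b K)"
      then obtain b where "b \<in> W" "W \<subseteq> cv.span (insert b K)" by auto
      then show "\<exists>B. finite B \<and> card B \<le> 1 \<and> B \<subseteq> W \<and> W \<subseteq> cv.span (K \<union> B)"
        by (intro exI[of _ "{b}"]) auto
    qed
    then show ?thesis using codim_le_iff[of W K 1] codim_0_iff[OF assms, of W] by auto
  qed (use codim_0_iff[OF assms, of W] in auto)
  finally show ?thesis unfolding subset_iff span Ball_def .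
qed

lemma Proj_ker:
  assumes W: "cv.subspace W" and l: "linear_on W l" and e: "e \<in> W" "l e \<noteq> 0"
  shows "{s \<in> W. l s = 0} \<in> Proj W"
proof -
  have sub: "cv.subspace {s \<in> W. l s = 0}" using subspace_ker[OF W, of "{l}"] l by simp
  have "\<exists>c. v - cscale c e \<in> {s \<in> W. l s = 0}" if "v \<in> W" for v
    by (rule exI[of _ "l v / l e"])
       (use that e in \<open>auto intro!: cv.subspace_diff cv.subspace_scale W
          simp: linear_on_diff[OF W l] linear_on_scale[OF l] cv.subspace_scale[OF W]\<close>)
  then have "codim W {s \<in> W. l s = 0} = 1" unfolding codim_1_iff[OF sub] using e by auto
  then show ?thesis using sub unfolding Proj_def by auto
qed

lemma functional_eq_0_iff:
  assumes "l \<in> functionals W y" "s \<in> W"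
  shows "l s = 0 \<longleftrightarrow> s \<in> y"
proof -
  have "{s \<in> W. l s = 0} = y" using assms(1) by (simp add: functionals_iff)
  then have "s \<in> y \<longleftrightarrow> s \<in> {s \<in> W. l s = 0}" by simp
  then show ?thesis using assms(2) by simp
qed

lemma Proj_obtain:
  assumes "y \<in> Proj W"
  obtains e where "e \<in> W" "e \<notin> y"
proof -
  have "cv.subspace y" "codim W y = 1" using assms by (auto simp: Proj_def)
  then show ?thesis using codim_1_iff[of y W] that by auto
qed

text \<open>A hyperplane and a vector \<open>b\<close> outside it span \<open>W\<close>; the
  coefficient along \<open>b\<close> is the functional. Existence matters because statements about
  all \<open>l \<in> functionals W y\<close> would otherwise be vacuous.\<close>

lemma functionals_nonempty:
  assumes W: "cv.subspace W" and y: "y \<in> Proj W"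
  shows "\<exists>l. l \<in> functionals W y"
proof -
  have sub: "cv.subspace y" "y \<subseteq> W" using y by (auto simp: Proj_def)
  obtain b where b: "b \<in> W" "\<forall>v\<in>W. \<exists>c. v - cscale c b \<in> y" "\<not> W \<subseteq> y"
    using y codim_1_iff[OF sub(1), of W] by (auto simp: Proj_def)
  have b_notin: "b \<notin> y"
  proof
    assume "b \<in> y"
    have "v \<in> y" if v: "v \<in> W" for v
    proof -
      obtain c where "v - cscale c b \<in> y" using b(2) v by auto
      then have "(v - cscale c b) + cscale c b \<in> y"
        using cv.subspace_add[OF sub(1)] cv.subspace_scale[OF sub(1) \<open>b \<in> y\<close>] by blast
      then show ?thesis by simp
    qed
    then show False using b(3) by auto
  qed
  have uniq: "c = d" if "v - cscale c b \<in> y" "v - cscale d b \<in> y" for c d v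
  proof (rule ccontr)
    assume "c \<noteq> d"
    have "(v - cscale c b) - (v - cscale d b) = cscale (d - c) b"
      by (simp add: fun_eq_iff cscale_def algebra_simps)
    then have "cscale (d - c) b \<in> y" using cv.subspace_diff[OF sub(1) that] by simp
    then have "cscale (inverse (d - c)) (cscale (d - c) b) \<in> y" by (rule cv.subspace_scale[OF sub(1)])
    moreover have "cscale (inverse (d - c)) (cscale (d - c) b) = b"
      using \<open>c \<noteq> d\<close> by (simp add: fun_eq_iff cscale_def)
    ultimately show False using b_notin by simp
  qed
  define l where "l v = (THE c. v - cscale c b \<in> y)" for v
  have l: "l v = c" if "v - cscale c b \<in> y" for v c
    unfolding l_def using that uniq by blast
  have l': "v - cscale (l v) b \<in> y" if v: "v \<in> W" for v
  proof -
    obtain c where "v - cscale c b \<in> y" using b(2) v by auto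
    then show ?thesis using l by simp
  qed
  have "l (s + t) = l s + l t" if "s \<in> W" "t \<in> W" for s t
  proof (rule l)
    have "s + t - cscale (l s + l t) b = (s - cscale (l s) b) + (t - cscale (l t) b)"
      by (simp add: fun_eq_iff cscale_def algebra_simps)
    then show "s + t - cscale (l s + l t) b \<in> y"
      using cv.subspace_add[OF sub(1) l'[OF that(1)] l'[OF that(2)]] by (simp only:)
  qed
  moreover have "l (cscale c s) = c * l s" if "s \<in> W" for c s
  proof (rule l)
    have "cscale c s - cscale (c * l s) b = cscale c (s - cscale (l s) b)"
      by (simp add: fun_eq_iff cscale_def algebra_simps)
    then show "cscale c s - cscale (c * l s) b \<in> y"
      using cv.subspace_scale[OF sub(1) l'[OF that]] by (simp only:)
  qed
  moreover have "{s \<in> W. l s = 0} = y"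
  proof -
    have [simp]: "cscale 0 b = 0" by (rule cv.scale_zero_left)
    have "l s = 0 \<longleftrightarrow> s \<in> y" if "s \<in> W" for s
      using l[of s 0] l'[OF that] by auto
    then show ?thesis using sub by auto
  qed
  ultimately show ?thesis by (intro exI[of _ l]) (auto simp: functionals_iff linear_on_def)
qed

text \<open>Subtracting from \<open>v\<close> the multiple of \<open>e\<close> with the same value
  under \<open>l\<close> lands in the common kernel. Cross multiplication keeps the case
  \<open>l e = 0\<close> in the statement.\<close>

lemma functionals_proportional:
  assumes W: "cv.subspace W" and l: "l \<in> functionals W y" and l': "l' \<in> functionals W y"
    and "v \<in> W" "e \<in> W"
  shows "l v * l' e = l' v * l e"
proof (cases "l e = 0")
  case True
  then show ?thesis using assms by (auto simp: functionals_iff)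
next
  case False
  let ?u = "v - cscale (l v / l e) e"
  have u: "?u \<in> W" using assms by (auto intro: cv.subspace_diff cv.subspace_scale)
  have lin: "linear_on W l" "linear_on W l'" using l l' by (auto simp: functionals_iff)
  have "l ?u = 0" using False assms
    by (simp add: linear_on_diff[OF W lin(1)] cv.subspace_scale[OF W] linear_on_scale[OF lin(1)])
  then have "l' ?u = 0" using u l l' by (auto simp: functionals_iff)
  then have "l' v = l v / l e * l' e" using assms
    by (simp add: linear_on_diff[OF W lin(2)] cv.subspace_scale[OF W] linear_on_scale[OF lin(2)])
  then show ?thesis using False by simp
qed

text \<open>\<open>lin\<close> reverses inclusions, so the smallest linear subspace comes from the
  largest admissible \<open>K\<close>. The factor \<open>W\<close> covers the empty
  \<open>S\<close>, which occurs as the face of a scroll with \<open>n = 1\<close>.\<close>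

lemma proj_span_eq:
  assumes W: "cv.subspace W" and S: "S \<subseteq> Proj W"
  shows "proj_span W S = lin W (W \<inter> \<Inter>S)"
proof
  have "cv.subspace (W \<inter> \<Inter>S)"
    using W S by (intro cv.subspace_inter cv.subspace_Inter) (auto simp: Proj_def)
  then have "linear_subspace W (lin W (W \<inter> \<Inter>S))" unfolding linear_subspace_def by blast
  moreover have "S \<subseteq> lin W (W \<inter> \<Inter>S)" using S by (auto simp: lin_def)
  ultimately show "proj_span W S \<subseteq> lin W (W \<inter> \<Inter>S)" unfolding proj_span_def by blast
next
  show "lin W (W \<inter> \<Inter>S) \<subseteq> proj_span W S"
    unfolding proj_span_def linear_subspace_def lin_def by blast
qed

text \<open>A vector outside \<open>K\<close> has a nonzero value under some \<open>a\<close>, whose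
  kernel is a hyperplane containing \<open>K\<close> but not the vector. Hence
  \<open>proj_dim\<close> of an osculating space becomes a codimension.\<close>

lemma Inter_lin_ker:
  assumes W: "cv.subspace W" and A: "\<And>a. a \<in> A \<Longrightarrow> linear_on W a"
  defines "K \<equiv> {v \<in> W. \<forall>a\<in>A. a v = 0}"
  shows "W \<inter> \<Inter>(lin W K) = K"
proof
  show "K \<subseteq> W \<inter> \<Inter>(lin W K)" by (auto simp: lin_def K_def)
next
  show "W \<inter> \<Inter>(lin W K) \<subseteq> K"
  proof
    fix v assume v: "v \<in> W \<inter> \<Inter>(lin W K)"
    have "a v = 0" if a: "a \<in> A" for a
    proof (rule ccontr)
      assume "a v \<noteq> 0"
      then have "{s \<in> W. a s = 0} \<in> lin W K"
        using Proj_ker[OF W A[OF a], of v] v a by (auto simp: lin_def K_def)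
      then show False using v \<open>a v \<noteq> 0\<close> by auto
    qed
    then show "v \<in> K" using v by (auto simp: K_def)
  qed
qed

section \<open>Counting linear conditions by means of a dual system\<close>

definition delta :: "'j \<Rightarrow> 'j cvec"
  where "delta j = (\<lambda>k. if k = j then 1 else 0)"

lemma sum_apply: "(\<Sum>i\<in>A. f i) x = (\<Sum>i\<in>A. f i x)" for f :: "'i \<Rightarrow> 'x cvec"
  by (induction A rule: infinite_finite_induct) simp_all

lemma inj_delta: "inj delta"
proof (rule injI)
  fix i j :: 'j
  assume "delta i = delta j"
  then have "delta i i = delta j i" by simp
  then show "i = j" by (simp add: delta_def split: if_splits)
qed

lemma independent_delta:
  assumes "finite J"
  shows "cv.independent (delta ` J)"
proof (rule cv.independent_if_scalars_zero)
  fix f :: "'a cvec \<Rightarrow> complex" and x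
  assume sum: "(\<Sum>x\<in>delta ` J. cscale (f x) x) = 0" and "x \<in> delta ` J"
  then obtain j where j: "j \<in> J" "x = delta j" by blast
  have "(\<Sum>x\<in>delta ` J. cscale (f x) x) j = (\<Sum>k\<in>J. f (delta k) * delta k j)"
    unfolding sum_apply cscale_def by (simp add: sum.reindex[OF inj_on_subset[OF inj_delta]])
  also have "\<dots> = (\<Sum>k\<in>J. if k = j then f (delta k) else 0)"
    by (intro sum.cong) (simp_all add: delta_def)
  also have "\<dots> = f (delta j)" using j(1) assms by (simp add: sum.delta)
  finally show "f x = 0" unfolding j(2) sum by simp
qed (use assms in simp)

lemma card_delta: "card (delta ` J) = card J"
  by (rule card_image) (rule inj_on_subset[OF inj_delta], simp)

text \<open>The dual vectors \<open>b\<close> show that the conditions \<open>a\<close> are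
  independent. So the codimension is \<open>card J\<close> or one more, depending on whether
  \<open>a'\<close> vanishes on their common kernel.\<close>

lemma codim_ker_le_iff:
  fixes a :: "'j \<Rightarrow> 'x cvec \<Rightarrow> complex"
  assumes W: "cv.subspace W" and J: "finite J"
    and a: "\<And>j. j \<in> J \<Longrightarrow> linear_on W (a j)" and a': "linear_on W a'"
    and b: "\<And>j. j \<in> J \<Longrightarrow> b j \<in> W"
    and dual: "\<And>j k. j \<in> J \<Longrightarrow> k \<in> J \<Longrightarrow> a j (b k) = (if j = k then 1 else 0)"
  shows "codim W {v \<in> W. (\<forall>j\<in>J. a j v = 0) \<and> a' v = 0} \<le> enat (card J) \<longleftrightarrow>
    (\<forall>v\<in>W. (\<forall>j\<in>J. a j v = 0) \<longrightarrow> a' v = 0)"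
proof
  let ?K = "{v \<in> W. (\<forall>j\<in>J. a j v = 0) \<and> a' v = 0}"
  assume vanish: "\<forall>v\<in>W. (\<forall>j\<in>J. a j v = 0) \<longrightarrow> a' v = 0"
  have "W \<subseteq> cv.span (?K \<union> b ` J)"
  proof
    fix v assume v: "v \<in> W"
    let ?s = "\<Sum>j\<in>J. cscale (a j v) (b j)"
    have s: "?s \<in> W" using b W by (intro cv.subspace_sum cv.subspace_scale)
    have vs: "v - ?s \<in> W" using v s W by (rule_tac cv.subspace_diff)
    have "a j (v - ?s) = 0" if j: "j \<in> J" for j
    proof -
      have "a j ?s = (\<Sum>k\<in>J. a k v * a j (b k))"
        using linear_on_sum[OF W a[OF j], of J "\<lambda>k. cscale (a k v) (b k)"] b
        by (simp add: linear_on_scale[OF a[OF j]] cv.subspace_scale[OF W])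
      also have "\<dots> = (\<Sum>k\<in>J. if j = k then a k v else 0)"
        using dual j by (intro sum.cong) auto
      also have "\<dots> = a j v" using J j by simp
      finally show ?thesis using linear_on_diff[OF W a[OF j] v s] by simp
    qed
    then have "v - ?s \<in> ?K" using vs vanish by auto
    then have "v - ?s \<in> cv.span (?K \<union> b ` J)" by (intro cv.span_base) auto
    moreover have "?s \<in> cv.span (?K \<union> b ` J)"
      by (intro cv.span_sum cv.span_scale cv.span_base) auto
    ultimately have "(v - ?s) + ?s \<in> cv.span (?K \<union> b ` J)" by (rule cv.span_add)
    then show "v \<in> cv.span (?K \<union> b ` J)" by simp
  qed
  then show "codim W ?K \<le> enat (card J)"
    unfolding codim_le_iff using J b card_image_le[OF J] by (intro exI[of _ "b ` J"]) auto
next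
  let ?K = "{v \<in> W. (\<forall>j\<in>J. a j v = 0) \<and> a' v = 0}"
  assume "codim W ?K \<le> enat (card J)"
  then obtain B where B: "finite B" "card B \<le> card J" "B \<subseteq> W" "W \<subseteq> cv.span (?K \<union> B)"
    unfolding codim_le_iff by auto
  show "\<forall>v\<in>W. (\<forall>j\<in>J. a j v = 0) \<longrightarrow> a' v = 0"
  proof (rule ccontr)
    assume "\<not> ?thesis"
    then obtain v0 where v0: "v0 \<in> W" "\<forall>j\<in>J. a j v0 = 0" "a' v0 \<noteq> 0" by auto
    \<comment> \<open>All conditions become one coordinate vector, with \<open>None\<close> for
      \<open>a'\<close>. Entries \<open>Some j\<close> with \<open>j \<notin> J\<close> are set to 0
      so that \<open>A\<close> kills \<open>?K\<close>; the images of \<open>B\<close> then span all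
      values of \<open>A\<close>, among them \<open>card J + 1\<close> unit vectors.\<close>
    define A where "A v = (\<lambda>k. case k of None \<Rightarrow> a' v | Some j \<Rightarrow> if j \<in> J then a j v else 0)" for v
    have A_add: "A (u + v) = A u + A v" if "u \<in> W" "v \<in> W" for u v
      using linear_on_add[OF a that] linear_on_add[OF a' that]
      by (auto simp: A_def fun_eq_iff split: option.splits)
    have A_scale: "A (cscale c v) = cscale c (A v)" if "v \<in> W" for c v
      using linear_on_scale[OF a that] linear_on_scale[OF a' that]
      by (auto simp: A_def fun_eq_iff cscale_apply split: option.splits)
    have sub: "cv.subspace {v \<in> W. A v \<in> cv.span (A ` B)}"
    proof -
      have "A 0 = 0" using A_scale[of 0 0] cv.subspace_0[OF W] by simp
      then show ?thesis unfolding cv.subspace_def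
        using W by (auto simp: cv.subspace_0 cv.subspace_add cv.subspace_scale A_add A_scale
            cv.span_zero cv.span_add cv.span_scale)
    qed
    have "?K \<union> B \<subseteq> {v \<in> W. A v \<in> cv.span (A ` B)}"
    proof -
      have "A v = 0" if "v \<in> ?K" for v
        using that by (auto simp: A_def fun_eq_iff split: option.splits)
      then show ?thesis using B by (auto simp: cv.span_zero cv.span_base)
    qed
    then have AW: "A v \<in> cv.span (A ` B)" if "v \<in> W" for v
      using cv.span_minimal[OF _ sub] B(4) that by blast
    \<comment> \<open>The scaled \<open>v0\<close>, killed by every \<open>a j\<close>, yields the
      unit vector of \<open>a'\<close>, which then serves to clear the \<open>None\<close> entry of
      each \<open>A (b j)\<close>.\<close>
    have "delta None = A (cscale (1 / a' v0) v0)"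
      using v0 by (auto simp: delta_def A_def fun_eq_iff linear_on_scale[OF a'] linear_on_scale[OF a] split: option.splits)
    then have None: "delta None \<in> cv.span (A ` B)" using AW v0 W by (simp add: cv.subspace_scale)
    have Some: "delta (Some j) \<in> cv.span (A ` B)" if j: "j \<in> J" for j
    proof -
      have "A (b j) = delta (Some j) + cscale (a' (b j)) (delta None)"
        using dual j by (auto simp: delta_def A_def fun_eq_iff cscale_def split: option.splits)
      then have "delta (Some j) = A (b j) - cscale (a' (b j)) (delta None)" by simp
      then show ?thesis using AW[OF b[OF j]] None by (simp add: cv.span_diff cv.span_scale)
    qed
    let ?O = "insert None (Some ` J)"
    have "card (delta ` ?O) \<le> card (A ` B)"
      using cv.independent_span_bound[of "A ` B" "delta ` ?O"] independent_delta[of ?O] None Some B(1) J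
      by auto
    moreover have "card (delta ` ?O) = Suc (card J)"
      using card_delta[of ?O] J by (simp add: card_image)
    ultimately show False using card_image_le[OF B(1), of A] B(2) by simp
  qed
qed

text \<open>The offset between projective and vector space dimension turns the strict inequality of
  \<open>infl_locus\<close> into a weak one for \<open>codim\<close>.\<close>

lemma ereal_of_enat_minus_1_less_iff:
  "ereal_of_enat k - 1 < ereal (real m) \<longleftrightarrow> k \<le> enat m"
proof (cases k)
  case (enat i)
  have "ereal (real i) - 1 = ereal (real i - 1)" by (simp add: one_ereal_def)
  then show ?thesis using enat by auto
qed simp

text \<open>Applied to a curve, with the conditions of orders 0 and 1, and to the scroll, with these
  two conditions for each summand. Each time \<open>a'\<close> is the condition of order 2.\<close>

lemma mem_infl_locus_iff:
  fixes a :: "'j \<Rightarrow> 'x cvec \<Rightarrow> complex"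
  assumes W: "cv.subspace W" and J: "finite J" "card J = n * k" and y: "y \<in> Y"
    and a: "\<And>j. j \<in> J \<Longrightarrow> linear_on W (a j)" and a': "linear_on W a'"
    and b: "\<And>j. j \<in> J \<Longrightarrow> b j \<in> W"
    and dual: "\<And>j k. j \<in> J \<Longrightarrow> k \<in> J \<Longrightarrow> a j (b k) = (if j = k then 1 else 0)"
    and ker: "jet_ker W Y k y = {v \<in> W. (\<forall>j\<in>J. a j v = 0) \<and> a' v = 0}"
  shows "y \<in> infl_locus W n Y k \<longleftrightarrow> (\<forall>v\<in>W. (\<forall>j\<in>J. a j v = 0) \<longrightarrow> a' v = 0)"
proof -
  have K: "jet_ker W Y k y = {v \<in> W. \<forall>c\<in>insert a' (a ` J). c v = 0}" unfolding ker by auto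
  have "W \<inter> \<Inter>(lin W (jet_ker W Y k y)) = jet_ker W Y k y"
    unfolding K by (rule Inter_lin_ker[OF W]) (use a a' in auto)
  then have "proj_dim W (Osc W Y k y) = ereal_of_enat (codim W (jet_ker W Y k y)) - 1"
    by (simp add: proj_dim_def Osc_def)
  then have "y \<in> infl_locus W n Y k \<longleftrightarrow> codim W (jet_ker W Y k y) \<le> enat (card J)"
    unfolding infl_locus_def using y J
    by (simp add: ereal_of_enat_minus_1_less_iff del: of_nat_mult)
  also have "\<dots> \<longleftrightarrow> (\<forall>v\<in>W. (\<forall>j\<in>J. a j v = 0) \<longrightarrow> a' v = 0)"
    unfolding ker by (rule codim_ker_le_iff[OF W J(1) a a' b dual])
  finally show ?thesis .
qed

section \<open>Rings of germs of functions\<close>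

text \<open>Powers of the maximal ideal at \<open>y\<close>, relative to a ring \<open>R\<close> of
  functions and a filter \<open>F\<close> standing for the neighbourhoods. Germs are represented by
  functions, with identities holding eventually; one theory thus serves \<open>C\<close>, its
  projective images and the scroll.\<close>

primrec mpow :: "('y \<Rightarrow> complex) set \<Rightarrow> 'y filter \<Rightarrow> 'y \<Rightarrow> nat \<Rightarrow> ('y \<Rightarrow> complex) set" where
  "mpow R F y 0 = R"
| "mpow R F y (Suc k) = {h. \<exists>(r::nat) f g.
     (\<forall>i<r. f i \<in> R \<and> f i y = 0 \<and> g i \<in> mpow R F y k) \<and>
     (\<forall>\<^sub>F z in F. h z = (\<Sum>i<r. f i z * g i z))}"

declare mpow.simps(2) [simp del]

lemma mpow_SucI:
  fixes r :: nat
  assumes "\<forall>\<^sub>F z in F. h z = (\<Sum>i<r. f i z * g i z)"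
    and "\<forall>i<r. f i \<in> R \<and> f i y = 0 \<and> g i \<in> mpow R F y k"
  shows "h \<in> mpow R F y (Suc k)"
  using assms unfolding mpow.simps(2)
  by (intro CollectI exI[of _ r] exI[of _ f] exI[of _ g] conjI)

lemma mpow_SucE:
  assumes "h \<in> mpow R F y (Suc k)"
  obtains r :: nat and f g where "\<forall>i<r. f i \<in> R \<and> f i y = 0 \<and> g i \<in> mpow R F y k"
    and "\<forall>\<^sub>F z in F. h z = (\<Sum>i<r. f i z * g i z)"
  using assms unfolding mpow.simps(2) by blast

text \<open>Sums of products pull back term by term. The instances are the embedding of
  \<open>C\<close>, its inverse, curves in the scroll, and the projection of the scroll.\<close>

lemma mpow_pullback:
  assumes R: "\<And>f. f \<in> RB \<Longrightarrow> f \<circ> \<sigma> \<in> RA"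
    and ev: "\<And>P. eventually P FB \<Longrightarrow> eventually (\<lambda>q. P (\<sigma> q)) FA"
    and "\<sigma> a = b"
  shows "f \<in> mpow RB FB b k \<Longrightarrow> f \<circ> \<sigma> \<in> mpow RA FA a k"
proof (induction k arbitrary: f)
  case (Suc k)
  obtain r :: nat and u v where uv: "\<forall>i<r. u i \<in> RB \<and> u i b = 0 \<and> v i \<in> mpow RB FB b k"
    and f: "\<forall>\<^sub>F z in FB. f z = (\<Sum>i<r. u i z * v i z)"
    using Suc.prems by (rule mpow_SucE)
  have "\<forall>i<r. u i \<circ> \<sigma> \<in> RA \<and> (u i \<circ> \<sigma>) a = 0 \<and> v i \<circ> \<sigma> \<in> mpow RA FA a k"
    using uv R Suc.IH \<open>\<sigma> a = b\<close> by (auto simp del: comp_apply) (simp add: comp_def)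
  moreover have "\<forall>\<^sub>F q in FA. (f \<circ> \<sigma>) q = (\<Sum>i<r. (u i \<circ> \<sigma>) q * (v i \<circ> \<sigma>) q)"
    using ev[OF f] by simp
  ultimately show ?case by (intro mpow_SucI)
qed (use R in simp)

text \<open>\<open>R_inverse\<close> and \<open>R_nonzero\<close> make every germ with nonzero value
  at \<open>y\<close> a unit, so the ring is local. \<open>at_point\<close> says that neighbourhoods
  contain \<open>y\<close>, so that the value at \<open>y\<close> depends only on the germ.\<close>

locale germ_ring =
  fixes R :: "('y \<Rightarrow> complex) set" and F :: "'y filter" and y :: 'y
  assumes R_const: "(\<lambda>_. c) \<in> R"
    and R_add: "f \<in> R \<Longrightarrow> g \<in> R \<Longrightarrow> (\<lambda>z. f z + g z) \<in> R"
    and R_mult: "f \<in> R \<Longrightarrow> g \<in> R \<Longrightarrow> (\<lambda>z. f z * g z) \<in> R"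
    and R_inverse: "f \<in> R \<Longrightarrow> f y \<noteq> 0 \<Longrightarrow> (\<lambda>z. inverse (f z)) \<in> R"
    and R_cong: "f \<in> R \<Longrightarrow> \<forall>\<^sub>F z in F. f z = g z \<Longrightarrow> g \<in> R"
    and R_nonzero: "f \<in> R \<Longrightarrow> f y \<noteq> 0 \<Longrightarrow> \<forall>\<^sub>F z in F. f z \<noteq> 0"
    and at_point: "eventually P F \<Longrightarrow> P y"
begin

abbreviation M :: "nat \<Rightarrow> ('y \<Rightarrow> complex) set" where "M \<equiv> mpow R F y"

lemma R_scale: "f \<in> R \<Longrightarrow> (\<lambda>z. c * f z) \<in> R"
  using R_mult[OF R_const] .

lemma R_diff: "f \<in> R \<Longrightarrow> g \<in> R \<Longrightarrow> (\<lambda>z. f z - g z) \<in> R"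
  using R_add[of f "\<lambda>z. - 1 * g z"] R_scale[of g "- 1"] by simp

lemma R_sum: "(\<And>i. i \<in> A \<Longrightarrow> f i \<in> R) \<Longrightarrow> (\<lambda>z. \<Sum>i\<in>A. f i z) \<in> R"
proof (induction A rule: infinite_finite_induct)
  case (insert x A)
  then show ?case using R_add[of "f x" "\<lambda>z. \<Sum>i\<in>A. f i z"] by simp
qed (auto intro: R_const)

lemma M_cong:
  assumes "f \<in> M k" "\<forall>\<^sub>F z in F. f z = g z"
  shows "g \<in> M k"
proof (cases k)
  case 0
  then show ?thesis using assms R_cong by auto
next
  case (Suc l)
  obtain r :: nat and u v where uv: "\<forall>i<r. u i \<in> R \<and> u i y = 0 \<and> v i \<in> M l"
    and f: "\<forall>\<^sub>F z in F. f z = (\<Sum>i<r. u i z * v i z)"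
    using assms(1)[unfolded Suc] by (rule mpow_SucE)
  have "\<forall>\<^sub>F z in F. g z = (\<Sum>i<r. u i z * v i z)"
    using f assms(2) by eventually_elim simp
  then show ?thesis unfolding Suc using uv by (rule mpow_SucI)
qed

lemma M_subset_R: "f \<in> M k \<Longrightarrow> f \<in> R"
proof (induction k arbitrary: f)
  case (Suc k)
  obtain r :: nat and u v where uv: "\<forall>i<r. u i \<in> R \<and> u i y = 0 \<and> v i \<in> M k"
    and f: "\<forall>\<^sub>F z in F. f z = (\<Sum>i<r. u i z * v i z)"
    using Suc.prems by (rule mpow_SucE)
  have "(\<lambda>z. \<Sum>i<r. u i z * v i z) \<in> R"
    using uv Suc.IH by (intro R_sum R_mult) auto
  then show ?case by (rule R_cong) (use f in \<open>auto elim: eventually_mono\<close>)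
qed simp

lemma M_add:
  assumes "f \<in> M k" "g \<in> M k"
  shows "(\<lambda>z. f z + g z) \<in> M k"
proof (cases k)
  case 0
  then show ?thesis using assms R_add by auto
next
  case (Suc l)
  obtain r :: nat and u v where uv: "\<forall>i<r. u i \<in> R \<and> u i y = 0 \<and> v i \<in> M l"
    and f: "\<forall>\<^sub>F z in F. f z = (\<Sum>i<r. u i z * v i z)"
    using assms(1)[unfolded Suc] by (rule mpow_SucE)
  obtain r' :: nat and u' v' where uv': "\<forall>i<r'. u' i \<in> R \<and> u' i y = 0 \<and> v' i \<in> M l"
    and g: "\<forall>\<^sub>F z in F. g z = (\<Sum>i<r'. u' i z * v' i z)"
    using assms(2)[unfolded Suc] by (rule mpow_SucE)
  \<comment> \<open>The two sums of products are concatenated, the second one shifted by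
    \<open>r\<close>.\<close>
  let ?u = "\<lambda>i. if i < r then u i else u' (i - r)" and ?v = "\<lambda>i. if i < r then v i else v' (i - r)"
  have "(\<Sum>i<r + r'. ?u i z * ?v i z) = (\<Sum>i<r. u i z * v i z) + (\<Sum>i<r'. u' i z * v' i z)" for z
  proof -
    have "(\<Sum>i<r + n. ?u i z * ?v i z) = (\<Sum>i<r. u i z * v i z) + (\<Sum>i<n. u' i z * v' i z)" for n
      by (induction n) (auto simp: add.assoc)
    then show ?thesis .
  qed
  then have "\<forall>\<^sub>F z in F. f z + g z = (\<Sum>i<r + r'. ?u i z * ?v i z)"
    using f g by (auto elim: eventually_elim2)
  moreover have "\<forall>i<r + r'. ?u i \<in> R \<and> ?u i y = 0 \<and> ?v i \<in> M l"
    using uv uv' by auto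
  ultimately show ?thesis unfolding Suc by (rule mpow_SucI)
qed

lemma M_mult: "a \<in> R \<Longrightarrow> f \<in> M k \<Longrightarrow> (\<lambda>z. a z * f z) \<in> M k"
proof (induction k arbitrary: f)
  case (Suc k)
  obtain r :: nat and u v where uv: "\<forall>i<r. u i \<in> R \<and> u i y = 0 \<and> v i \<in> M k"
    and f: "\<forall>\<^sub>F z in F. f z = (\<Sum>i<r. u i z * v i z)"
    using Suc.prems(2) by (rule mpow_SucE)
  have "\<forall>\<^sub>F z in F. a z * f z = (\<Sum>i<r. u i z * (a z * v i z))"
    using f by eventually_elim (simp add: sum_distrib_left mult.left_commute)
  moreover have "\<forall>i<r. u i \<in> R \<and> u i y = 0 \<and> (\<lambda>z. a z * v i z) \<in> M k"
    using uv Suc by auto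
  ultimately show ?case by (rule mpow_SucI)
qed (use R_mult in auto)

lemma M_zero: "(\<lambda>_. 0) \<in> M k"
proof (cases k)
  case (Suc l)
  show ?thesis unfolding Suc by (rule mpow_SucI[where r = 0]) auto
qed (use R_const in auto)

lemma M_eventually_zero: "\<forall>\<^sub>F z in F. f z = 0 \<Longrightarrow> f \<in> M k"
  by (rule M_cong[OF M_zero]) (auto elim: eventually_mono)

lemma M_sum: "(\<And>i. i \<in> A \<Longrightarrow> f i \<in> M k) \<Longrightarrow> (\<lambda>z. \<Sum>i\<in>A. f i z) \<in> M k"
proof (induction A rule: infinite_finite_induct)
  case (insert x A)
  then show ?case using M_add[of "f x" k "\<lambda>z. \<Sum>i\<in>A. f i z"] by simp
qed (auto simp: M_zero)

lemma M_scale: "f \<in> M k \<Longrightarrow> (\<lambda>z. c * f z) \<in> M k"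
  using M_mult[OF R_const] .

lemma M_diff: "f \<in> M k \<Longrightarrow> g \<in> M k \<Longrightarrow> (\<lambda>z. f z - g z) \<in> M k"
  using M_add[of f k "\<lambda>z. - 1 * g z"] M_scale[of g k "- 1"] by simp

lemma M_SucI: "f \<in> R \<Longrightarrow> f y = 0 \<Longrightarrow> g \<in> M k \<Longrightarrow> (\<lambda>z. f z * g z) \<in> M (Suc k)"
  by (rule mpow_SucI[where r = 1 and f = "\<lambda>_. f" and g = "\<lambda>_. g"]) auto

lemma M_SucD: "f \<in> M (Suc k) \<Longrightarrow> f \<in> M k"
proof -
  assume "f \<in> M (Suc k)"
  then obtain r :: nat and u v where uv: "\<forall>i<r. u i \<in> R \<and> u i y = 0 \<and> v i \<in> M k"
    and f: "\<forall>\<^sub>F z in F. f z = (\<Sum>i<r. u i z * v i z)"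
    by (rule mpow_SucE)
  have "(\<lambda>z. \<Sum>i<r. u i z * v i z) \<in> M k"
    using uv by (intro M_sum M_mult) auto
  then show ?thesis by (rule M_cong) (use f in \<open>auto elim: eventually_mono\<close>)
qed

lemma M_1: "f \<in> M (Suc 0) \<longleftrightarrow> f \<in> R \<and> f y = 0"
proof
  assume f: "f \<in> M (Suc 0)"
  then obtain r :: nat and u v where uv: "\<forall>i<r. u i \<in> R \<and> u i y = 0 \<and> v i \<in> M 0"
    and *: "\<forall>\<^sub>F z in F. f z = (\<Sum>i<r. u i z * v i z)"
    by (rule mpow_SucE)
  show "f \<in> R \<and> f y = 0"
    using M_subset_R[OF f] at_point[OF *] uv by simp
next
  assume "f \<in> R \<and> f y = 0"
  then show "f \<in> M (Suc 0)"
    using M_SucI[of f "\<lambda>_. 1" 0] R_const[of 1] by simp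
qed

lemma M_2_le_1: "f \<in> M 2 \<Longrightarrow> f \<in> M (Suc 0)"
  using M_SucD by (simp add: numeral_2_eq_2)

lemma M_3_le_2: "f \<in> M 3 \<Longrightarrow> f \<in> M 2"
  using M_SucD by (simp add: numeral_2_eq_2 numeral_3_eq_3)

text \<open>Elimination of one generator at a time: the relation for \<open>x\<close> can be solved
  for \<open>x\<close> because \<open>1 - a x\<close> is a unit, and the solution is substituted
  into the remaining relations.\<close>

lemma nakayama:
  assumes "finite X" "t \<in> R" "X \<subseteq> R"
    and "\<And>x. x \<in> X \<Longrightarrow> \<exists>c\<in>R. \<exists>a. (\<forall>x'\<in>X. a x' \<in> R \<and> a x' y = 0) \<and>
           (\<forall>\<^sub>F z in F. x z = c z * t z + (\<Sum>x'\<in>X. a x' z * x' z))"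
  shows "\<forall>x\<in>X. \<exists>c\<in>R. \<forall>\<^sub>F z in F. x z = c z * t z"
  using assms
proof (induction X rule: finite_induct)
  case (insert x X)
  obtain c a where c: "c \<in> R" and a: "\<forall>x'\<in>insert x X. a x' \<in> R \<and> a x' y = 0"
    and x: "\<forall>\<^sub>F z in F. x z = c z * t z + (\<Sum>x'\<in>insert x X. a x' z * x' z)"
    using insert.prems(3)[of x] by auto
  define u where "u = (\<lambda>z. inverse (1 - a x z))"
  have 1: "(\<lambda>z. 1 - a x z) \<in> R" using R_diff[OF R_const[of 1], of "a x"] a by auto
  have u: "u \<in> R" unfolding u_def using a by (intro R_inverse[OF 1]) auto
  have nz: "\<forall>\<^sub>F z in F. 1 - a x z \<noteq> 0" using a by (intro R_nonzero[OF 1]) auto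
  have x': "\<forall>\<^sub>F z in F. x z = (u z * c z) * t z + (\<Sum>x'\<in>X. (u z * a x' z) * x' z)"
    using x nz
  proof eventually_elim
    case (elim z)
    have "(1 - a x z) * x z = c z * t z + (\<Sum>x'\<in>X. a x' z * x' z)"
      using elim(1) insert.hyps by (simp add: algebra_simps)
    then have "u z * ((1 - a x z) * x z) = u z * (c z * t z + (\<Sum>x'\<in>X. a x' z * x' z))"
      by simp
    moreover have "u z * ((1 - a x z) * x z) = x z" using elim(2) by (simp add: u_def)
    ultimately show ?case by (simp add: algebra_simps sum_distrib_left)
  qed
  have "\<exists>c\<in>R. \<exists>a. (\<forall>x'\<in>X. a x' \<in> R \<and> a x' y = 0) \<and>
      (\<forall>\<^sub>F z in F. x1 z = c z * t z + (\<Sum>x'\<in>X. a x' z * x' z))" if x1: "x1 \<in> X" for x1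
  proof -
    obtain c1 a1 where c1: "c1 \<in> R" and a1: "\<forall>x'\<in>insert x X. a1 x' \<in> R \<and> a1 x' y = 0"
      and ev: "\<forall>\<^sub>F z in F. x1 z = c1 z * t z + (\<Sum>x'\<in>insert x X. a1 x' z * x' z)"
      using insert.prems(3)[of x1] x1 by auto
    have "\<forall>\<^sub>F z in F. x1 z = (c1 z + a1 x z * (u z * c z)) * t z +
        (\<Sum>x'\<in>X. (a1 x' z + a1 x z * (u z * a x' z)) * x' z)"
      using ev x'
    proof eventually_elim
      case (elim z)
      have "x1 z = c1 z * t z + a1 x z * x z + (\<Sum>x'\<in>X. a1 x' z * x' z)"
        using elim(1) insert.hyps by simp
      also have "a1 x z * x z = a1 x z * ((u z * c z) * t z + (\<Sum>x'\<in>X. (u z * a x' z) * x' z))"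
        using elim(2) by simp
      finally show ?case
        by (simp add: algebra_simps sum_distrib_left sum.distrib)
    qed
    moreover have "(\<lambda>z. c1 z + a1 x z * (u z * c z)) \<in> R"
      using c1 a1 u c by (intro R_add R_mult) auto
    \<comment> \<open>The induction hypothesis needs coefficients that vanish at \<open>y\<close>;
      after the substitution each summand still contains a factor that does.\<close>
    moreover have "\<forall>x'\<in>X. (\<lambda>z. a1 x' z + a1 x z * (u z * a x' z)) \<in> R \<and>
        a1 x' y + a1 x y * (u y * a x' y) = 0"
      using a1 a u by (auto intro!: R_add R_mult)
    ultimately show ?thesis
      by (intro bexI[of _ "\<lambda>z. c1 z + a1 x z * (u z * c z)"]
          exI[of _ "\<lambda>x' z. a1 x' z + a1 x z * (u z * a x' z)"]) auto
  qed
  then have IH: "\<forall>x\<in>X. \<exists>c\<in>R. \<forall>\<^sub>F z in F. x z = c z * t z"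
    using insert by auto
  then obtain d where d: "\<forall>x\<in>X. d x \<in> R \<and> (\<forall>\<^sub>F z in F. x z = d x z * t z)"
    by metis
  have "\<forall>\<^sub>F z in F. \<forall>x\<in>X. x z = d x z * t z"
    using d insert.hyps by (simp add: eventually_ball_finite_distrib)
  with x' have "\<forall>\<^sub>F z in F. x z = (u z * c z + (\<Sum>x'\<in>X. u z * a x' z * d x' z)) * t z"
  proof eventually_elim
    case (elim z)
    have "(\<Sum>x'\<in>X. (u z * a x' z) * x' z) = (\<Sum>x'\<in>X. u z * a x' z * d x' z) * t z"
      unfolding sum_distrib_right by (intro sum.cong) (use elim(2) in auto)
    then show ?case using elim(1) by (simp add: algebra_simps)
  qed
  moreover have "(\<lambda>z. u z * c z + (\<Sum>x'\<in>X. u z * a x' z * d x' z)) \<in> R"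
    using u c a d by (intro R_add R_mult R_sum) auto
  ultimately have "\<exists>c\<in>R. \<forall>\<^sub>F z in F. x z = c z * t z"
    by (intro bexI[of _ "\<lambda>z. u z * c z + (\<Sum>x'\<in>X. u z * a x' z * d x' z)"]) auto
  with IH show ?case by auto
qed auto

text \<open>Since \<open>t\<close> spans m/m^2, each generator is a multiple of \<open>t\<close>
  plus an element of m^2. The latter is a combination of the generators with coefficients in m, as
  \<open>nakayama\<close> requires.\<close>

lemma principal_max_ideal:
  assumes X: "finite X" "X \<subseteq> M (Suc 0)"
    and gen: "\<And>f. f \<in> M (Suc 0) \<Longrightarrow>
      \<exists>a. (\<forall>x\<in>X. a x \<in> R) \<and> (\<forall>\<^sub>F z in F. f z = (\<Sum>x\<in>X. a x z * x z))"
    and t: "t \<in> R" "\<And>f. f \<in> M (Suc 0) \<Longrightarrow> \<exists>c. (\<lambda>z. f z - c * t z) \<in> M 2"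
    and f: "f \<in> M (Suc 0)"
  shows "\<exists>c\<in>R. \<forall>\<^sub>F z in F. f z = c z * t z"
proof -
  have "\<forall>x\<in>X. \<exists>c\<in>R. \<forall>\<^sub>F z in F. x z = c z * t z"
  proof (rule nakayama)
    fix x assume "x \<in> X"
    then obtain c where "(\<lambda>z. x z - c * t z) \<in> M (Suc (Suc 0))"
      using t(2)[of x] X by (auto simp: numeral_2_eq_2)
    then obtain r :: nat and u v where uv: "\<forall>i<r. u i \<in> R \<and> u i y = 0 \<and> v i \<in> M (Suc 0)"
      and x: "\<forall>\<^sub>F z in F. x z - c * t z = (\<Sum>i<r. u i z * v i z)"
      by (rule mpow_SucE)
    have "\<forall>i\<in>{..<r}. \<exists>a. (\<forall>x\<in>X. a x \<in> R) \<and> (\<forall>\<^sub>F z in F. v i z = (\<Sum>x\<in>X. a x z * x z))"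
      using uv gen by auto
    from bchoice[OF this] obtain a where a: "\<forall>i\<in>{..<r}. (\<forall>x\<in>X. a i x \<in> R) \<and>
        (\<forall>\<^sub>F z in F. v i z = (\<Sum>x\<in>X. a i x z * x z))"
      by (rule exE)
    then have "\<forall>\<^sub>F z in F. \<forall>i\<in>{..<r}. v i z = (\<Sum>x\<in>X. a i x z * x z)"
      by (simp add: eventually_ball_finite_distrib)
    with x have "\<forall>\<^sub>F z in F. x z = c * t z + (\<Sum>x\<in>X. (\<Sum>i<r. u i z * a i x z) * x z)"
    proof eventually_elim
      case (elim z)
      have "(\<Sum>i<r. u i z * v i z) = (\<Sum>i<r. u i z * (\<Sum>x\<in>X. a i x z * x z))"
        using elim(2) by auto
      also have "\<dots> = (\<Sum>i<r. \<Sum>x\<in>X. u i z * a i x z * x z)"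
        by (simp add: sum_distrib_left mult.assoc)
      also have "\<dots> = (\<Sum>x\<in>X. (\<Sum>i<r. u i z * a i x z) * x z)"
        by (subst sum.swap) (simp add: sum_distrib_right)
      finally show ?case using elim(1) by (simp add: algebra_simps)
    qed
    moreover have "\<forall>x\<in>X. (\<lambda>z. \<Sum>i<r. u i z * a i x z) \<in> R \<and> (\<Sum>i<r. u i y * a i x y) = 0"
      using uv a by (auto intro!: R_sum R_mult)
    ultimately show "\<exists>c\<in>R. \<exists>a. (\<forall>x'\<in>X. a x' \<in> R \<and> a x' y = 0) \<and>
        (\<forall>\<^sub>F z in F. x z = c z * t z + (\<Sum>x'\<in>X. a x' z * x' z))"
      by (intro bexI[of _ "\<lambda>_. c"] exI[of _ "\<lambda>x z. \<Sum>i<r. u i z * a i x z"]) (auto simp: R_const)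
  qed (use X t M_subset_R in auto)
  then obtain d where d: "\<forall>x\<in>X. d x \<in> R \<and> (\<forall>\<^sub>F z in F. x z = d x z * t z)"
    by metis
  obtain a where a: "\<forall>x\<in>X. a x \<in> R" and ev: "\<forall>\<^sub>F z in F. f z = (\<Sum>x\<in>X. a x z * x z)"
    using gen[OF f] by auto
  have "\<forall>\<^sub>F z in F. \<forall>x\<in>X. x z = d x z * t z"
    using d X by (simp add: eventually_ball_finite_distrib)
  with ev have "\<forall>\<^sub>F z in F. f z = (\<Sum>x\<in>X. a x z * d x z) * t z"
  proof eventually_elim
    case (elim z)
    have "(\<Sum>x\<in>X. a x z * x z) = (\<Sum>x\<in>X. a x z * d x z) * t z"
      unfolding sum_distrib_right by (intro sum.cong) (use elim(2) in auto)
    then show ?case using elim(1) by simp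
  qed
  moreover have "(\<lambda>z. \<Sum>x\<in>X. a x z * d x z) \<in> R"
    using a d by (intro R_mult R_sum) auto
  ultimately show ?thesis
    by (intro bexI[of _ "\<lambda>z. \<Sum>x\<in>X. a x z * d x z"]) auto
qed

end

section \<open>Taylor coefficients up to order 2 with respect to a uniformizer\<close>

locale uniformized_germ_ring = germ_ring +
  fixes t
  assumes t_max: "t \<in> M (Suc 0)" and t_not_M2: "t \<notin> M 2"
    and t_generates: "f \<in> M (Suc 0) \<Longrightarrow> \<exists>c\<in>R. \<forall>\<^sub>F z in F. f z = c z * t z"
begin

lemma t_R: "t \<in> R" and t_0: "t y = 0"
  using t_max by (simp_all add: M_1)

lemma t_power_M: "(\<lambda>z. t z ^ k) \<in> M k"
proof (induction k)
  case (Suc k)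
  then show ?case using M_SucI[OF t_R t_0 Suc] by simp
qed (simp add: R_const)

lemma M_iff: "f \<in> M k \<longleftrightarrow> (\<exists>c\<in>R. \<forall>\<^sub>F z in F. f z = c z * t z ^ k)"
proof
  show "f \<in> M k \<Longrightarrow> \<exists>c\<in>R. \<forall>\<^sub>F z in F. f z = c z * t z ^ k"
  proof (induction k arbitrary: f)
    case 0
    then show ?case by (intro bexI[of _ f]) auto
  next
    case (Suc k)
    obtain r :: nat and u v where uv: "\<forall>i<r. u i \<in> R \<and> u i y = 0 \<and> v i \<in> M k"
      and f: "\<forall>\<^sub>F z in F. f z = (\<Sum>i<r. u i z * v i z)"
      using Suc.prems by (rule mpow_SucE)
    have "\<forall>i\<in>{..<r}. \<exists>c\<in>R. \<forall>\<^sub>F z in F. u i z = c z * t z"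
      using uv t_generates M_1 by blast
    then obtain a where a: "\<forall>i\<in>{..<r}. a i \<in> R \<and> (\<forall>\<^sub>F z in F. u i z = a i z * t z)"
      by metis
    have "\<forall>i\<in>{..<r}. \<exists>c\<in>R. \<forall>\<^sub>F z in F. v i z = c z * t z ^ k"
      using uv Suc.IH by blast
    then obtain b where b: "\<forall>i\<in>{..<r}. b i \<in> R \<and> (\<forall>\<^sub>F z in F. v i z = b i z * t z ^ k)"
      by metis
    have "\<forall>\<^sub>F z in F. \<forall>i\<in>{..<r}. u i z = a i z * t z" "\<forall>\<^sub>F z in F. \<forall>i\<in>{..<r}. v i z = b i z * t z ^ k"
      using a b by (simp_all add: eventually_ball_finite_distrib)
    with f have "\<forall>\<^sub>F z in F. f z = (\<Sum>i<r. a i z * b i z) * t z ^ Suc k"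
    proof eventually_elim
      case (elim z)
      have "(\<Sum>i<r. u i z * v i z) = (\<Sum>i<r. a i z * b i z) * t z ^ Suc k"
        unfolding sum_distrib_right by (intro sum.cong) (use elim(2,3) in \<open>auto simp: mult_ac\<close>)
      then show ?case using elim(1) by simp
    qed
    moreover have "(\<lambda>z. \<Sum>i<r. a i z * b i z) \<in> R"
      using a b by (intro R_sum R_mult) auto
    ultimately show ?case by (intro bexI[of _ "\<lambda>z. \<Sum>i<r. a i z * b i z"]) auto
  qed
next
  assume "\<exists>c\<in>R. \<forall>\<^sub>F z in F. f z = c z * t z ^ k"
  then obtain c where "c \<in> R" and f: "\<forall>\<^sub>F z in F. f z = c z * t z ^ k"
    by auto
  then have "(\<lambda>z. c z * t z ^ k) \<in> M k" using M_mult t_power_M by blast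
  then show "f \<in> M k" by (rule M_cong) (use f in \<open>auto elim: eventually_mono\<close>)
qed

text \<open>Rings of complex-valued functions are reduced: \<open>t z ^ k = 0\<close> forces
  \<open>t z = 0\<close>, and a germ that vanishes nearby lies in every power of m.\<close>

lemma t_not_nilpotent: "\<not> (\<forall>\<^sub>F z in F. t z ^ k = 0)"
proof
  assume "\<forall>\<^sub>F z in F. t z ^ k = 0"
  then have "\<forall>\<^sub>F z in F. t z = 0" by (auto elim: eventually_mono)
  then show False using M_eventually_zero t_not_M2 by blast
qed

definition truncation :: "(nat \<Rightarrow> complex) \<Rightarrow> 'a \<Rightarrow> complex"
  where "truncation c z = c 0 + c 1 * t z + c 2 * t z ^ 2"

text \<open>Order 0 is settled by the value at \<open>y\<close> and order 1 by
  \<open>t \<notin> M 2\<close>. A nonzero \<open>c 2\<close> would make \<open>c 2 - d * t\<close>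
  a unit that annihilates \<open>t ^ 2\<close>.\<close>

lemma truncation_unique:
  assumes "truncation c \<in> M 3"
  shows "c 0 = 0" "c 1 = 0" "c 2 = 0"
proof -
  have 1: "truncation c \<in> M (Suc 0)" using assms M_2_le_1 M_3_le_2 by blast
  then show c0: "c 0 = 0" using t_0 by (simp add: M_1 truncation_def)
  have "(\<lambda>z. truncation c z - c 2 * t z ^ 2) \<in> M 2"
    using M_diff[OF M_3_le_2[OF assms] M_scale[OF t_power_M[of 2]]] .
  then have "(\<lambda>z. c 1 * t z) \<in> M 2" using c0 by (simp add: truncation_def)
  from M_scale[OF this, of "inverse (c 1)"] t_not_M2 show c1: "c 1 = 0"
    by (cases "c 1 = 0") (auto simp flip: mult.assoc)
  show "c 2 = 0"
  proof (rule ccontr)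
    assume c2: "c 2 \<noteq> 0"
    obtain d where d: "d \<in> R" and d': "\<forall>\<^sub>F z in F. truncation c z = d z * t z ^ 3"
      using assms M_iff by auto
    from d' have ev: "\<forall>\<^sub>F z in F. (c 2 - d z * t z) * t z ^ 2 = 0"
    proof (rule eventually_mono)
      fix z assume elim: "truncation c z = d z * t z ^ 3"

      have "(c 2 - d z * t z) * t z ^ 2 = truncation c z - d z * t z ^ 3"
        by (simp add: truncation_def c0 c1[simplified] algebra_simps power2_eq_square power3_eq_cube)
      then show "(c 2 - d z * t z) * t z ^ 2 = 0" using elim by simp
    qed
    have "(\<lambda>z. c 2 - d z * t z) \<in> R"
      using d t_R by (intro R_diff R_mult R_const)
    then have "\<forall>\<^sub>F z in F. c 2 - d z * t z \<noteq> 0"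
      by (rule R_nonzero) (use c2 t_0 in auto)
    with ev have "\<forall>\<^sub>F z in F. t z ^ 2 = 0" by eventually_elim auto
    then show False using t_not_nilpotent by blast
  qed
qed

text \<open>Only the entries 0, 1 and 2 are determined by the chosen property; hence the side
  condition \<open>j < 3\<close> in the rules below.\<close>

definition coef :: "('a \<Rightarrow> complex) \<Rightarrow> nat \<Rightarrow> complex"
  where "coef f = (SOME c. (\<lambda>z. f z - truncation c z) \<in> M 3)"

text \<open>Taylor expansion by repeated division: a function minus its value at \<open>y\<close> is
  a multiple of \<open>t\<close>, and the quotient is treated in the same way, three times in
  all.\<close>

lemma coef:
  assumes "f \<in> R"
  shows "(\<lambda>z. f z - truncation (coef f) z) \<in> M 3"
proof -
  have split: "\<exists>h\<in>R. \<forall>\<^sub>F z in F. g z = g y + h z * t z" if "g \<in> R" for g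
  proof -
    have "(\<lambda>z. g z - g y) \<in> M (Suc 0)" unfolding M_1 using that R_diff R_const by auto
    from t_generates[OF this] obtain h where "h \<in> R" "\<forall>\<^sub>F z in F. g z - g y = h z * t z" by auto
    then show ?thesis by (intro bexI[of _ h]) (auto elim!: eventually_mono simp: algebra_simps)
  qed
  obtain g where g: "g \<in> R" "\<forall>\<^sub>F z in F. f z = f y + g z * t z" using split[OF assms] by auto
  obtain h where h: "h \<in> R" "\<forall>\<^sub>F z in F. g z = g y + h z * t z" using split[OF g(1)] by auto
  obtain k where k: "k \<in> R" "\<forall>\<^sub>F z in F. h z = h y + k z * t z" using split[OF h(1)] by auto
  define c :: "nat \<Rightarrow> complex" where "c j = (if j = 0 then f y else if j = 1 then g y else h y)" for j
  have "\<forall>\<^sub>F z in F. f z - truncation c z = k z * t z ^ 3"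
    using g(2) h(2) k(2)
    by eventually_elim (simp add: truncation_def c_def algebra_simps power_numeral_reduce)
  then have "(\<lambda>z. f z - truncation c z) \<in> M 3" using k(1) M_iff by auto
  then show ?thesis unfolding coef_def by (rule someI[where P = "\<lambda>c. (\<lambda>z. f z - truncation c z) \<in> M 3"])
qed

lemma coef_unique:
  assumes "f \<in> R" "(\<lambda>z. f z - truncation c z) \<in> M 3"
  shows "coef f 0 = c 0" "coef f 1 = c 1" "coef f 2 = c 2"
proof -
  let ?d = "\<lambda>j. c j - coef f j"
  have "truncation ?d \<in> M 3"
    using M_diff[OF coef[OF assms(1)] assms(2)] unfolding truncation_def
    by (rule M_cong) (auto simp: algebra_simps)
  from truncation_unique[OF this]
  show "coef f 0 = c 0" "coef f 1 = c 1" "coef f 2 = c 2" by auto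
qed

lemma less_3_cases: "(j::nat) < 3 \<Longrightarrow> j = 0 \<or> j = 1 \<or> j = 2"
  by auto

lemma coef_add:
  assumes "f \<in> R" "g \<in> R" "j < 3"
  shows "coef (\<lambda>z. f z + g z) j = coef f j + coef g j"
proof -
  have "(\<lambda>z. (f z + g z) - truncation (\<lambda>j. coef f j + coef g j) z) \<in> M 3"
    using M_add[OF coef[OF assms(1)] coef[OF assms(2)]] unfolding truncation_def
    by (rule M_cong) (auto simp: algebra_simps)
  from coef_unique[OF R_add[OF assms(1,2)] this] less_3_cases[OF assms(3)] show ?thesis by auto
qed

lemma coef_scale:
  assumes "f \<in> R" "j < 3"
  shows "coef (\<lambda>z. c * f z) j = c * coef f j"
proof -
  have "(\<lambda>z. c * f z - truncation (\<lambda>j. c * coef f j) z) \<in> M 3"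
    using M_scale[OF coef[OF assms(1)], of c] unfolding truncation_def
    by (rule M_cong) (auto simp: algebra_simps)
  from coef_unique[OF R_scale[OF assms(1)] this] less_3_cases[OF assms(2)] show ?thesis by auto
qed

lemma coef_cong:
  assumes "f \<in> R" "\<forall>\<^sub>F z in F. f z = g z" "j < 3"
  shows "coef g j = coef f j"
proof -
  have "(\<lambda>z. g z - truncation (coef f) z) \<in> M 3"
    using coef[OF assms(1)] by (rule M_cong) (use assms(2) in \<open>auto elim: eventually_mono\<close>)
  from coef_unique[OF R_cong[OF assms(1,2)] this] less_3_cases[OF assms(3)] show ?thesis by auto
qed

lemma coef_sum:
  assumes "\<And>i. i \<in> A \<Longrightarrow> f i \<in> R" "j < 3"
  shows "coef (\<lambda>z. \<Sum>i\<in>A. f i z) j = (\<Sum>i\<in>A. coef (f i) j)"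
  using assms
proof (induction A rule: infinite_finite_induct)
  case (insert x A)
  then show ?case using coef_add[of "f x" "\<lambda>z. \<Sum>i\<in>A. f i z" j] R_sum[of A f] by auto
qed (use coef_scale[OF R_const, of _ 0 1] in auto)

lemma coef_M3:
  assumes "f \<in> R"
  shows "f \<in> M 3 \<longleftrightarrow> coef f 0 = 0 \<and> coef f 1 = 0 \<and> coef f 2 = 0"
  using coef_unique[OF assms, of "\<lambda>_. 0"] coef[OF assms] by (auto simp: truncation_def)

lemma coef_M2:
  assumes "f \<in> R"
  shows "f \<in> M 2 \<longleftrightarrow> coef f 0 = 0 \<and> coef f 1 = 0"
proof
  assume "f \<in> M 2"
  then obtain g where g: "g \<in> R" and ev: "\<forall>\<^sub>F z in F. f z = g z * t z ^ 2"
    using M_iff by auto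
  \<comment> \<open>Freezing the cofactor \<open>g\<close> at its value \<open>g y\<close> costs
    only an element of m^3, so \<open>g y * t ^ 2\<close> is the Taylor polynomial of
    \<open>f\<close>.\<close>
  have "(\<lambda>z. (g z - g y) * t z ^ 2) \<in> M (Suc 2)"
    by (rule M_SucI) (use g t_power_M in \<open>auto intro!: R_diff R_const\<close>)
  then have "(\<lambda>z. f z - truncation (\<lambda>j. if j = 2 then g y else 0) z) \<in> M 3"
    unfolding eval_nat_numeral(3)[of "num.One"] numeral_3_eq_3 numeral_2_eq_2
    by (rule M_cong) (use ev in \<open>auto elim!: eventually_mono simp: truncation_def algebra_simps numeral_2_eq_2\<close>)
  from coef_unique[OF assms this] show "coef f 0 = 0 \<and> coef f 1 = 0" by simp
next
  assume "coef f 0 = 0 \<and> coef f 1 = 0"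
  then have "\<forall>\<^sub>F z in F. (f z - truncation (coef f) z) + coef f 2 * t z ^ 2 = f z"
    by (simp add: truncation_def)
  with M_add[OF M_3_le_2[OF coef[OF assms]] M_scale[OF t_power_M]]
  show "f \<in> M 2" by (rule M_cong)
qed

lemma coef_t: "coef t 0 = 0" "coef t 1 = 1"
proof -
  have "(\<lambda>z. t z - truncation (\<lambda>j. if j = 1 then 1 else 0) z) \<in> M 3"
    using M_zero by (simp add: truncation_def)
  from coef_unique[OF t_R this] show "coef t 0 = 0" "coef t 1 = 1" by auto
qed

lemma coef_one: "coef (\<lambda>_. 1) 0 = 1" "coef (\<lambda>_. 1) 1 = 0"
proof -
  have "(\<lambda>z. 1 - truncation (\<lambda>j. if j = 0 then 1 else 0) z) \<in> M 3"
    using M_zero by (simp add: truncation_def)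
  from coef_unique[OF R_const this] show "coef (\<lambda>_. 1) 0 = 1" "coef (\<lambda>_. 1) 1 = 0" by auto
qed

text \<open>Multiplication by \<open>t\<close> shifts the Taylor polynomial by one place: the
  entries 0 and 1 of \<open>f\<close> become the entries 1 and 2 of the product.\<close>

lemma t_mult_M3:
  assumes "f \<in> R" "(\<lambda>z. t z * f z) \<in> M 3"
  shows "coef f 0 = 0 \<and> coef f 1 = 0"
proof -
  have "(\<lambda>z. t z * (f z - truncation (coef f) z)) \<in> M (Suc 2)"
    by (rule M_SucI[OF t_R t_0 M_3_le_2[OF coef[OF assms(1)]]])
  then have 1: "(\<lambda>z. t z * (f z - truncation (coef f) z)) \<in> M 3" by simp
  have 2: "(\<lambda>z. coef f 2 * t z ^ 3) \<in> M 3" by (rule M_scale[OF t_power_M])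
  \<comment> \<open>The shifted polynomial, with a separate case for \<open>j = 0\<close> since
    \<open>j - 1\<close> is truncated there. The old entry 2 sits at \<open>t ^ 3\<close> and is
    absorbed by fact \<open>2\<close>.\<close>
  have "truncation (\<lambda>j. if j = 0 then 0 else coef f (j - 1)) \<in> M 3"
    using M_diff[OF M_diff[OF assms(2) 1] 2] unfolding truncation_def
    by (rule M_cong) (simp add: algebra_simps power_numeral_reduce)
  from truncation_unique[OF this] show ?thesis by simp
qed

end

section \<open>Local rings and jets of embedded varieties\<close>

lemma topspace_zariski: "topspace (zariski W) = Proj W"
proof -
  have "form W 0 (\<lambda>l. 1)" by (rule form_const)
  then have "Proj W \<in> {{y \<in> Proj W. \<forall>l\<in>functionals W y. F l \<noteq> 0} |F. \<exists>d. form W d F}"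
    by (intro CollectI exI[of _ "\<lambda>l. 1"]) auto
  then show ?thesis unfolding zariski_def topology_generated_by_topspace by blast
qed

lemma openin_zariski_form:
  "form W d F \<Longrightarrow> openin (zariski W) {y \<in> Proj W. \<forall>l\<in>functionals W y. F l \<noteq> 0}"
  unfolding zariski_def by (rule topology_generated_by_Basis) blast

text \<open>Multiplying forms intersects their nonvanishing sets, so the generating family of the
  topology is already a basis.\<close>

lemma zariski_basis:
  assumes "openin (zariski W) U" "y \<in> U"
  shows "\<exists>d F. form W d F \<and> (\<forall>l\<in>functionals W y. F l \<noteq> 0) \<and>
    {z \<in> Proj W. \<forall>l\<in>functionals W z. F l \<noteq> 0} \<subseteq> U"
proof -
  have "generate_topology_on {{y \<in> Proj W. \<forall>l\<in>functionals W y. F l \<noteq> 0} |F. \<exists>d. form W d F} U"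
    using assms(1) unfolding zariski_def openin_topology_generated_by_iff .
  then show ?thesis using assms(2)
  proof (induction U rule: generate_topology_on.induct)
    case (Int A B)
    then obtain d F e G where F: "form W d F" "\<forall>l\<in>functionals W y. F l \<noteq> 0"
        "{z \<in> Proj W. \<forall>l\<in>functionals W z. F l \<noteq> 0} \<subseteq> A"
      and G: "form W e G" "\<forall>l\<in>functionals W y. G l \<noteq> 0"
        "{z \<in> Proj W. \<forall>l\<in>functionals W z. G l \<noteq> 0} \<subseteq> B"
      by blast
    then show ?case
      using form_mult[OF F(1) G(1)] by (intro exI[of _ "d + e"] exI[of _ "\<lambda>l. F l * G l"]) auto
  next
    case (UN K)
    then obtain A where A: "A \<in> K" "y \<in> A" by blast
    with UN.IH[OF A] show ?case by blast
  next
    case (Basis A)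
    then obtain d F where "form W d F" "A = {y \<in> Proj W. \<forall>l\<in>functionals W y. F l \<noteq> 0}" by blast
    then show ?case using Basis by blast
  qed simp
qed

abbreviation zariski_nhds :: "'x cvec set \<Rightarrow> 'x cvec set set \<Rightarrow> 'x cvec set \<Rightarrow> 'x cvec set filter"
  where "zariski_nhds W Y y \<equiv> nhdsin (zariski_on W Y) y"

locale embedded_point =
  fixes W :: "'x cvec set" and Y :: "'x cvec set set" and y :: "'x cvec set"
  assumes subspace_W: "cv.subspace W" and y_in_Y: "y \<in> Y" and y_in_Proj: "y \<in> Proj W"
begin

lemma y_in_topspace: "y \<in> topspace (zariski_on W Y)"
  using y_in_Y y_in_Proj by (simp add: topspace_zariski)

lemma eventually_open:
  "eventually P (zariski_nhds W Y y) \<longleftrightarrow>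
    (\<exists>M. openin (zariski_on W Y) M \<and> y \<in> M \<and> (\<forall>z\<in>M. P z))"
  using y_in_topspace by (simp add: eventually_nhdsin)

lemma eventually_openI:
  "openin (zariski_on W Y) M \<Longrightarrow> y \<in> M \<Longrightarrow> \<forall>\<^sub>F z in zariski_nhds W Y y. z \<in> M"
  unfolding eventually_open by blast

lemma eventually_Proj: "\<forall>\<^sub>F z in zariski_nhds W Y y. z \<in> Proj W"
  and eventually_Y: "\<forall>\<^sub>F z in zariski_nhds W Y y. z \<in> Y"
proof -
  have "\<forall>\<^sub>F z in zariski_nhds W Y y. z \<in> topspace (zariski_on W Y)"
    by (rule eventually_openI[OF openin_topspace y_in_topspace])
  then show "\<forall>\<^sub>F z in zariski_nhds W Y y. z \<in> Proj W" "\<forall>\<^sub>F z in zariski_nhds W Y y. z \<in> Y"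
    by (auto simp: topspace_zariski elim: eventually_mono)
qed

text \<open>A neighbourhood is reduced to the nonvanishing of one form, a condition that can be
  pulled back along a map by evaluating the form.\<close>

lemma eventually_form:
  "eventually P (zariski_nhds W Y y) \<longleftrightarrow> (\<exists>d F. form W d F \<and> (\<forall>l\<in>functionals W y. F l \<noteq> 0) \<and>
    (\<forall>z\<in>Proj W \<inter> Y. (\<forall>l\<in>functionals W z. F l \<noteq> 0) \<longrightarrow> P z))"
proof
  assume "eventually P (zariski_nhds W Y y)"
  then obtain M where "openin (zariski_on W Y) M" and M: "y \<in> M" "\<forall>z\<in>M. P z"
    unfolding eventually_open by blast
  then obtain U where U: "openin (zariski W) U" "M = U \<inter> Y" unfolding openin_subtopology by blast
  obtain d F where F: "form W d F" "\<forall>l\<in>functionals W y. F l \<noteq> 0"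
    "{z \<in> Proj W. \<forall>l\<in>functionals W z. F l \<noteq> 0} \<subseteq> U"
    using zariski_basis[OF U(1), of y] M U(2) by blast
  then show "\<exists>d F. form W d F \<and> (\<forall>l\<in>functionals W y. F l \<noteq> 0) \<and>
      (\<forall>z\<in>Proj W \<inter> Y. (\<forall>l\<in>functionals W z. F l \<noteq> 0) \<longrightarrow> P z)"
    using M U(2) by (intro exI[of _ d] exI[of _ F]) blast
next
  assume "\<exists>d F. form W d F \<and> (\<forall>l\<in>functionals W y. F l \<noteq> 0) \<and>
    (\<forall>z\<in>Proj W \<inter> Y. (\<forall>l\<in>functionals W z. F l \<noteq> 0) \<longrightarrow> P z)"
  then obtain d F where F: "form W d F" "\<forall>l\<in>functionals W y. F l \<noteq> 0"
    and P: "\<forall>z\<in>Proj W \<inter> Y. (\<forall>l\<in>functionals W z. F l \<noteq> 0) \<longrightarrow> P z"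
    by blast
  let ?M = "{z \<in> Proj W. \<forall>l\<in>functionals W z. F l \<noteq> 0} \<inter> Y"
  have "openin (zariski_on W Y) ?M"
    using openin_zariski_form[OF F(1)] openin_subtopology by blast
  then show "eventually P (zariski_nhds W Y y)"
    unfolding eventually_open using F P y_in_Y y_in_Proj by (intro exI[of _ ?M]) blast
qed

lemma eventually_form_nonzero:
  "form W d F \<Longrightarrow> \<forall>l\<in>functionals W y. F l \<noteq> 0 \<Longrightarrow>
    \<forall>\<^sub>F z in zariski_nhds W Y y. \<forall>l\<in>functionals W z. F l \<noteq> 0"
  unfolding eventually_form by blast

text \<open>One fraction at \<open>y\<close> suffices: on the open set where it is valid, the same
  fraction shows regularity at every point.\<close>

lemma local_ring_iff:
  "f \<in> local_ring W Y y \<longleftrightarrow> (\<exists>d F G. form W d F \<and> form W d G \<and>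
    (\<forall>\<^sub>F z in zariski_nhds W Y y. \<forall>l\<in>functionals W z. G l \<noteq> 0 \<and> f z = F l / G l))"
proof
  assume "f \<in> local_ring W Y y"
  then show "\<exists>d F G. form W d F \<and> form W d G \<and>
    (\<forall>\<^sub>F z in zariski_nhds W Y y. \<forall>l\<in>functionals W z. G l \<noteq> 0 \<and> f z = F l / G l)"
    unfolding local_ring_def regular_def eventually_open by blast
next
  assume "\<exists>d F G. form W d F \<and> form W d G \<and>
    (\<forall>\<^sub>F z in zariski_nhds W Y y. \<forall>l\<in>functionals W z. G l \<noteq> 0 \<and> f z = F l / G l)"
  then obtain d F G M where "form W d F" "form W d G" "openin (zariski_on W Y) M" "y \<in> M"
    "\<forall>z\<in>M. \<forall>l\<in>functionals W z. G l \<noteq> 0 \<and> f z = F l / G l"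
    unfolding eventually_open by blast
  then have "regular W Y M f" unfolding regular_def by blast
  then show "f \<in> local_ring W Y y" using \<open>y \<in> M\<close> unfolding local_ring_def by blast
qed

lemma hyp_stalk_iff:
  "\<sigma> \<in> hyp_stalk W Y y \<longleftrightarrow> (\<exists>d F G. form W (Suc d) F \<and> form W d G \<and>
    (\<forall>\<^sub>F z in zariski_nhds W Y y. \<forall>l\<in>functionals W z. G l \<noteq> 0 \<and> \<sigma> l = F l / G l))"
proof
  assume "\<sigma> \<in> hyp_stalk W Y y"
  then show "\<exists>d F G. form W (Suc d) F \<and> form W d G \<and>
    (\<forall>\<^sub>F z in zariski_nhds W Y y. \<forall>l\<in>functionals W z. G l \<noteq> 0 \<and> \<sigma> l = F l / G l)"
    unfolding hyp_stalk_def hyp_section_def eventually_open by blast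
next
  assume "\<exists>d F G. form W (Suc d) F \<and> form W d G \<and>
    (\<forall>\<^sub>F z in zariski_nhds W Y y. \<forall>l\<in>functionals W z. G l \<noteq> 0 \<and> \<sigma> l = F l / G l)"
  then obtain d F G M where "form W (Suc d) F" "form W d G" "openin (zariski_on W Y) M" "y \<in> M"
    "\<forall>z\<in>M. \<forall>l\<in>functionals W z. G l \<noteq> 0 \<and> \<sigma> l = F l / G l"
    unfolding eventually_open by blast
  then have "hyp_section W Y M \<sigma>" unfolding hyp_section_def by blast
  then show "\<sigma> \<in> hyp_stalk W Y y" using \<open>y \<in> M\<close> unfolding hyp_stalk_def by blast
qed

abbreviation "R \<equiv> local_ring W Y y"

sublocale germ_ring "local_ring W Y y" "zariski_nhds W Y y" y
proof
  fix c
  show "(\<lambda>_. c) \<in> R"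
    unfolding local_ring_iff
    by (intro exI[of _ 0] exI[of _ "\<lambda>_. c"] exI[of _ "\<lambda>_. 1"]) (simp add: form_const)
next
  fix f g
  assume "f \<in> R" "g \<in> R"
  then obtain d F G d' F' G' where F: "form W d F" "form W d G"
      "\<forall>\<^sub>F z in zariski_nhds W Y y. \<forall>l\<in>functionals W z. G l \<noteq> 0 \<and> f z = F l / G l"
    and F': "form W d' F'" "form W d' G'"
      "\<forall>\<^sub>F z in zariski_nhds W Y y. \<forall>l\<in>functionals W z. G' l \<noteq> 0 \<and> g z = F' l / G' l"
    unfolding local_ring_iff by blast
  have G: "form W (d + d') (\<lambda>l. G l * G' l)" by (rule form_mult[OF F(2) F'(2)])
  have "form W (d + d') (\<lambda>l. F l * G' l + G l * F' l)"
    by (rule form_add[OF form_mult[OF F(1) F'(2)] form_mult[OF F(2) F'(1)]])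
  moreover have "\<forall>\<^sub>F z in zariski_nhds W Y y. \<forall>l\<in>functionals W z.
      G l * G' l \<noteq> 0 \<and> f z + g z = (F l * G' l + G l * F' l) / (G l * G' l)"
    using F(3) F'(3) by eventually_elim (simp add: add_frac_eq mult.commute)
  ultimately show "(\<lambda>z. f z + g z) \<in> R" using G unfolding local_ring_iff by blast
  have "form W (d + d') (\<lambda>l. F l * F' l)" by (rule form_mult[OF F(1) F'(1)])
  moreover have "\<forall>\<^sub>F z in zariski_nhds W Y y. \<forall>l\<in>functionals W z.
      G l * G' l \<noteq> 0 \<and> f z * g z = (F l * F' l) / (G l * G' l)"
    using F(3) F'(3) by eventually_elim simp
  ultimately show "(\<lambda>z. f z * g z) \<in> R" using G unfolding local_ring_iff by blast
next
  show at: "P y" if "eventually P (zariski_nhds W Y y)" for P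
    using that unfolding eventually_open by blast
  fix f
  assume "f \<in> R" and nz: "f y \<noteq> 0"
  then obtain d F G where F: "form W d F" "form W d G"
      "\<forall>\<^sub>F z in zariski_nhds W Y y. \<forall>l\<in>functionals W z. G l \<noteq> 0 \<and> f z = F l / G l"
    unfolding local_ring_iff by blast
  have "\<forall>l\<in>functionals W y. F l \<noteq> 0" using at[OF F(3)] nz by auto
  note F_nz = eventually_form_nonzero[OF F(1) this]
  have "\<forall>\<^sub>F z in zariski_nhds W Y y. \<forall>l\<in>functionals W z. F l \<noteq> 0 \<and> inverse (f z) = G l / F l"
    using F(3) F_nz by eventually_elim simp
  then show "(\<lambda>z. inverse (f z)) \<in> R" using F unfolding local_ring_iff by blast
  show "\<forall>\<^sub>F z in zariski_nhds W Y y. f z \<noteq> 0"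
    using F(3) F_nz eventually_Proj
  proof eventually_elim
    case (elim z)
    \<comment> \<open>The identity \<open>f z = F l / G l\<close> carries information only if some
      functional \<open>l\<close> with kernel \<open>z\<close> exists.\<close>
    then show ?case using functionals_nonempty[OF subspace_W, of z] by auto
  qed
next
  fix f g
  assume "f \<in> R" and eq: "\<forall>\<^sub>F z in zariski_nhds W Y y. f z = g z"
  then obtain d F G where F: "form W d F" "form W d G"
      "\<forall>\<^sub>F z in zariski_nhds W Y y. \<forall>l\<in>functionals W z. G l \<noteq> 0 \<and> f z = F l / G l"
    unfolding local_ring_iff by blast
  have "\<forall>\<^sub>F z in zariski_nhds W Y y. \<forall>l\<in>functionals W z. G l \<noteq> 0 \<and> g z = F l / G l"
    using F(3) eq by eventually_elim simp
  then show "g \<in> R" using F unfolding local_ring_iff by blast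
qed

lemma max_ideal_pow_eq: "max_ideal_pow W Y y k = M k"
proof (induction k)
  case (Suc k)
  have "h \<in> max_ideal_pow W Y y (Suc k) \<longleftrightarrow> h \<in> M (Suc k)" for h
  proof
    assume "h \<in> max_ideal_pow W Y y (Suc k)"
    then obtain N and r :: nat and f g where N: "openin (zariski_on W Y) N" "y \<in> N"
      and fg: "\<forall>i<r. f i \<in> max_ideal W Y y \<and> g i \<in> M k" and h: "\<forall>z\<in>N. h z = (\<Sum>i<r. f i z * g i z)"
      unfolding max_ideal_pow.simps Suc.IH by blast
    have "\<forall>\<^sub>F z in zariski_nhds W Y y. h z = (\<Sum>i<r. f i z * g i z)"
      unfolding eventually_open using N h by blast
    then show "h \<in> M (Suc k)" by (rule mpow_SucI) (use fg in \<open>simp add: max_ideal_def\<close>)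
  next
    assume "h \<in> M (Suc k)"
    then obtain r :: nat and f g where fg: "\<forall>i<r. f i \<in> R \<and> f i y = 0 \<and> g i \<in> M k"
      and "\<forall>\<^sub>F z in zariski_nhds W Y y. h z = (\<Sum>i<r. f i z * g i z)"
      by (rule mpow_SucE)
    then obtain N where "openin (zariski_on W Y) N" "y \<in> N" "\<forall>z\<in>N. h z = (\<Sum>i<r. f i z * g i z)"
      unfolding eventually_open by blast
    then show "h \<in> max_ideal_pow W Y y (Suc k)"
      unfolding max_ideal_pow.simps Suc.IH max_ideal_def using fg
      by (intro CollectI exI[of _ N] exI[of _ r] exI[of _ f] exI[of _ g]) simp
  qed
  then show ?case by blast
qed simp

lemma max_ideal_eq: "max_ideal W Y y = M (Suc 0)"
  unfolding max_ideal_def using M_1 by blast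

end

section \<open>Ratios of sections as local functions, and jets in a trivialization of the hyperplane
  bundle\<close>

definition ratio :: "'x cvec set \<Rightarrow> 'x cvec \<Rightarrow> 'x cvec \<Rightarrow> 'x cvec set \<Rightarrow> complex"
  where "ratio W v e z = (let l = SOME l. l \<in> functionals W z in l v / l e)"

text \<open>Proportionality makes the choice in \<open>ratio\<close> immaterial. If
  \<open>l e = 0\<close>, the chosen functional kills \<open>e\<close> too, and both quotients are 0
  by the convention on division.\<close>

lemma ratio_eq:
  assumes "cv.subspace W" "v \<in> W" "e \<in> W" "l \<in> functionals W z"
  shows "ratio W v e z = l v / l e"
proof -
  define l' where "l' = (SOME l. l \<in> functionals W z)"
  have l': "l' \<in> functionals W z" unfolding l'_def using assms(4) by (rule someI[of "\<lambda>l. l \<in> functionals W z"])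
  have "l' e = 0 \<longleftrightarrow> l e = 0"
    using functional_eq_0_iff[OF l' assms(3)] functional_eq_0_iff[OF assms(4,3)] by simp
  moreover have "l v * l' e = l' v * l e"
    by (rule functionals_proportional[OF assms(1,4) l' assms(2,3)])
  ultimately show ?thesis
    unfolding ratio_def l'_def[symmetric] Let_def by (cases "l e = 0") (simp_all add: field_simps)
qed

context embedded_point
begin

lemma eventually_not_mem:
  assumes "e \<in> W" "e \<notin> y"
  shows "\<forall>\<^sub>F z in zariski_nhds W Y y. e \<notin> z"
proof -
  have "\<forall>l\<in>functionals W y. l e \<noteq> 0" using functional_eq_0_iff[OF _ assms(1)] assms(2) by blast
  from eventually_form_nonzero[OF form_lin[OF assms(1)] this] eventually_Proj show ?thesis
  proof eventually_elim
    case (elim z)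
    then show ?case
      using functionals_nonempty[OF subspace_W, of z] functional_eq_0_iff[OF _ assms(1)] by blast
  qed
qed

lemma eventually_functional_nonzero:
  assumes "e \<in> W" "e \<notin> y"
  shows "\<forall>\<^sub>F z in zariski_nhds W Y y. \<forall>l\<in>functionals W z. l e \<noteq> 0"
  using eventually_not_mem[OF assms] by eventually_elim (use functional_eq_0_iff[OF _ assms(1)] in blast)

lemma ratio_R:
  assumes "v \<in> W" "e \<in> W" "e \<notin> y"
  shows "ratio W v e \<in> R"
  unfolding local_ring_iff
proof (intro exI conjI)
  show "form W 1 (\<lambda>l. l v)" "form W 1 (\<lambda>l. l e)" by (rule form_lin[OF assms(1)], rule form_lin[OF assms(2)])
  show "\<forall>\<^sub>F z in zariski_nhds W Y y. \<forall>l\<in>functionals W z. l e \<noteq> 0 \<and> ratio W v e z = l v / l e"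
    using eventually_functional_nonzero[OF assms(2,3)]
    by eventually_elim (use ratio_eq[OF subspace_W assms(1,2)] in blast)
qed

lemma hyp_stalk_linear: "v \<in> W \<Longrightarrow> (\<lambda>l. l v) \<in> hyp_stalk W Y y"
  unfolding hyp_stalk_iff
  by (intro exI[of _ 0] exI[of _ "\<lambda>l. l v"] exI[of _ "\<lambda>l. 1"])
     (use form_lin[of v W] form_const[of W 1] in simp)

lemma form_homogeneous:
  assumes "form W k F" "\<forall>s\<in>W. l' s = c * l s"
  shows "F l' = c ^ k * F l"
  using assms by (induction rule: form.induct) (auto simp: algebra_simps power_add)

text \<open>A section \<open>e\<close> nonzero at \<open>y\<close> trivializes the hyperplane bundle
  nearby: dividing a fraction of degree one by \<open>e\<close> leaves a fraction of degree zero,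
  that is, a function.\<close>

lemma hyp_stalk_ratio:
  assumes e: "e \<in> W" "e \<notin> y" and \<rho>: "\<rho> \<in> hyp_stalk W Y y"
  shows "\<exists>f\<in>R. \<forall>\<^sub>F z in zariski_nhds W Y y. \<forall>l\<in>functionals W z. \<rho> l = f z * l e"
proof -
  obtain d F G where F: "form W (Suc d) F" "form W d G"
    "\<forall>\<^sub>F z in zariski_nhds W Y y. \<forall>l\<in>functionals W z. G l \<noteq> 0 \<and> \<rho> l = F l / G l"
    using \<rho> unfolding hyp_stalk_iff by blast
  have G: "form W (Suc d) (\<lambda>l. G l * l e)" using form_mult[OF F(2) form_lin[OF e(1)]] by simp
  \<comment> \<open>Numerator and denominator both have degree \<open>Suc d\<close>, so by
    homogeneity the value does not depend on the chosen functional.\<close>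
  define f where "f z = (let l = SOME l. l \<in> functionals W z in F l / (G l * l e))" for z
  have "\<forall>\<^sub>F z in zariski_nhds W Y y. \<forall>l\<in>functionals W z.
      G l * l e \<noteq> 0 \<and> f z = F l / (G l * l e) \<and> \<rho> l = f z * l e"
    using F(3) eventually_functional_nonzero[OF e]
  proof eventually_elim
    case (elim z)
    show ?case
    proof
      fix l assume l: "l \<in> functionals W z"
      define l' where "l' = (SOME l. l \<in> functionals W z)"
      have l': "l' \<in> functionals W z" unfolding l'_def using l by (rule someI[of "\<lambda>l. l \<in> functionals W z"])
      define c where "c = l' e / l e"
      have nz: "l e \<noteq> 0" "l' e \<noteq> 0" "G l \<noteq> 0" using elim l l' by auto
      have "\<forall>s\<in>W. l' s = c * l s"
        using functionals_proportional[OF subspace_W l l' _ e(1)] nz by (auto simp: c_def field_simps)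
      then have "F l' = c ^ Suc d * F l" "G l' = c ^ d * G l"
        using form_homogeneous[OF F(1)] form_homogeneous[OF F(2)] by blast+
      moreover have "l' e = c * l e" "c \<noteq> 0" using nz by (auto simp: c_def)
      ultimately have "f z = F l / (G l * l e)"
        unfolding f_def l'_def[symmetric] Let_def using nz by simp
      then show "G l * l e \<noteq> 0 \<and> f z = F l / (G l * l e) \<and> \<rho> l = f z * l e"
        using nz elim(1) l by auto
    qed
  qed
  note ev = this
  have "f \<in> R" unfolding local_ring_iff
    by (intro exI[of _ "Suc d"] exI[of _ F] exI[of _ "\<lambda>l. G l * l e"])
       (use F(1) G ev in \<open>auto elim: eventually_mono\<close>)
  then show ?thesis using ev by (intro bexI[of _ f]) (auto elim: eventually_mono)
qed

lemma hyp_stalk_pow_iff: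
  assumes e: "e \<in> W" "e \<notin> y"
  shows "\<sigma> \<in> hyp_stalk_pow W Y y k \<longleftrightarrow>
    (\<exists>f\<in>M k. \<forall>\<^sub>F z in zariski_nhds W Y y. \<forall>l\<in>functionals W z. \<sigma> l = f z * l e)"
proof
  assume "\<sigma> \<in> hyp_stalk_pow W Y y k"
  then obtain N and r :: nat and f \<rho> where N: "openin (zariski_on W Y) N" "y \<in> N"
    and f: "\<forall>i<r. f i \<in> M k \<and> \<rho> i \<in> hyp_stalk W Y y"
    and \<sigma>: "\<forall>z\<in>N. \<forall>l\<in>functionals W z. \<sigma> l = (\<Sum>i<r. f i z * \<rho> i l)"
    unfolding hyp_stalk_pow_def max_ideal_pow_eq by blast
  have "\<forall>i\<in>{..<r}. \<exists>g. g \<in> R \<and> (\<forall>\<^sub>F z in zariski_nhds W Y y. \<forall>l\<in>functionals W z. \<rho> i l = g z * l e)"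
    using f hyp_stalk_ratio[OF e] by blast
  from bchoice[OF this] obtain g where g: "\<forall>i\<in>{..<r}. g i \<in> R \<and>
      (\<forall>\<^sub>F z in zariski_nhds W Y y. \<forall>l\<in>functionals W z. \<rho> i l = g i z * l e)"
    by (rule exE)
  have "\<forall>\<^sub>F z in zariski_nhds W Y y. \<forall>i\<in>{..<r}. \<forall>l\<in>functionals W z. \<rho> i l = g i z * l e"
    by (rule eventually_ball_finite) (use g in auto)
  with eventually_openI[OF N] have "\<forall>\<^sub>F z in zariski_nhds W Y y. \<forall>l\<in>functionals W z.
      \<sigma> l = (\<Sum>i<r. g i z * f i z) * l e"
  proof eventually_elim
    case (elim z)
    show ?case
    proof
      fix l assume l: "l \<in> functionals W z"
      have "\<sigma> l = (\<Sum>i<r. f i z * \<rho> i l)" using \<sigma> elim(1) l by blast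
      also have "\<dots> = (\<Sum>i<r. g i z * f i z) * l e"
        unfolding sum_distrib_right by (intro sum.cong) (use elim(2) l in auto)
      finally show "\<sigma> l = (\<Sum>i<r. g i z * f i z) * l e" .
    qed
  qed
  moreover have "(\<lambda>z. \<Sum>i<r. g i z * f i z) \<in> M k"
    using f g by (intro M_sum M_mult) auto
  ultimately show "\<exists>f\<in>M k. \<forall>\<^sub>F z in zariski_nhds W Y y. \<forall>l\<in>functionals W z. \<sigma> l = f z * l e"
    by (intro bexI[of _ "\<lambda>z. \<Sum>i<r. g i z * f i z"])
next
  assume "\<exists>f\<in>M k. \<forall>\<^sub>F z in zariski_nhds W Y y. \<forall>l\<in>functionals W z. \<sigma> l = f z * l e"
  then obtain f N where "f \<in> M k" "openin (zariski_on W Y) N" "y \<in> N"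
    "\<forall>z\<in>N. \<forall>l\<in>functionals W z. \<sigma> l = f z * l e"
    unfolding eventually_open by blast
  then show "\<sigma> \<in> hyp_stalk_pow W Y y k"
    unfolding hyp_stalk_pow_def max_ideal_pow_eq using hyp_stalk_linear[OF e(1)]
    by (intro CollectI exI[of _ N] exI[of _ "1::nat"] exI[of _ "\<lambda>_. f"] exI[of _ "\<lambda>_ l. l e"]) simp
qed

text \<open>Division by \<open>e\<close> identifies the stalk of the hyperplane bundle with the
  local ring, and its submodules with powers of m. Osculation becomes order of vanishing.\<close>

lemma jet_ker_eq:
  assumes e: "e \<in> W" "e \<notin> y"
  shows "jet_ker W Y k y = {v \<in> W. ratio W v e \<in> M (Suc k)}"
proof -
  let ?I = "hyp_stalk_pow W Y y (Suc k)"
  have minus: "(\<lambda>l. \<sigma> l - \<tau> l) \<in> ?I" if \<sigma>: "\<sigma> \<in> ?I" and \<tau>: "\<tau> \<in> ?I" for \<sigma> \<tau>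
  proof -
    obtain f where f: "f \<in> M (Suc k)" "\<forall>\<^sub>F z in zariski_nhds W Y y. \<forall>l\<in>functionals W z. \<sigma> l = f z * l e"
      using \<sigma> unfolding hyp_stalk_pow_iff[OF e] by blast
    obtain g where g: "g \<in> M (Suc k)" "\<forall>\<^sub>F z in zariski_nhds W Y y. \<forall>l\<in>functionals W z. \<tau> l = g z * l e"
      using \<tau> unfolding hyp_stalk_pow_iff[OF e] by blast
    have "\<forall>\<^sub>F z in zariski_nhds W Y y. \<forall>l\<in>functionals W z. \<sigma> l - \<tau> l = (f z - g z) * l e"
      using f(2) g(2) by eventually_elim (simp add: algebra_simps)
    then show ?thesis unfolding hyp_stalk_pow_iff[OF e]
      using M_diff[OF f(1) g(1)] by (intro bexI[of _ "\<lambda>z. f z - g z"])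
  qed
  have zero: "(\<lambda>l. 0) \<in> ?I" unfolding hyp_stalk_pow_iff[OF e]
    using M_zero by (intro bexI[of _ "\<lambda>_. 0"]) auto
  have "jet W Y k y v = jet_class W Y k y (\<lambda>l. 0) \<longleftrightarrow> ratio W v e \<in> M (Suc k)" if v: "v \<in> W" for v
  proof
    assume eq: "jet W Y k y v = jet_class W Y k y (\<lambda>l. 0)"
    have "(\<lambda>l. l v) \<in> jet W Y k y v"
      using zero hyp_stalk_linear[OF v] by (simp add: jet_def jet_class_def)
    then have "(\<lambda>l. l v) \<in> ?I" unfolding eq by (simp add: jet_class_def)
    then obtain f where f: "f \<in> M (Suc k)" "\<forall>\<^sub>F z in zariski_nhds W Y y. \<forall>l\<in>functionals W z. l v = f z * l e"
      unfolding hyp_stalk_pow_iff[OF e] by blast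
    have "\<forall>\<^sub>F z in zariski_nhds W Y y. f z = ratio W v e z"
      using f(2) eventually_functional_nonzero[OF e] eventually_Proj
    proof eventually_elim
      case (elim z)
      then obtain l where "l \<in> functionals W z" using functionals_nonempty[OF subspace_W, of z] by blast
      then show ?case using elim ratio_eq[OF subspace_W v e(1), of l z] by auto
    qed
    then show "ratio W v e \<in> M (Suc k)" by (rule M_cong[OF f(1)])
  next
    assume ratio: "ratio W v e \<in> M (Suc k)"
    have "\<forall>\<^sub>F z in zariski_nhds W Y y. \<forall>l\<in>functionals W z. l v = ratio W v e z * l e"
      using eventually_functional_nonzero[OF e]
      by eventually_elim (use ratio_eq[OF subspace_W v e(1)] in auto)
    then have I: "(\<lambda>l. l v) \<in> ?I" unfolding hyp_stalk_pow_iff[OF e] using ratio by blast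
    \<comment> \<open>Equality of the two cosets of \<open>?I\<close>. The converse inclusion and
      the direct one both use differences only; adding \<open>l v\<close> is subtracting
      \<open>0 - l v\<close>.\<close>
    have "(\<lambda>l. \<tau> l - l v) \<in> ?I \<longleftrightarrow> \<tau> \<in> ?I" for \<tau>
      using minus[OF _ I, of \<tau>] minus[OF _ minus[OF zero I], of "\<lambda>l. \<tau> l - l v"] by auto
    then show "jet W Y k y v = jet_class W Y k y (\<lambda>l. 0)"
      by (simp add: jet_def jet_class_def)
  qed
  then show ?thesis unfolding jet_ker_def by auto
qed

text \<open>A form \<open>F\<close> of degree \<open>d\<close> gives the function \<open>F / e ^ d\<close>, which is a polynomial in ratios
  \<open>v / e\<close>; so it agrees with its value at \<open>y\<close> modulo any ideal containing the \<open>w / e\<close>, \<open>w \<in> y\<close>.\<close>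

lemma max_ideal_subset_ideal:
  assumes e: "e \<in> W" "e \<notin> y"
    and I_sub: "\<And>f. f \<in> I \<Longrightarrow> f \<in> R"
    and I_cong: "\<And>f g. f \<in> I \<Longrightarrow> \<forall>\<^sub>F z in zariski_nhds W Y y. f z = g z \<Longrightarrow> g \<in> I"
    and I_add: "\<And>f g. f \<in> I \<Longrightarrow> g \<in> I \<Longrightarrow> (\<lambda>z. f z + g z) \<in> I"
    and I_mult: "\<And>f g. f \<in> R \<Longrightarrow> g \<in> I \<Longrightarrow> (\<lambda>z. f z * g z) \<in> I"
    and I_zero: "(\<lambda>_. 0) \<in> I"
    and I_gen: "\<And>w. w \<in> y \<Longrightarrow> ratio W w e \<in> I"
    and f: "f \<in> M (Suc 0)"
  shows "f \<in> I"
proof -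
  have y_sub: "y \<subseteq> W" using y_in_Proj by (auto simp: Proj_def)
  obtain l0 where l0: "l0 \<in> functionals W y" using functionals_nonempty[OF subspace_W y_in_Proj] by blast
  have lin0: "linear_on W l0" using l0 by (simp add: functionals_iff)
  have e0: "l0 e \<noteq> 0" using functional_eq_0_iff[OF l0 e(1)] e(2) by simp
  have form: "\<exists>c. \<exists>h\<in>I. \<forall>\<^sub>F z in zariski_nhds W Y y. \<forall>l\<in>functionals W z. F l / l e ^ d = c + h z"
    if "form W d F" for d F
    using that
  proof (induction rule: form.induct)
    case (form_const c)
    then show ?case using I_zero by (intro exI[of _ c] bexI[of _ "\<lambda>_. 0"]) auto
  next
    case (form_lin s)
    define w where "w = s - cscale (l0 s / l0 e) e"
    have w: "w \<in> W" unfolding w_def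
      using form_lin e subspace_W by (intro cv.subspace_diff cv.subspace_scale)
    have "l0 w = 0" unfolding w_def using e0
        linear_on_diff[OF subspace_W lin0 form_lin cv.subspace_scale[OF subspace_W e(1)]]
        linear_on_scale[OF lin0 e(1)] by simp
    then have "w \<in> y" using functional_eq_0_iff[OF l0 w] by simp
    moreover have "\<forall>\<^sub>F z in zariski_nhds W Y y. \<forall>l\<in>functionals W z.
        l s / l e ^ 1 = l0 s / l0 e + ratio W w e z"
      using eventually_functional_nonzero[OF e]
    proof eventually_elim
      case (elim z)
      show ?case
      proof
        fix l assume l: "l \<in> functionals W z"
        then have lin: "linear_on W l" by (simp add: functionals_iff)
        have "l w = l s - l0 s / l0 e * l e" unfolding w_def
          using linear_on_diff[OF subspace_W lin form_lin cv.subspace_scale[OF subspace_W e(1)]]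
            linear_on_scale[OF lin e(1)] by simp
        moreover have "l e \<noteq> 0" using elim l by blast
        ultimately show "l s / l e ^ 1 = l0 s / l0 e + ratio W w e z"
          using ratio_eq[OF subspace_W w e(1) l] by (simp add: diff_divide_distrib)
      qed
    qed
    ultimately show ?case using I_gen by blast
  next
    case (form_add d F G)
    then obtain c h c' h' where h: "h \<in> I" "h' \<in> I"
      "\<forall>\<^sub>F z in zariski_nhds W Y y. \<forall>l\<in>functionals W z. F l / l e ^ d = c + h z"
      "\<forall>\<^sub>F z in zariski_nhds W Y y. \<forall>l\<in>functionals W z. G l / l e ^ d = c' + h' z"
      by blast
    have "\<forall>\<^sub>F z in zariski_nhds W Y y. \<forall>l\<in>functionals W z.
        (F l + G l) / l e ^ d = (c + c') + (h z + h' z)"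
      using h(3,4) by eventually_elim (simp add: add_divide_distrib)
    then show ?case using I_add[OF h(1,2)] by (intro exI[of _ "c + c'"] bexI[of _ "\<lambda>z. h z + h' z"])
  next
    case (form_mult d F d' G)
    then obtain c h c' h' where h: "h \<in> I" "h' \<in> I"
      "\<forall>\<^sub>F z in zariski_nhds W Y y. \<forall>l\<in>functionals W z. F l / l e ^ d = c + h z"
      "\<forall>\<^sub>F z in zariski_nhds W Y y. \<forall>l\<in>functionals W z. G l / l e ^ d' = c' + h' z"
      by blast
    have "\<forall>\<^sub>F z in zariski_nhds W Y y. \<forall>l\<in>functionals W z.
        (F l * G l) / l e ^ (d + d') = c * c' + (c * h' z + (c' + h' z) * h z)"
      using h(3,4)
    proof eventually_elim
      case (elim z)
      show ?case
      proof
        fix l assume l: "l \<in> functionals W z"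
        have "(F l * G l) / l e ^ (d + d') = (F l / l e ^ d) * (G l / l e ^ d')"
          by (simp add: power_add)
        also have "\<dots> = (c + h z) * (c' + h' z)" using elim l by simp
        finally show "(F l * G l) / l e ^ (d + d') = c * c' + (c * h' z + (c' + h' z) * h z)"
          by (simp add: algebra_simps)
      qed
    qed
    moreover have "(\<lambda>z. c * h' z + (c' + h' z) * h z) \<in> I"
      using h I_sub by (intro I_add I_mult R_const R_add) auto
    ultimately show ?case
      by (intro exI[of _ "c * c'"] bexI[of _ "\<lambda>z. c * h' z + (c' + h' z) * h z"])
  qed
  have f': "f \<in> R" "f y = 0" using f by (simp_all add: M_1)
  then obtain d F G where F: "form W d F" "form W d G"
      "\<forall>\<^sub>F z in zariski_nhds W Y y. \<forall>l\<in>functionals W z. G l \<noteq> 0 \<and> f z = F l / G l"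
    unfolding local_ring_iff by blast
  obtain c h where h: "h \<in> I"
    "\<forall>\<^sub>F z in zariski_nhds W Y y. \<forall>l\<in>functionals W z. F l / l e ^ d = c + h z"
    using form[OF F(1)] by blast
  obtain c' h' where h': "h' \<in> I"
    "\<forall>\<^sub>F z in zariski_nhds W Y y. \<forall>l\<in>functionals W z. G l / l e ^ d = c' + h' z"
    using form[OF F(2)] by blast
  have f_eq: "\<forall>\<^sub>F z in zariski_nhds W Y y. c' + h' z \<noteq> 0 \<and> f z * (c' + h' z) = c + h z"
    using F(3) h(2) h'(2) eventually_functional_nonzero[OF e] eventually_Proj
  proof eventually_elim
    case (elim z)
    then obtain l where l: "l \<in> functionals W z" using functionals_nonempty[OF subspace_W, of z] by blast
    have "c' + h' z = G l / l e ^ d" "c + h z = F l / l e ^ d" "G l \<noteq> 0" "f z = F l / G l" "l e \<noteq> 0"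
      using elim l by auto
    then show ?case by simp
  qed
  show ?thesis
  \<comment> \<open>An ideal with a unit is everything. Otherwise all of \<open>I\<close> vanishes
    at \<open>y\<close>, so \<open>f y = 0\<close> gives \<open>c = 0\<close>, while
    \<open>c' \<noteq> 0\<close>; near \<open>y\<close>, \<open>f\<close> is then a unit times
    \<open>h\<close>.\<close>
  proof (cases "\<exists>g\<in>I. g y \<noteq> 0")
    case True
    then obtain g where g: "g \<in> I" "g y \<noteq> 0" by blast
    have "(\<lambda>z. (f z * inverse (g z)) * g z) \<in> I"
      using g I_sub f'(1) by (intro I_mult R_mult R_inverse) auto
    then show ?thesis
      by (rule I_cong) (use R_nonzero[OF I_sub[OF g(1)] g(2)] in \<open>auto elim: eventually_mono\<close>)
  next
    case False
    then have "h y = 0" "h' y = 0" using h h' by auto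
    then have "c = 0" "c' \<noteq> 0" using at_point[OF f_eq] f'(2) by auto
    have u: "(\<lambda>z. c' + h' z) \<in> R" using I_sub[OF h'(1)] by (intro R_add R_const)
    have "(\<lambda>z. inverse (c' + h' z) * h z) \<in> I"
      using u \<open>c' \<noteq> 0\<close> \<open>h' y = 0\<close> h(1) by (intro I_mult R_inverse) auto
    then show ?thesis
      by (rule I_cong) (use f_eq \<open>c = 0\<close> in \<open>auto elim!: eventually_mono simp: field_simps\<close>)
  qed
qed

end

text \<open>\<open>\<phi> q\<close> gives homogeneous coordinates of \<open>\<sigma> q\<close> that
  are functions in \<open>RA\<close>, and fractions of forms evaluated at them stay in
  \<open>RA\<close>. Used for curves in the scroll and for its projection to a projective
  curve.\<close>

lemma (in embedded_point) local_ring_pullback: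
  assumes "germ_ring RA FA a"
    and y: "\<sigma> a = y"
    and \<sigma>: "\<forall>\<^sub>F q in FA. \<sigma> q \<in> Y \<and> \<sigma> q \<in> Proj W \<and> \<phi> q \<in> functionals W (\<sigma> q)"
    and \<phi>: "\<And>v. v \<in> W \<Longrightarrow> (\<lambda>q. \<phi> q v) \<in> RA"
  shows "f \<in> R \<Longrightarrow> f \<circ> \<sigma> \<in> RA"
    and "eventually P (zariski_nhds W Y y) \<Longrightarrow> eventually (\<lambda>q. P (\<sigma> q)) FA"
proof -
  interpret A: germ_ring RA FA a by fact
  have form: "(\<lambda>q. F (\<phi> q)) \<in> RA" if "form W d F" for d F
    using that
  proof (induction rule: form.induct)
    case (form_mult d F e G)
    then show ?case using A.R_mult by blast
  next
    case (form_add d F G)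
    then show ?case using A.R_add by blast
  qed (auto intro: \<phi> A.R_const)
  have a: "\<phi> a \<in> functionals W y" using A.at_point[OF \<sigma>] y by blast
  \<comment> \<open>Basic open sets quantify over all functionals with kernel \<open>z\<close>, but
    the ring controls only the value at \<open>\<phi> q\<close>; homogeneity bridges the
    gap.\<close>
  have nonzero_iff: "H l \<noteq> 0 \<longleftrightarrow> H l' \<noteq> 0"
    if H: "form W k H" and l: "l \<in> functionals W z" and l': "l' \<in> functionals W z" and z: "z \<in> Proj W"
    for H k l l' z
  proof -
    obtain e where e: "e \<in> W" "e \<notin> z" using Proj_obtain[OF z] .
    have nz: "l e \<noteq> 0" "l' e \<noteq> 0"
      using functional_eq_0_iff[OF l e(1)] functional_eq_0_iff[OF l' e(1)] e(2) by auto
    define c where "c = l' e / l e"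
    have "\<forall>s\<in>W. l' s = c * l s"
      using functionals_proportional[OF subspace_W l l' _ e(1)] nz by (auto simp: c_def field_simps)
    then have "H l' = c ^ k * H l" by (rule form_homogeneous[OF H])
    then show ?thesis using nz by (auto simp: c_def)
  qed
  have ev: "eventually (\<lambda>q. P (\<sigma> q)) FA" if P: "eventually P (zariski_nhds W Y y)" for P
  proof -
    obtain d F where F: "form W d F" "\<forall>l\<in>functionals W y. F l \<noteq> 0"
      and P': "\<forall>z\<in>Proj W \<inter> Y. (\<forall>l\<in>functionals W z. F l \<noteq> 0) \<longrightarrow> P z"
      using P unfolding eventually_form by blast
    have "\<forall>\<^sub>F q in FA. F (\<phi> q) \<noteq> 0"
      by (rule A.R_nonzero[OF form[OF F(1)]]) (use F(2) a in blast)
    with \<sigma> show ?thesis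
    proof eventually_elim
      case (elim q)
      then have "\<forall>l\<in>functionals W (\<sigma> q). F l \<noteq> 0" using nonzero_iff[OF F(1)] by blast
      then show ?case using P' elim by blast
    qed
  qed
  show "eventually P (zariski_nhds W Y y) \<Longrightarrow> eventually (\<lambda>q. P (\<sigma> q)) FA" by (rule ev)
  assume "f \<in> R"
  then obtain d F G where F: "form W d F" "form W d G"
      "\<forall>\<^sub>F z in zariski_nhds W Y y. \<forall>l\<in>functionals W z. G l \<noteq> 0 \<and> f z = F l / G l"
    unfolding local_ring_iff by blast
  have "G (\<phi> a) \<noteq> 0" using at_point[OF F(3)] a by blast
  then have "(\<lambda>q. F (\<phi> q) * inverse (G (\<phi> q))) \<in> RA"
    by (intro A.R_mult A.R_inverse form[OF F(1)] form[OF F(2)])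
  moreover have "\<forall>\<^sub>F q in FA. F (\<phi> q) * inverse (G (\<phi> q)) = (f \<circ> \<sigma>) q"
    using ev[OF F(3)] \<sigma> by eventually_elim (auto simp: divide_inverse)
  ultimately show "f \<circ> \<sigma> \<in> RA" by (rule A.R_cong)
qed

lemma ratio_add:
  assumes "cv.subspace W" "z \<in> Proj W" "u \<in> W" "v \<in> W" "e \<in> W"
  shows "ratio W (u + v) e z = ratio W u e z + ratio W v e z"
proof -
  obtain l where l: "l \<in> functionals W z" using functionals_nonempty[OF assms(1,2)] by blast
  then have "linear_on W l" by (simp add: functionals_iff)
  then have "l (u + v) = l u + l v" using assms by (intro linear_on_add)
  moreover have "ratio W (u + v) e z = l (u + v) / l e"
    using assms by (intro ratio_eq l cv.subspace_add)
  ultimately show ?thesis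
    using ratio_eq[OF assms(1,3,5) l] ratio_eq[OF assms(1,4,5) l] by (simp add: add_divide_distrib)
qed

lemma ratio_scale:
  assumes "cv.subspace W" "z \<in> Proj W" "v \<in> W" "e \<in> W"
  shows "ratio W (cscale c v) e z = c * ratio W v e z"
proof -
  obtain l where l: "l \<in> functionals W z" using functionals_nonempty[OF assms(1,2)] by blast
  then have "linear_on W l" by (simp add: functionals_iff)
  then have "l (cscale c v) = c * l v" using assms by (intro linear_on_scale)
  moreover have "ratio W (cscale c v) e z = l (cscale c v) / l e"
    using assms by (intro ratio_eq l cv.subspace_scale)
  ultimately show ?thesis using ratio_eq[OF assms(1,3,4) l] by simp
qed

lemma ratio_self:
  assumes "cv.subspace W" "z \<in> Proj W" "e \<in> W" "e \<notin> z"
  shows "ratio W e e z = 1"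
proof -
  obtain l where l: "l \<in> functionals W z" using functionals_nonempty[OF assms(1,2)] by blast
  then have "l e \<noteq> 0" using functional_eq_0_iff[OF l assms(3)] assms(4) by simp
  then show ?thesis using ratio_eq[OF assms(1,3,3) l] by simp
qed

lemma ratio_eq_0:
  assumes "cv.subspace W" "z \<in> Proj W" "v \<in> W" "e \<in> W" "v \<in> z"
  shows "ratio W v e z = 0"
proof -
  obtain l where l: "l \<in> functionals W z" using functionals_nonempty[OF assms(1,2)] by blast
  then have "l v = 0" using functional_eq_0_iff[OF l assms(3)] assms(5) by simp
  then show ?thesis using ratio_eq[OF assms(1,3,4) l] by simp
qed

section \<open>Finite generation of the maximal ideal and existence of a uniformizer\<close>

context embedded_point
begin

text \<open>The ideal is generated by the \<open>w / e\<close> with \<open>w \<in> y\<close>, and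
  projecting a finite generating set of \<open>W\<close> to \<open>y\<close> along \<open>e\<close>
  leaves finitely many of them.\<close>

lemma max_ideal_finitely_generated:
  assumes fin: "codim W {0} < \<infinity>" and e: "e \<in> W" "e \<notin> y"
  shows "\<exists>X. finite X \<and> X \<subseteq> M (Suc 0) \<and> (\<forall>f\<in>M (Suc 0). \<exists>a. (\<forall>x\<in>X. a x \<in> R) \<and>
    (\<forall>\<^sub>F z in zariski_nhds W Y y. f z = (\<Sum>x\<in>X. a x z * x z)))"
proof -
  obtain m where "codim W {0} = enat m" using fin by auto
  then have "codim W {0} \<le> enat m" by simp
  then obtain B where B: "finite B" "B \<subseteq> W" "W \<subseteq> cv.span ({0} \<union> B)" unfolding codim_le_iff by blast
  obtain l0 where l0: "l0 \<in> functionals W y" using functionals_nonempty[OF subspace_W y_in_Proj] by blast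
  have lin: "linear_on W l0" using l0 by (simp add: functionals_iff)
  have e0: "l0 e \<noteq> 0" using functional_eq_0_iff[OF l0 e(1)] e(2) by simp
  define pr where "pr v = v - cscale (l0 v / l0 e) e" for v
  have pr_W: "pr v \<in> W" if "v \<in> W" for v
    unfolding pr_def using that e subspace_W by (intro cv.subspace_diff cv.subspace_scale)
  have pr_y: "pr v \<in> y" if v: "v \<in> W" for v
  proof -
    have "l0 (pr v) = 0" unfolding pr_def using e0
        linear_on_diff[OF subspace_W lin v cv.subspace_scale[OF subspace_W e(1)]]
        linear_on_scale[OF lin e(1)] by simp
    then show ?thesis using functional_eq_0_iff[OF l0 pr_W[OF v]] by simp
  qed
  have pr_add: "pr (u + v) = pr u + pr v" if "u \<in> W" "v \<in> W" for u v
    unfolding pr_def linear_on_add[OF lin that]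
    by (simp add: fun_eq_iff cscale_def add_divide_distrib algebra_simps)
  have pr_scale: "pr (cscale c v) = cscale c (pr v)" if "v \<in> W" for c v
    unfolding pr_def linear_on_scale[OF lin that]
    by (simp add: fun_eq_iff cscale_def algebra_simps)
  define X where "X = (\<lambda>b. ratio W (pr b) e) ` B"
  have X: "x \<in> M (Suc 0)" if "x \<in> X" for x
  proof -
    obtain b where b: "b \<in> B" "x = ratio W (pr b) e" using \<open>x \<in> X\<close> unfolding X_def by blast
    then have "b \<in> W" using B by blast
    then show ?thesis unfolding M_1 b(2)
      using ratio_R[OF pr_W e] ratio_eq_0[OF subspace_W y_in_Proj pr_W e(1) pr_y] by simp
  qed
  have "finite X" unfolding X_def using B(1) by simp
  \<comment> \<open>The ideal generated by \<open>X\<close>. Once its closure properties are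
    checked, \<open>max_ideal_subset_ideal\<close> shows that it contains all of m.\<close>
  define I where "I = {f \<in> R. \<exists>a. (\<forall>x\<in>X. a x \<in> R) \<and> (\<forall>\<^sub>F z in zariski_nhds W Y y. f z = (\<Sum>x\<in>X. a x z * x z))}"
  have I_cong: "g \<in> I" if f: "f \<in> I" and eq: "\<forall>\<^sub>F z in zariski_nhds W Y y. f z = g z" for f g
  proof -
    obtain a where a: "\<forall>x\<in>X. a x \<in> R" "\<forall>\<^sub>F z in zariski_nhds W Y y. f z = (\<Sum>x\<in>X. a x z * x z)"
      using f unfolding I_def by blast
    have "\<forall>\<^sub>F z in zariski_nhds W Y y. g z = (\<Sum>x\<in>X. a x z * x z)"
      using a(2) eq by eventually_elim simp
    moreover have "g \<in> R" using f eq R_cong unfolding I_def by blast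
    ultimately show ?thesis using a(1) unfolding I_def by blast
  qed
  have I_add: "(\<lambda>z. f z + g z) \<in> I" if f: "f \<in> I" and g: "g \<in> I" for f g
  proof -
    obtain a where a: "\<forall>x\<in>X. a x \<in> R" "\<forall>\<^sub>F z in zariski_nhds W Y y. f z = (\<Sum>x\<in>X. a x z * x z)"
      using f unfolding I_def by blast
    obtain b where b: "\<forall>x\<in>X. b x \<in> R" "\<forall>\<^sub>F z in zariski_nhds W Y y. g z = (\<Sum>x\<in>X. b x z * x z)"
      using g unfolding I_def by blast
    have "\<forall>\<^sub>F z in zariski_nhds W Y y. f z + g z = (\<Sum>x\<in>X. (a x z + b x z) * x z)"
      using a(2) b(2) by eventually_elim (simp add: algebra_simps sum.distrib)
    moreover have "\<forall>x\<in>X. (\<lambda>z. a x z + b x z) \<in> R" using a(1) b(1) R_add by blast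
    moreover have "(\<lambda>z. f z + g z) \<in> R" using f g R_add unfolding I_def by blast
    ultimately show ?thesis unfolding I_def by (intro CollectI conjI exI[of _ "\<lambda>x z. a x z + b x z"])
  qed
  have I_mult: "(\<lambda>z. f z * g z) \<in> I" if f: "f \<in> R" and g: "g \<in> I" for f g
  proof -
    obtain b where b: "\<forall>x\<in>X. b x \<in> R" "\<forall>\<^sub>F z in zariski_nhds W Y y. g z = (\<Sum>x\<in>X. b x z * x z)"
      using g unfolding I_def by blast
    have "\<forall>\<^sub>F z in zariski_nhds W Y y. f z * g z = (\<Sum>x\<in>X. (f z * b x z) * x z)"
      using b(2) by eventually_elim (simp add: sum_distrib_left mult.assoc)
    moreover have "\<forall>x\<in>X. (\<lambda>z. f z * b x z) \<in> R" using f b(1) R_mult by blast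
    moreover have "(\<lambda>z. f z * g z) \<in> R" using f g R_mult unfolding I_def by blast
    ultimately show ?thesis unfolding I_def by (intro CollectI conjI exI[of _ "\<lambda>x z. f z * b x z"])
  qed
  have I_zero: "(\<lambda>_. 0) \<in> I" unfolding I_def using R_const
    by (intro CollectI conjI exI[of _ "\<lambda>x z. 0"]) auto
  have I_X: "x \<in> I" if x: "x \<in> X" for x
  proof -
    have "(\<Sum>x'\<in>X. (if x' = x then 1 else 0) * x' z) = x z" for z
      using sum.delta[OF \<open>finite X\<close>, of x "\<lambda>x'. x' z"] x
      by (simp add: if_distrib[of "\<lambda>c. c * _"] cong: if_cong)
    then show ?thesis using X[OF x] M_subset_R R_const unfolding I_def
      by (intro CollectI conjI exI[of _ "\<lambda>x' z. if x' = x then 1 else 0"]) auto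
  qed
  \<comment> \<open>The vectors whose projection gives an element of \<open>I\<close> form a
    subspace containing \<open>B\<close>, hence all of \<open>W\<close>; on \<open>y\<close> the
    projection \<open>pr\<close> is the identity.\<close>
  let ?S = "{v \<in> W. ratio W (pr v) e \<in> I}"
  have "cv.subspace ?S"
    unfolding cv.subspace_def
  proof (intro conjI allI ballI)
    have "pr 0 \<in> W" "pr 0 \<in> y" using pr_W pr_y cv.subspace_0[OF subspace_W] by auto
    then have "\<forall>\<^sub>F z in zariski_nhds W Y y. 0 = ratio W (pr 0) e z"
      using eventually_Proj
    proof (elim eventually_mono)
      fix z assume "z \<in> Proj W"
      then have "0 \<in> z" by (auto simp: Proj_def cv.subspace_0)
      moreover have "pr 0 = 0" using pr_scale[of 0 0] cv.subspace_0[OF subspace_W] by simp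
      ultimately show "0 = ratio W (pr 0) e z"
        using ratio_eq_0[OF subspace_W \<open>z \<in> Proj W\<close> cv.subspace_0[OF subspace_W] e(1)] by simp
    qed
    then show "0 \<in> ?S" using I_cong[OF I_zero] cv.subspace_0[OF subspace_W] by blast
  next
    fix u v assume u: "u \<in> ?S" and v: "v \<in> ?S"
    have "\<forall>\<^sub>F z in zariski_nhds W Y y. ratio W (pr u) e z + ratio W (pr v) e z = ratio W (pr (u + v)) e z"
      using eventually_Proj by eventually_elim
        (use u v pr_add ratio_add[OF subspace_W _ pr_W pr_W e(1)] in simp)
    moreover have "(\<lambda>z. ratio W (pr u) e z + ratio W (pr v) e z) \<in> I" using I_add u v by blast
    ultimately show "u + v \<in> ?S" using I_cong u v cv.subspace_add[OF subspace_W] by blast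
  next
    fix c v assume v: "v \<in> ?S"
    have "\<forall>\<^sub>F z in zariski_nhds W Y y. c * ratio W (pr v) e z = ratio W (pr (cscale c v)) e z"
      using eventually_Proj by eventually_elim
        (use v pr_scale ratio_scale[OF subspace_W _ pr_W e(1)] in simp)
    moreover have "(\<lambda>z. c * ratio W (pr v) e z) \<in> I" using I_mult[OF R_const] v by blast
    ultimately show "cscale c v \<in> ?S" using I_cong v cv.subspace_scale[OF subspace_W] by blast
  qed
  moreover have "{0} \<union> B \<subseteq> ?S"
    using B(2) I_X cv.subspace_0[OF calculation] unfolding X_def by blast
  ultimately have S: "W \<subseteq> ?S" using B(3) cv.span_minimal by blast
  have gen: "ratio W w e \<in> I" if w: "w \<in> y" for w
  proof -
    have wW: "w \<in> W" using w y_in_Proj by (auto simp: Proj_def)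
    then have "l0 w = 0" using functional_eq_0_iff[OF l0] w by simp
    then have "pr w = w" by (simp add: pr_def fun_eq_iff cscale_def)
    then show ?thesis using S wW by auto
  qed
  have "f \<in> I" if "f \<in> M (Suc 0)" for f
    by (rule max_ideal_subset_ideal[OF e _ I_cong I_add I_mult I_zero gen that]) (auto simp: I_def)
  then show ?thesis using \<open>finite X\<close> X unfolding I_def by blast
qed

lemma cv_subspace_M: "cv.subspace (M k)"
  unfolding cv.subspace_def using M_zero M_add M_scale
  by (simp add: plus_fun_def zero_fun_def cscale_def)

text \<open>Smoothness provides \<open>t\<close> spanning m/m^2, and finite dimension of
  \<open>W\<close> provides finite generation; Nakayama then makes \<open>t\<close> a generator of
  m.\<close>

lemma uniformizer_exists:
  assumes "codim W {0} < \<infinity>" and "codim (max_ideal W Y y) (max_ideal_pow W Y y 2) = 1"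
  shows "\<exists>t. uniformized_germ_ring (local_ring W Y y) (zariski_nhds W Y y) y t"
proof -
  obtain e where e: "e \<in> W" "e \<notin> y" using Proj_obtain[OF y_in_Proj] .
  obtain X where X: "finite X" "X \<subseteq> M (Suc 0)" and gen: "\<forall>f\<in>M (Suc 0). \<exists>a. (\<forall>x\<in>X. a x \<in> R) \<and>
      (\<forall>\<^sub>F z in zariski_nhds W Y y. f z = (\<Sum>x\<in>X. a x z * x z))"
    using max_ideal_finitely_generated[OF assms(1) e] by blast
  have "codim (M (Suc 0)) (M 2) = 1" using assms(2) by (simp only: max_ideal_eq max_ideal_pow_eq)
  then obtain t where t: "t \<in> M (Suc 0)" "\<forall>f\<in>M (Suc 0). \<exists>c. f - cscale c t \<in> M 2" "\<not> M (Suc 0) \<subseteq> M 2"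
    unfolding codim_1_iff[OF cv_subspace_M] by blast
  have t2: "t \<notin> M 2"
  proof
    assume "t \<in> M 2"
    have "f \<in> M 2" if f: "f \<in> M (Suc 0)" for f
    proof -
      obtain c where "f - cscale c t \<in> M 2" using t(2) f by blast
      then have "(f - cscale c t) + cscale c t \<in> M 2"
        using \<open>t \<in> M 2\<close> by (intro cv.subspace_add[OF cv_subspace_M] cv.subspace_scale[OF cv_subspace_M])
      then show ?thesis by simp
    qed
    then show False using t(3) by blast
  qed
  have t3: "\<exists>c. (\<lambda>z. f z - c * t z) \<in> M 2" if "f \<in> M (Suc 0)" for f
    using t(2) that by (simp add: fun_diff_def cscale_def)
  have "\<exists>c\<in>R. \<forall>\<^sub>F z in zariski_nhds W Y y. f z = c z * t z" if "f \<in> M (Suc 0)" for f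
    by (rule principal_max_ideal[OF X _ M_subset_R[OF t(1)] t3 that]) (use gen in blast)
  then show ?thesis using t(1) t2
    by (intro exI[of _ t]) (unfold_locales, auto)
qed

end

section \<open>An embedded curve\<close>

text \<open>Trivializes the line bundle near \<open>p\<close>; relative to it,
  \<open>rel_fun\<close> turns every section in \<open>V\<close> into a function.\<close>

definition base_section :: "('a \<times> 'p) cvec set \<Rightarrow> 'p \<Rightarrow> ('a \<times> 'p) cvec"
  where "base_section V p = (SOME e. e \<in> V \<and> e \<notin> sys_map V p)"

definition rel_fun :: "('a \<times> 'p) cvec set \<Rightarrow> 'p \<Rightarrow> ('a \<times> 'p) cvec \<Rightarrow> 'p \<Rightarrow> complex"
  where "rel_fun V p v q = ratio V v (base_section V p) (sys_map V q)"

lemma local_ringI: "y \<in> N \<Longrightarrow> regular W Y N f \<Longrightarrow> f \<in> local_ring W Y y"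
  unfolding local_ring_def by blast

locale embedded_curve =
  uniformized_germ_ring "local_ring U C p" "zariski_nhds U C p" p t
  for U :: "'b cvec set" and C p t +
  fixes V :: "('a \<times> 'b cvec set) cvec set"
  assumes subspace_U: "cv.subspace U" and C_Proj: "C \<subseteq> Proj U" and p_in_C: "p \<in> C"
    and subspace_V: "cv.subspace V" and embedding: "gives_embedding U C V"
begin

abbreviation "R \<equiv> local_ring U C p"
abbreviation "e \<equiv> base_section V p"
abbreviation "rel \<equiv> rel_fun V p"
abbreviation "\<phi> \<equiv> sys_map V"

sublocale P: embedded_point U C p
  using subspace_U C_Proj p_in_C by unfold_locales auto

lemma sys_map_Proj: "q \<in> C \<Longrightarrow> \<phi> q \<in> Proj V"
  using embedding by (auto simp: gives_embedding_def embedding_into_def)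

text \<open>Two copies of the same point: \<open>M\<close> and \<open>coef\<close> refer to
  \<open>p\<close> on the given curve, \<open>Q.M\<close> to its image in \<open>Proj V\<close>,
  where flexes are defined.\<close>

sublocale Q: embedded_point V "\<phi> ` C" "\<phi> p"
  using subspace_V sys_map_Proj p_in_C by unfold_locales auto

lemma e_in_V: "e \<in> V" and e_notin: "e \<notin> \<phi> p"
proof -
  have "\<exists>e. e \<in> V \<and> e \<notin> \<phi> p"
    using Proj_obtain[OF Q.y_in_Proj] by blast
  then have "e \<in> V \<and> e \<notin> \<phi> p" unfolding base_section_def by (rule someI_ex)
  then show "e \<in> V" "e \<notin> \<phi> p" by auto
qed

lemma pullback:
  shows "f \<in> local_ring V (\<phi> ` C) (\<phi> p) \<Longrightarrow> f \<circ> \<phi> \<in> R"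
    and "eventually P (zariski_nhds V (\<phi> ` C) (\<phi> p)) \<Longrightarrow> eventually (\<lambda>q. P (\<phi> q)) (zariski_nhds U C p)"
proof -
  have mor: "morphism U C V (\<phi> ` C) \<phi>"
    using embedding by (simp add: gives_embedding_def embedding_into_def isomorphism_def)
  show "f \<circ> \<phi> \<in> R" if f: "f \<in> local_ring V (\<phi> ` C) (\<phi> p)"
  proof -
    obtain N where N: "\<phi> p \<in> N" "regular V (\<phi> ` C) N f" using f unfolding local_ring_def by blast
    have "regular U C {q \<in> C. \<phi> q \<in> N} (f \<circ> \<phi>)" using mor N(2) unfolding morphism_def by blast
    moreover have "p \<in> {q \<in> C. \<phi> q \<in> N}" using N(1) p_in_C by simp
    ultimately show ?thesis by (rule local_ringI[rotated])
  qed
  assume "eventually P (zariski_nhds V (\<phi> ` C) (\<phi> p))"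
  then obtain M where M: "openin (zariski_on V (\<phi> ` C)) M" "\<phi> p \<in> M" "\<forall>z\<in>M. P z"
    unfolding Q.eventually_open by blast
  have "openin (zariski_on U C) {q \<in> topspace (zariski_on U C). \<phi> q \<in> M}"
    using mor M(1) unfolding morphism_def by (intro openin_continuous_map_preimage) auto
  then show "eventually (\<lambda>q. P (\<phi> q)) (zariski_nhds U C p)"
    unfolding P.eventually_open using M(2,3) P.y_in_topspace by blast
qed

text \<open>Retains of the inverse morphism its action on germs, in the format that
  \<open>mpow_pullback\<close> expects.\<close>

lemma inverse_exists:
  obtains \<psi> where "\<And>q. q \<in> C \<Longrightarrow> \<psi> (\<phi> q) = q"
    and "\<And>f. f \<in> R \<Longrightarrow> f \<circ> \<psi> \<in> local_ring V (\<phi> ` C) (\<phi> p)"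
    and "\<And>P. eventually P (zariski_nhds U C p) \<Longrightarrow>
      eventually (\<lambda>z. P (\<psi> z)) (zariski_nhds V (\<phi> ` C) (\<phi> p))"
proof -
  obtain \<psi> where mor: "morphism V (\<phi> ` C) U C \<psi>" and inv: "\<forall>q\<in>C. \<psi> (\<phi> q) = q"
  proof -
    have "isomorphism U C V (\<phi> ` C) \<phi>"
      using embedding by (simp add: gives_embedding_def embedding_into_def)
    then show ?thesis using that unfolding isomorphism_def by blast
  qed
  have p: "\<psi> (\<phi> p) = p" using inv p_in_C by blast
  have ring: "f \<circ> \<psi> \<in> local_ring V (\<phi> ` C) (\<phi> p)" if f: "f \<in> R" for f
  proof -
    obtain N where N: "p \<in> N" "regular U C N f" using f unfolding local_ring_def by blast
    then have "regular V (\<phi> ` C) {z \<in> \<phi> ` C. \<psi> z \<in> N} (f \<circ> \<psi>)" using mor unfolding morphism_def by blast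
    moreover have "\<phi> p \<in> {z \<in> \<phi> ` C. \<psi> z \<in> N}" using N(1) p_in_C p by simp
    ultimately show ?thesis by (rule local_ringI[rotated])
  qed
  have ev: "eventually (\<lambda>z. P (\<psi> z)) (zariski_nhds V (\<phi> ` C) (\<phi> p))"
    if P: "eventually P (zariski_nhds U C p)" for P
  proof -
    obtain M where M: "openin (zariski_on U C) M" "p \<in> M" "\<forall>z\<in>M. P z"
      using P unfolding P.eventually_open by blast
    have "openin (zariski_on V (\<phi> ` C)) {z \<in> topspace (zariski_on V (\<phi> ` C)). \<psi> z \<in> M}"
      using mor M(1) unfolding morphism_def by (intro openin_continuous_map_preimage) auto
    moreover have "\<phi> p \<in> {z \<in> topspace (zariski_on V (\<phi> ` C)). \<psi> z \<in> M}"
      using Q.y_in_topspace M(2) p by auto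
    ultimately show ?thesis unfolding Q.eventually_open using M(3) by blast
  qed
  show ?thesis
  proof (rule that[of \<psi>])
    show "\<psi> (\<phi> q) = q" if "q \<in> C" for q using inv that by simp
  qed (fact ring ev)+
qed

lemma rel_R: "v \<in> V \<Longrightarrow> rel v \<in> R"
  using pullback(1)[OF Q.ratio_R[OF _ e_in_V e_notin]] by (simp add: comp_def rel_fun_def[abs_def])

lemma eventually_e: "\<forall>\<^sub>F q in zariski_nhds U C p. e \<notin> \<phi> q"
  by (rule pullback(2)[OF Q.eventually_not_mem[OF e_in_V e_notin]])

lemma rel_add: "q \<in> C \<Longrightarrow> u \<in> V \<Longrightarrow> v \<in> V \<Longrightarrow> rel (u + v) q = rel u q + rel v q"
  unfolding rel_fun_def by (intro ratio_add subspace_V sys_map_Proj e_in_V)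

lemma rel_scale: "q \<in> C \<Longrightarrow> v \<in> V \<Longrightarrow> rel (cscale c v) q = c * rel v q"
  unfolding rel_fun_def by (intro ratio_scale subspace_V sys_map_Proj e_in_V)

lemma rel_e: "q \<in> C \<Longrightarrow> e \<notin> \<phi> q \<Longrightarrow> rel e q = 1"
  unfolding rel_fun_def by (intro ratio_self subspace_V sys_map_Proj e_in_V)

lemma coef_rel_linear: "j < 3 \<Longrightarrow> linear_on V (\<lambda>v. coef (rel v) j)"
  unfolding linear_on_def
proof (intro conjI ballI allI)
  fix u v assume j: "j < 3" and u: "u \<in> V" and v: "v \<in> V"
  have "\<forall>\<^sub>F q in zariski_nhds U C p. rel u q + rel v q = rel (u + v) q"
    using P.eventually_Y by eventually_elim (simp add: rel_add u v)
  from coef_cong[OF R_add[OF rel_R[OF u] rel_R[OF v]] this j]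
  show "coef (rel (u + v)) j = coef (rel u) j + coef (rel v) j"
    using coef_add[OF rel_R[OF u] rel_R[OF v] j] by simp
next
  fix c v assume j: "j < 3" and v: "v \<in> V"
  have "\<forall>\<^sub>F q in zariski_nhds U C p. c * rel v q = rel (cscale c v) q"
    using P.eventually_Y by eventually_elim (simp add: rel_scale v)
  from coef_cong[OF R_scale[OF rel_R[OF v]] this j]
  show "coef (rel (cscale c v)) j = c * coef (rel v) j"
    using coef_scale[OF rel_R[OF v] j] by simp
qed

lemma coef_rel_e: "coef (rel e) 0 = 1" "coef (rel e) 1 = 0"
proof -
  have "\<forall>\<^sub>F q in zariski_nhds U C p. 1 = rel e q"
    using P.eventually_Y eventually_e by eventually_elim (simp add: rel_e)
  from coef_cong[OF R_const this] show "coef (rel e) 0 = 1" "coef (rel e) 1 = 0"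
    using coef_one by simp_all
qed

text \<open>The two functions are pullbacks of each other along the embedding and its inverse. This
  lets flexes of the image be read off on \<open>C\<close> with the uniformizer
  \<open>t\<close>.\<close>

lemma rel_M3_iff: "v \<in> V \<Longrightarrow> rel v \<in> M 3 \<longleftrightarrow> ratio V v e \<in> Q.M 3"
proof
  assume "v \<in> V" and v: "ratio V v e \<in> Q.M 3"
  have "ratio V v e \<circ> \<phi> \<in> M 3"
    by (rule mpow_pullback[OF pullback refl v])
  then show "rel v \<in> M 3" by (simp add: comp_def rel_fun_def[abs_def])
next
  assume "v \<in> V" and v: "rel v \<in> M 3"
  obtain \<psi> where \<psi>: "\<And>q. q \<in> C \<Longrightarrow> \<psi> (\<phi> q) = q"
    "\<And>f. f \<in> R \<Longrightarrow> f \<circ> \<psi> \<in> local_ring V (\<phi> ` C) (\<phi> p)"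
    "\<And>P. eventually P (zariski_nhds U C p) \<Longrightarrow>
      eventually (\<lambda>z. P (\<psi> z)) (zariski_nhds V (\<phi> ` C) (\<phi> p))"
    using inverse_exists by metis
  have "rel v \<circ> \<psi> \<in> Q.M 3"
    by (rule mpow_pullback[OF \<psi>(2,3) \<psi>(1)[OF p_in_C] v])
  moreover have "\<forall>\<^sub>F z in zariski_nhds V (\<phi> ` C) (\<phi> p). (rel v \<circ> \<psi>) z = ratio V v e z"
    using Q.eventually_Y by eventually_elim (auto simp: rel_fun_def \<psi>(1))
  ultimately show "ratio V v e \<in> Q.M 3" by (rule Q.M_cong)
qed

text \<open>An embedding separates tangents: the cotangent space at \<open>\<phi> p\<close> is spanned by the
  classes of \<open>w / e\<close> with \<open>w\<close> vanishing at \<open>p\<close>.\<close>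

lemma tangent_section_exists: "\<exists>w\<in>V. coef (rel w) 0 = 0 \<and> coef (rel w) 1 = 1"
proof -
  obtain \<psi> where \<psi>: "\<And>q. q \<in> C \<Longrightarrow> \<psi> (\<phi> q) = q"
    "\<And>f. f \<in> R \<Longrightarrow> f \<circ> \<psi> \<in> local_ring V (\<phi> ` C) (\<phi> p)"
    "\<And>P. eventually P (zariski_nhds U C p) \<Longrightarrow>
      eventually (\<lambda>z. P (\<psi> z)) (zariski_nhds V (\<phi> ` C) (\<phi> p))"
    using inverse_exists by metis
  have sub: "\<phi> p \<subseteq> V" "cv.subspace (\<phi> p)" using Q.y_in_Proj by (auto simp: Proj_def)
  define I where "I = {f \<in> Q.R. \<exists>w\<in>\<phi> p. (\<lambda>z. f z - ratio V w e z) \<in> Q.M 2}"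
  have "t \<circ> \<psi> \<in> I"
  proof (rule Q.max_ideal_subset_ideal[OF e_in_V e_notin])
    show "f \<in> Q.R" if "f \<in> I" for f using that by (simp add: I_def)
  next
    fix f g assume f: "f \<in> I" and eq: "\<forall>\<^sub>F z in zariski_nhds V (\<phi> ` C) (\<phi> p). f z = g z"
    then obtain w where w: "w \<in> \<phi> p" "(\<lambda>z. f z - ratio V w e z) \<in> Q.M 2" by (auto simp: I_def)
    have "\<forall>\<^sub>F z in zariski_nhds V (\<phi> ` C) (\<phi> p). f z - ratio V w e z = g z - ratio V w e z"
      using eq by eventually_elim simp
    from Q.M_cong[OF w(2) this] show "g \<in> I"
      using w(1) f Q.R_cong[OF _ eq] by (auto simp: I_def)
  next
    fix f g assume f: "f \<in> I" and g: "g \<in> I"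
    obtain w where w: "w \<in> \<phi> p" "(\<lambda>z. f z - ratio V w e z) \<in> Q.M 2" using f by (auto simp: I_def)
    obtain x where x: "x \<in> \<phi> p" "(\<lambda>z. g z - ratio V x e z) \<in> Q.M 2" using g by (auto simp: I_def)
    have wx: "w \<in> V" "x \<in> V" using w x sub by auto
    have "\<forall>\<^sub>F z in zariski_nhds V (\<phi> ` C) (\<phi> p).
        (f z - ratio V w e z) + (g z - ratio V x e z) = f z + g z - ratio V (w + x) e z"
      using Q.eventually_Proj
      by eventually_elim (simp add: ratio_add[OF subspace_V _ wx e_in_V])
    from Q.M_cong[OF Q.M_add[OF w(2) x(2)] this] show "(\<lambda>z. f z + g z) \<in> I"
      using cv.subspace_add[OF sub(2) w(1) x(1)] f g Q.R_add unfolding I_def by blast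
  next
    fix f g assume f: "f \<in> Q.R" and g: "g \<in> I"
    obtain w where w: "w \<in> \<phi> p" "(\<lambda>z. g z - ratio V w e z) \<in> Q.M 2" using g by (auto simp: I_def)
    have wV: "w \<in> V" using w sub by auto
    let ?c = "f (\<phi> p)"
    have 1: "(\<lambda>z. f z * (g z - ratio V w e z)) \<in> Q.M 2" by (rule Q.M_mult[OF f w(2)])
    \<comment> \<open>Modulo m^2 a factor \<open>f\<close> acts on \<open>w / e\<close> through its
      value \<open>?c\<close>, because \<open>f - ?c\<close> and \<open>w / e\<close> both vanish at
      the point. This makes \<open>I\<close> an ideal.\<close>
    have "(\<lambda>z. (f z - ?c) * ratio V w e z) \<in> Q.M (Suc (Suc 0))"
    proof (rule Q.M_SucI)
      show "(\<lambda>z. f z - ?c) \<in> Q.R" by (rule Q.R_diff[OF f Q.R_const])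
      show "ratio V w e \<in> Q.M (Suc 0)" unfolding Q.M_1
        using Q.ratio_R[OF wV e_in_V e_notin] ratio_eq_0[OF subspace_V Q.y_in_Proj wV e_in_V w(1)] by simp
    qed simp
    then have 2: "(\<lambda>z. (f z - ?c) * ratio V w e z) \<in> Q.M 2" by (simp add: numeral_2_eq_2)
    have "\<forall>\<^sub>F z in zariski_nhds V (\<phi> ` C) (\<phi> p).
        f z * (g z - ratio V w e z) + (f z - ?c) * ratio V w e z = f z * g z - ratio V (cscale ?c w) e z"
      using Q.eventually_Proj
      by eventually_elim (simp add: ratio_scale[OF subspace_V _ wV e_in_V] algebra_simps)
    from Q.M_cong[OF Q.M_add[OF 1 2] this] show "(\<lambda>z. f z * g z) \<in> I"
      using cv.subspace_scale[OF sub(2) w(1)] f g Q.R_mult unfolding I_def by blast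
  next
    have z: "0 \<in> \<phi> p" by (rule cv.subspace_0[OF sub(2)])
    have "\<forall>\<^sub>F z in zariski_nhds V (\<phi> ` C) (\<phi> p). 0 = 0 - ratio V 0 e z"
      using Q.eventually_Proj
    proof eventually_elim
      case (elim z)
      then have "0 \<in> z" by (auto simp: Proj_def cv.subspace_0)
      then show ?case
        using ratio_eq_0[OF subspace_V elim cv.subspace_0[OF subspace_V] e_in_V] by simp
    qed
    from Q.M_cong[OF Q.M_zero this] show "(\<lambda>_. 0) \<in> I"
      using z Q.R_const unfolding I_def by blast
  next
    fix w assume w: "w \<in> \<phi> p"
    then have "w \<in> V" using sub by auto
    then show "ratio V w e \<in> I"
      using w Q.M_zero[of 2] Q.ratio_R[OF _ e_in_V e_notin] unfolding I_def
      by (intro CollectI conjI bexI[of _ w]) auto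
  next
    have "t \<circ> \<psi> \<in> Q.R" by (rule \<psi>(2)[OF t_R])
    then show "t \<circ> \<psi> \<in> Q.M (Suc 0)" using t_0 \<psi>(1)[OF p_in_C] by (simp add: Q.M_1)
  qed
  \<comment> \<open>Pulled back to \<open>C\<close>, the congruence reads
    \<open>t - rel w \<in> M 2\<close>, so \<open>rel w\<close> has the coefficients of
    \<open>t\<close> in orders 0 and 1.\<close>
  then obtain w where w: "w \<in> \<phi> p" "(\<lambda>z. (t \<circ> \<psi>) z - ratio V w e z) \<in> Q.M 2" by (auto simp: I_def)
  have wV: "w \<in> V" using w sub by auto
  have "(\<lambda>z. (t \<circ> \<psi>) z - ratio V w e z) \<circ> \<phi> \<in> M 2"
    by (rule mpow_pullback[OF pullback refl w(2)])
  moreover have "\<forall>\<^sub>F q in zariski_nhds U C p. ((\<lambda>z. (t \<circ> \<psi>) z - ratio V w e z) \<circ> \<phi>) q = t q + (- 1) * rel w q"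
    using P.eventually_Y by eventually_elim (simp add: \<psi>(1) rel_fun_def)
  ultimately have M2: "(\<lambda>q. t q + (- 1) * rel w q) \<in> M 2" by (rule M_cong)
  have "coef (\<lambda>q. t q + (- 1) * rel w q) j = coef t j - coef (rel w) j" if "j < 3" for j
    unfolding coef_add[OF t_R R_scale[OF rel_R[OF wV]] that] coef_scale[OF rel_R[OF wV] that] by simp
  then have "coef (rel w) 0 = 0 \<and> coef (rel w) 1 = 1"
    using M2 coef_M2[OF M_subset_R[OF M2]] coef_t by simp
  then show ?thesis using wV by blast
qed

text \<open>Together with \<open>e\<close>, whose coefficients of orders 0 and 1 are 1 and 0, this
  is a dual system for these two coefficients.\<close>

definition tangent_section :: "('a \<times> 'b cvec set) cvec"
  where "tangent_section = (SOME w. w \<in> V \<and> coef (rel w) 0 = 0 \<and> coef (rel w) 1 = 1)"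

lemma tangent_section: "tangent_section \<in> V"
  "coef (rel tangent_section) 0 = 0" "coef (rel tangent_section) 1 = 1"
proof -
  have "\<exists>w. w \<in> V \<and> coef (rel w) 0 = 0 \<and> coef (rel w) 1 = 1"
    using tangent_section_exists by blast
  from someI_ex[OF this] show "tangent_section \<in> V"
    "coef (rel tangent_section) 0 = 0" "coef (rel tangent_section) 1 = 1"
    unfolding tangent_section_def[symmetric] by auto
qed

text \<open>The rank count with \<open>n * k = 1 * 2\<close> conditions, the dual system being
  \<open>e\<close> and \<open>tangent_section\<close>.\<close>

lemma is_flex_iff: "is_flex V 1 (\<phi> ` C) (\<phi> p) \<longleftrightarrow>
  (\<forall>v\<in>V. coef (rel v) 0 = 0 \<and> coef (rel v) 1 = 0 \<longrightarrow> coef (rel v) 2 = 0)"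
proof -
  let ?a = "\<lambda>j v. coef (rel v) j" and ?b = "\<lambda>j. if j = 0 then e else tangent_section"
  have "\<phi> p \<in> infl_locus V 1 (\<phi> ` C) 2 \<longleftrightarrow> (\<forall>v\<in>V. (\<forall>j\<in>{0,1::nat}. ?a j v = 0) \<longrightarrow> ?a 2 v = 0)"
  proof (rule mem_infl_locus_iff[OF subspace_V, where b = ?b])
    have "rel v \<in> M 3 \<longleftrightarrow> (\<forall>j\<in>{0,1::nat}. ?a j v = 0) \<and> ?a 2 v = 0" if "v \<in> V" for v
      using coef_M3[OF rel_R[OF that]] by simp
    then show "jet_ker V (\<phi> ` C) 2 (\<phi> p) = {v \<in> V. (\<forall>j\<in>{0,1::nat}. ?a j v = 0) \<and> ?a 2 v = 0}"
      unfolding Q.jet_ker_eq[OF e_in_V e_notin] using rel_M3_iff by auto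
    show "linear_on V (?a j)" if "j \<in> {0,1::nat}" for j using that by (intro coef_rel_linear) auto
    show "linear_on V (?a 2)" by (intro coef_rel_linear) auto
    show "?b j \<in> V" for j using e_in_V tangent_section by simp
    show "?a j (?b k) = (if j = k then 1 else 0)" if "j \<in> {0,1::nat}" "k \<in> {0,1::nat}" for j k
      using that coef_rel_e tangent_section by auto
  qed (use p_in_C in auto)
  then show ?thesis unfolding is_flex_def by simp
qed

end

section \<open>Decomposable scrolls\<close>

definition inj_comp :: "nat \<Rightarrow> 'x cvec \<Rightarrow> (nat \<times> 'x) cvec"
  where "inj_comp i v = (\<lambda>(j, x). if j = i then v x else 0)"

lemma component_inj_comp: "component i (inj_comp j v) = (if i = j then v else 0)"
  by (auto simp: component_def inj_comp_def fun_eq_iff)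

lemma component_add: "component i (u + v) = component i u + component i v"
  by (simp add: component_def fun_eq_iff)

lemma component_scale: "component i (cscale c v) = cscale c (component i v)"
  by (simp add: component_def fun_eq_iff cscale_def)

lemma component_zero: "component i 0 = 0"
  by (simp add: component_def fun_eq_iff)

lemma inj_comp_diff: "inj_comp i (u - v) = inj_comp i u - inj_comp i v"
  by (auto simp: inj_comp_def fun_eq_iff)

lemma inj_comp_scale: "inj_comp i (cscale c v) = cscale c (inj_comp i v)"
  by (auto simp: inj_comp_def fun_eq_iff cscale_def)

lemma inj_comp_add: "inj_comp i (u + v) = inj_comp i u + inj_comp i v"
  by (auto simp: inj_comp_def fun_eq_iff)

lemma subspace_direct_sum:
  assumes "\<And>i. i \<in> {1..n} \<Longrightarrow> cv.subspace (V i)"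
  shows "cv.subspace (direct_sum n V)"
proof (rule cv.subspaceI)
  show "0 \<in> direct_sum n V"
    by (simp add: direct_sum_def component_zero cv.subspace_0[OF assms])
next
  fix u v assume "u \<in> direct_sum n V" "v \<in> direct_sum n V"
  then show "u + v \<in> direct_sum n V"
    by (simp add: direct_sum_def component_add cv.subspace_add[OF assms])
next
  fix c v assume "v \<in> direct_sum n V"
  then show "cscale c v \<in> direct_sum n V"
    by (simp add: direct_sum_def component_scale cv.subspace_scale[OF assms])
qed

lemma inj_comp_direct_sum:
  assumes "\<And>i. i \<in> {1..n} \<Longrightarrow> cv.subspace (V i)" "i \<in> {1..n}" "v \<in> V i"
  shows "inj_comp i v \<in> direct_sum n V"
  using assms(2,3) cv.subspace_0[OF assms(1)] by (simp add: direct_sum_def component_inj_comp)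

lemma direct_sum_eq_sum:
  assumes "v \<in> direct_sum n V"
  shows "v = (\<Sum>i\<in>{1..n}. inj_comp i (component i v))"
proof (rule ext)
  fix x :: "nat \<times> 'a"
  obtain j a where x: "x = (j, a)" by (cases x)
  have "(\<Sum>i\<in>{1..n}. inj_comp i (component i v)) x = (\<Sum>i\<in>{1..n}. if i = j then v (j, a) else 0)"
    unfolding sum_apply x by (intro sum.cong) (auto simp: inj_comp_def component_def)
  also have "\<dots> = (if j \<in> {1..n} then v (j, a) else 0)" by simp
  also have "\<dots> = v x"
  proof (cases "j \<in> {1..n}")
    case False
    then have "component j v = 0" using assms by (simp add: direct_sum_def)
    then have "v (j, a) = 0" by (simp add: component_def fun_eq_iff)
    then show ?thesis using False x by simp
  qed (simp add: x)
  finally show "v x = (\<Sum>i\<in>{1..n}. inj_comp i (component i v)) x" by simp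
qed

section \<open>Fibres of line bundles as vector spaces\<close>

lemma lb_fibreI:
  assumes "\<And>a. a \<notin> lb_index L \<or> q \<notin> lb_open L a \<Longrightarrow> v a = 0"
    and "\<And>a b. a \<in> lb_index L \<Longrightarrow> b \<in> lb_index L \<Longrightarrow> q \<in> lb_open L a \<Longrightarrow> q \<in> lb_open L b \<Longrightarrow>
      v a = lb_trans L a b q * v b"
  shows "v \<in> lb_fibre L q"
  unfolding lb_fibre_def mem_Collect_eq by (intro conjI allI ballI impI assms; (elim IntE)?; assumption)

lemma lb_fibreD:
  assumes "v \<in> lb_fibre L q"
  shows "a \<notin> lb_index L \<or> q \<notin> lb_open L a \<Longrightarrow> v a = 0"
    and "a \<in> lb_index L \<Longrightarrow> b \<in> lb_index L \<Longrightarrow> q \<in> lb_open L a \<Longrightarrow> q \<in> lb_open L b \<Longrightarrow>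
      v a = lb_trans L a b q * v b"
proof -
  note * = assms[unfolded lb_fibre_def mem_Collect_eq]
  show "a \<notin> lb_index L \<or> q \<notin> lb_open L a \<Longrightarrow> v a = 0"
    using conjunct1[OF *] by blast
  show "a \<in> lb_index L \<Longrightarrow> b \<in> lb_index L \<Longrightarrow> q \<in> lb_open L a \<Longrightarrow> q \<in> lb_open L b \<Longrightarrow>
      v a = lb_trans L a b q * v b"
    by (rule conjunct2[OF *, rule_format]) auto
qed

lemma subspace_lb_fibre: "cv.subspace (lb_fibre L q)"
proof (rule cv.subspaceI)
  show "0 \<in> lb_fibre L q" by (rule lb_fibreI) simp_all
next
  fix u v assume u: "u \<in> lb_fibre L q" and v: "v \<in> lb_fibre L q"
  show "u + v \<in> lb_fibre L q"
  proof (rule lb_fibreI)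
    fix a assume "a \<notin> lb_index L \<or> q \<notin> lb_open L a"
    then show "(u + v) a = 0" using lb_fibreD(1)[OF u] lb_fibreD(1)[OF v] by simp
  next
    fix a b assume *: "a \<in> lb_index L" "b \<in> lb_index L" "q \<in> lb_open L a" "q \<in> lb_open L b"
    show "(u + v) a = lb_trans L a b q * (u + v) b"
      unfolding plus_fun_apply lb_fibreD(2)[OF u *] lb_fibreD(2)[OF v *] by (rule distrib_left[symmetric])
  qed
next
  fix c v assume v: "v \<in> lb_fibre L q"
  show "cscale c v \<in> lb_fibre L q"
  proof (rule lb_fibreI)
    fix a assume "a \<notin> lb_index L \<or> q \<notin> lb_open L a"
    then show "cscale c v a = 0" using lb_fibreD(1)[OF v] by (simp add: cscale_def)
  next
    fix a b assume *: "a \<in> lb_index L" "b \<in> lb_index L" "q \<in> lb_open L a" "q \<in> lb_open L b"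
    show "cscale c v a = lb_trans L a b q * cscale c v b"
      unfolding cscale_apply lb_fibreD(2)[OF v *] by (rule mult.left_commute)
  qed
qed

section \<open>The scroll over a neighbourhood of \<open>p\<close>, in homogeneous fibre
  coordinates\<close>

locale decomposable_scroll =
  uniformized_germ_ring "local_ring U C p" "zariski_nhds U C p" p t
  for U :: "'b cvec set" and C p t +
  fixes n :: nat and L :: "nat \<Rightarrow> ('a, 'b cvec set) line_bundle"
    and V :: "nat \<Rightarrow> ('a \<times> 'b cvec set) cvec set"
  assumes subspace_U: "cv.subspace U" and C_Proj: "C \<subseteq> Proj U" and p_in_C: "p \<in> C"
    and line_bundle: "i \<in> {1..n} \<Longrightarrow> line_bundle_on U C (L i)"
    and subspace_V: "i \<in> {1..n} \<Longrightarrow> cv.subspace (V i)"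
    and V_H0: "i \<in> {1..n} \<Longrightarrow> V i \<subseteq> H0 U C (L i)"
    and embedding: "i \<in> {1..n} \<Longrightarrow> gives_embedding U C (V i)"
begin

lemma curve: "i \<in> {1..n} \<Longrightarrow> embedded_curve U C p t (V i)"
  using uniformized_germ_ring_axioms subspace_U C_Proj p_in_C subspace_V embedding
  by (simp add: embedded_curve_def embedded_curve_axioms_def)

abbreviation "R \<equiv> local_ring U C p"
abbreviation "W \<equiv> direct_sum n V"
abbreviation "X \<equiv> scroll C n L V"
abbreviation "e \<equiv> \<lambda>i. base_section (V i) p"
abbreviation "rel \<equiv> \<lambda>i. rel_fun (V i) p"
abbreviation "E \<equiv> \<lambda>i. inj_comp i (e i)"

lemma subspace_W: "cv.subspace W"
  by (rule subspace_direct_sum) (rule subspace_V)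

lemma inj_W: "i \<in> {1..n} \<Longrightarrow> v \<in> V i \<Longrightarrow> inj_comp i v \<in> W"
  by (rule inj_comp_direct_sum) (rule subspace_V)

lemma component_V: "v \<in> W \<Longrightarrow> i \<in> {1..n} \<Longrightarrow> component i v \<in> V i"
  by (simp add: direct_sum_def)

lemma e_V: "i \<in> {1..n} \<Longrightarrow> e i \<in> V i"
  by (rule embedded_curve.e_in_V[OF curve])

lemma E_W: "i \<in> {1..n} \<Longrightarrow> E i \<in> W"
  by (rule inj_W[OF _ e_V])

lemma sys_map_Proj: "i \<in> {1..n} \<Longrightarrow> q \<in> C \<Longrightarrow> sys_map (V i) q \<in> Proj (V i)"
  by (rule embedded_curve.sys_map_Proj[OF curve])

lemma rel_R: "i \<in> {1..n} \<Longrightarrow> v \<in> V i \<Longrightarrow> rel i v \<in> R"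
  by (rule embedded_curve.rel_R[OF curve])

text \<open>Near \<open>p\<close> the sections \<open>e i\<close> trivialize the line bundles; \<open>combination c q\<close> is the functional
  with homogeneous coordinates \<open>c\<close> in the fibre over \<open>q\<close> and \<open>point c q\<close> the corresponding point.\<close>

definition trivial_at :: "'b cvec set \<Rightarrow> bool"
  where "trivial_at q \<longleftrightarrow> q \<in> C \<and> (\<forall>i\<in>{1..n}. e i \<notin> sys_map (V i) q)"

definition combination :: "(nat \<Rightarrow> complex) \<Rightarrow> 'b cvec set \<Rightarrow> (nat \<times> 'a \<times> 'b cvec set) cvec \<Rightarrow> complex"
  where "combination c q v = (\<Sum>i\<in>{1..n}. c i * rel i (component i v) q)"

definition point :: "(nat \<Rightarrow> complex) \<Rightarrow> 'b cvec set \<Rightarrow> (nat \<times> 'a \<times> 'b cvec set) cvec set"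
  where "point c q = {v \<in> W. combination c q v = 0}"

lemma trivial_at_p: "trivial_at p"
  unfolding trivial_at_def using p_in_C embedded_curve.e_notin[OF curve] by blast

lemma eventually_trivial_at: "eventually trivial_at (zariski_nhds U C p)"
proof -
  interpret P: embedded_point U C p using subspace_U C_Proj p_in_C by unfold_locales auto
  have "\<forall>\<^sub>F q in zariski_nhds U C p. \<forall>i\<in>{1..n}. e i \<notin> sys_map (V i) q"
    by (rule eventually_ball_finite) (use embedded_curve.eventually_e[OF curve] in auto)
  then show ?thesis unfolding trivial_at_def using P.eventually_Y by eventually_elim blast
qed

lemma linear_combination:
  assumes "q \<in> C"
  shows "linear_on W (combination c q)"
  unfolding linear_on_def
proof (intro conjI ballI allI)
  fix u v assume uv: "u \<in> W" "v \<in> W"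
  have "rel i (component i (u + v)) q = rel i (component i u) q + rel i (component i v) q" if "i \<in> {1..n}" for i
    unfolding component_add by (rule embedded_curve.rel_add[OF curve[OF that] assms]) (use uv that component_V in auto)
  then show "combination c q (u + v) = combination c q u + combination c q v"
    unfolding combination_def sum.distrib[symmetric] by (intro sum.cong) (simp_all add: algebra_simps)
next
  fix a v assume v: "v \<in> W"
  have "rel i (component i (cscale a v)) q = a * rel i (component i v) q" if "i \<in> {1..n}" for i
    unfolding component_scale by (rule embedded_curve.rel_scale[OF curve[OF that] assms]) (use v that component_V in auto)
  then show "combination c q (cscale a v) = a * combination c q v"
    unfolding combination_def sum_distrib_left by (intro sum.cong) (simp_all add: algebra_simps)
qed

lemma rel_zero: "i \<in> {1..n} \<Longrightarrow> q \<in> C \<Longrightarrow> rel i 0 q = 0"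
  using embedded_curve.rel_scale[OF curve, of i q 0 0] cv.subspace_0[OF subspace_V] by simp

lemma combination_inj:
  assumes "q \<in> C" "i \<in> {1..n}"
  shows "combination c q (inj_comp i v) = c i * rel i v q"
proof -
  have "combination c q (inj_comp i v) = (\<Sum>j\<in>{1..n}. if j = i then c i * rel i v q else 0)"
    unfolding combination_def by (intro sum.cong) (auto simp: component_inj_comp rel_zero assms)
  then show ?thesis using assms(2) by simp
qed

lemma combination_E: "trivial_at q \<Longrightarrow> i \<in> {1..n} \<Longrightarrow> combination c q (E i) = c i"
  using embedded_curve.rel_e[OF curve] by (simp add: combination_inj trivial_at_def)

lemma point_functional: "q \<in> C \<Longrightarrow> combination c q \<in> functionals W (point c q)"
  unfolding functionals_iff point_def by (simp add: linear_combination)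

lemma point_Proj:
  assumes "trivial_at q" "s \<in> {1..n}" "c s \<noteq> 0"
  shows "point c q \<in> Proj W"
  unfolding point_def
  by (rule Proj_ker[OF subspace_W linear_combination E_W[OF assms(2)]])
     (use assms combination_E in \<open>auto simp: trivial_at_def\<close>)

lemma section_eq_0_iff:
  assumes i: "i \<in> {1..n}" and a: "a \<in> lb_index (L i)" "q \<in> lb_open (L i) a" and v: "v \<in> V i"
  shows "sec_value v q = 0 \<longleftrightarrow> v (a, q) = 0"
proof
  assume "sec_value v q = 0"
  then show "v (a, q) = 0" by (simp add: sec_value_def fun_eq_iff)
next
  assume 0: "v (a, q) = 0"
  have "v \<in> H0 U C (L i)" using V_H0[OF i] v by blast
  then have fib: "sec_value v q \<in> lb_fibre (L i) q" unfolding H0_def by simp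
  have "sec_value v q b = 0" for b
  proof (cases "b \<in> lb_index (L i) \<and> q \<in> lb_open (L i) b")
    case True
    have "sec_value v q b = lb_trans (L i) b a q * sec_value v q a"
      by (rule lb_fibreD(2)[OF fib]) (use a True in auto)
    then show ?thesis using 0 by (simp add: sec_value_def)
  next
    case False
    then show ?thesis using lb_fibreD(1)[OF fib] by blast
  qed
  then show "sec_value v q = 0" by (simp add: fun_eq_iff)
qed

text \<open>Evaluation in a chart represents the point \<open>sys_map (V i) q\<close>, so
  \<open>rel i v q\<close> is a quotient of two local expressions.\<close>

lemma evaluation_functional:
  assumes i: "i \<in> {1..n}" and a: "a \<in> lb_index (L i)" "q \<in> lb_open (L i) a"
  shows "(\<lambda>v. v (a, q)) \<in> functionals (V i) (sys_map (V i) q)"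
proof -
  have "{s \<in> V i. s (a, q) = 0} = sys_map (V i) q"
    unfolding sys_map_def by (intro Collect_cong conj_cong refl) (simp add: section_eq_0_iff[OF assms])
  then show ?thesis unfolding functionals_iff linear_on_def by (simp add: cscale_def)
qed

lemma point_scroll:
  assumes q: "trivial_at q" and s: "s \<in> {1..n}" "c s \<noteq> 0"
  shows "point c q \<in> X"
proof -
  have qC: "q \<in> C" using q by (simp add: trivial_at_def)
  have "\<exists>a. a \<in> lb_index (L i) \<and> q \<in> lb_open (L i) a" if i: "i \<in> {1..n}" for i
  proof -
    have "(\<Union>a\<in>lb_index (L i). lb_open (L i) a) = C"
      using line_bundle[OF i] unfolding line_bundle_on_def by (elim conjE)
    then show ?thesis using qC by blast
  qed
  then obtain a where a: "\<And>i. i \<in> {1..n} \<Longrightarrow> a i \<in> lb_index (L i) \<and> q \<in> lb_open (L i) (a i)"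
    by metis
  have rel: "rel i v q = v (a i, q) / e i (a i, q)" if i: "i \<in> {1..n}" and v: "v \<in> V i" for i v
    unfolding rel_fun_def
    using ratio_eq[OF subspace_V[OF i] v e_V[OF i] evaluation_functional[OF i, of "a i" q]] a[OF i] by simp
  define D where "D = direct_sum n (\<lambda>i. lb_fibre (L i) q)"
  \<comment> \<open>The functional on the fibre of the bundle that takes the value
    \<open>c i\<close> on the value of \<open>e i\<close> at \<open>q\<close>; composed with
    evaluation of sections it is \<open>combination c q\<close>. Its kernel is the hyperplane
    defining the point of the scroll.\<close>
  define k where "k w = (\<Sum>i\<in>{1..n}. c i / e i (a i, q) * w (i, a i))" for w :: "(nat \<times> 'a) cvec"
  have D: "cv.subspace D" unfolding D_def by (rule subspace_direct_sum) (rule subspace_lb_fibre)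
  have k: "linear_on D k" unfolding linear_on_def k_def cscale_def
    by (simp add: distrib_left add_divide_distrib sum.distrib sum_distrib_left mult_ac)
  have fib: "fibre_value v q \<in> D" if v: "v \<in> W" for v
  proof -
    have comp: "component i (fibre_value v q) = sec_value (component i v) q" for i
      by (simp add: component_def fibre_value_def sec_value_def)
    have "sec_value (component i v) q \<in> lb_fibre (L i) q" if "i \<in> {1..n}" for i
    proof -
      have "component i v \<in> H0 U C (L i)" using V_H0[OF that] component_V[OF v that] by blast
      then show ?thesis unfolding H0_def by simp
    qed
    moreover have "sec_value (component i v) q = 0" if "i \<notin> {1..n}" for i
    proof -
      have "component i v = 0" using v that by (simp add: direct_sum_def)
      then show ?thesis by (simp add: sec_value_def fun_eq_iff)
    qed
    ultimately show ?thesis unfolding D_def direct_sum_def mem_Collect_eq comp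
      by (intro conjI ballI allI impI)
  qed
  have k_fib: "k (fibre_value v q) = combination c q v" if v: "v \<in> W" for v
    unfolding k_def combination_def
  proof (rule sum.cong[OF refl])
    fix i assume i: "i \<in> {1..n}"
    show "c i / e i (a i, q) * fibre_value v q (i, a i) = c i * rel i (component i v) q"
      unfolding rel[OF i component_V[OF v i]] by (simp add: fibre_value_def component_def)
  qed
  have "{w \<in> D. k w = 0} \<in> Proj D"
    by (rule Proj_ker[OF D k fib[OF E_W[OF s(1)]]]) (use k_fib[OF E_W[OF s(1)]] combination_E[OF q s(1)] s in simp)
  then have "(q, {w \<in> D. k w = 0}) \<in> proj_bundle C n L"
    using qC by (simp add: proj_bundle_def D_def)
  moreover have "point c q = scroll_map n V (q, {w \<in> D. k w = 0})"
    unfolding scroll_map_def point_def using fib k_fib by auto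
  ultimately show ?thesis unfolding scroll_def by (rule image_eqI[rotated])
qed

text \<open>A section vanishing at \<open>q\<close> has value 0 in the fibre and so lies over every
  hyperplane there. An arbitrary point of the scroll enters the later arguments through this
  property.\<close>

lemma scroll_base_point:
  assumes "z \<in> X"
  obtains q where "q \<in> C" "\<And>i v. i \<in> {1..n} \<Longrightarrow> v \<in> sys_map (V i) q \<Longrightarrow> inj_comp i v \<in> z"
proof -
  obtain q H where q: "q \<in> C" and H: "H \<in> Proj (direct_sum n (\<lambda>i. lb_fibre (L i) q))"
    and z: "z = scroll_map n V (q, H)"
    using assms unfolding scroll_def proj_bundle_def by auto
  have "0 \<in> H" using H by (auto simp: Proj_def cv.subspace_0)
  have "inj_comp i v \<in> z" if i: "i \<in> {1..n}" and v: "v \<in> sys_map (V i) q" for i v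
  proof -
    have "v \<in> V i" and "sec_value v q = 0" using v by (auto simp: sys_map_def)
    then have "fibre_value (inj_comp i v) q = 0"
      by (auto simp: fibre_value_def inj_comp_def sec_value_def fun_eq_iff)
    then show ?thesis unfolding z scroll_map_def using inj_W[OF i \<open>v \<in> V i\<close>] \<open>0 \<in> H\<close> by simp
  qed
  with q show ?thesis by (rule that)
qed

text \<open>On the \<open>i\<close>-th summand \<open>l\<close> kills the hyperplane of sections
  vanishing at \<open>q\<close>, so it is a multiple of evaluation at \<open>q\<close>; its value on
  \<open>u\<close> fixes the multiple.\<close>

lemma functional_inj:
  assumes z: "z \<in> Proj W" and l: "l \<in> functionals W z" and q: "q \<in> C"
    and van: "\<And>v. v \<in> sys_map (V i) q \<Longrightarrow> inj_comp i v \<in> z"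
    and i: "i \<in> {1..n}" and v: "v \<in> V i" and u: "u \<in> V i" "u \<notin> sys_map (V i) q"
  shows "l (inj_comp i v) = ratio (V i) v u (sys_map (V i) q) * l (inj_comp i u)"
proof -
  obtain m where m: "m \<in> functionals (V i) (sys_map (V i) q)"
    using functionals_nonempty[OF subspace_V[OF i] sys_map_Proj[OF i q]] by blast
  then have lin: "linear_on (V i) m" by (simp add: functionals_iff)
  have l_lin: "linear_on W l" using l by (simp add: functionals_iff)
  have mu: "m u \<noteq> 0" using functional_eq_0_iff[OF m u(1)] u(2) by simp
  let ?c = "m v / m u"
  let ?w = "v - cscale ?c u"
  have su: "cscale ?c u \<in> V i" by (rule cv.subspace_scale[OF subspace_V[OF i] u(1)])
  have w: "?w \<in> V i" by (rule cv.subspace_diff[OF subspace_V[OF i] v su])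
  have "m ?w = 0"
    using linear_on_diff[OF subspace_V[OF i] lin v su] linear_on_scale[OF lin u(1)] mu by simp
  then have "?w \<in> sys_map (V i) q" using functional_eq_0_iff[OF m w] by simp
  then have "l (inj_comp i ?w) = 0"
    using van functional_eq_0_iff[OF l inj_W[OF i w]] by blast
  moreover have "l (inj_comp i ?w) = l (inj_comp i v) - ?c * l (inj_comp i u)"
    unfolding inj_comp_diff inj_comp_scale
    using linear_on_diff[OF subspace_W l_lin inj_W[OF i v] cv.subspace_scale[OF subspace_W inj_W[OF i u(1)]]]
      linear_on_scale[OF l_lin inj_W[OF i u(1)]] by simp
  ultimately show ?thesis using ratio_eq[OF subspace_V[OF i] v u(1) m] by simp
qed

lemma rel_eq_0_iff:
  assumes "trivial_at q" and i: "i \<in> {1..n}" and v: "v \<in> V i"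
  shows "rel i v q = 0 \<longleftrightarrow> v \<in> sys_map (V i) q"
proof -
  have q: "q \<in> C" "e i \<notin> sys_map (V i) q" using assms by (auto simp: trivial_at_def)
  obtain m where m: "m \<in> functionals (V i) (sys_map (V i) q)"
    using functionals_nonempty[OF subspace_V[OF i] sys_map_Proj[OF i q(1)]] by blast
  have "m (e i) \<noteq> 0" using functional_eq_0_iff[OF m e_V[OF i]] q(2) by simp
  then show ?thesis
    unfolding rel_fun_def ratio_eq[OF subspace_V[OF i] v e_V[OF i] m]
    using functional_eq_0_iff[OF m v] by simp
qed

lemma embedded_point_point:
  assumes "s \<in> {1..n}" "c s \<noteq> 0"
  shows "embedded_point W X (point c p)"
  by unfold_locales (use subspace_W point_scroll point_Proj trivial_at_p assms in auto)

lemma E_notin_point: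
  assumes "s \<in> {1..n}" "c s \<noteq> 0"
  shows "E s \<notin> point c p"
  using combination_E[OF trivial_at_p assms(1)] assms(2) by (simp add: point_def)

text \<open>The projection of the scroll to \<open>C\<close> near a point off the \<open>s\<close>-th face of the fibre: project
  linearly to the \<open>s\<close>-th curve, and go back to \<open>C\<close>.\<close>

lemma projection_exists:
  assumes s: "s \<in> {1..n}" "c s \<noteq> 0"
  obtains \<pi> where "\<pi> (point c p) = p"
    and "\<And>f. f \<in> R \<Longrightarrow> f \<circ> \<pi> \<in> local_ring W X (point c p)"
    and "\<And>P. eventually P (zariski_nhds U C p) \<Longrightarrow>
      eventually (\<lambda>z. P (\<pi> z)) (zariski_nhds W X (point c p))"
    and "\<And>z. z \<in> X \<Longrightarrow> z \<in> Proj W \<Longrightarrow> E s \<notin> z \<Longrightarrow> \<pi> z \<in> C"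
    and "\<And>z i v. z \<in> X \<Longrightarrow> z \<in> Proj W \<Longrightarrow> E s \<notin> z \<Longrightarrow> i \<in> {1..n} \<Longrightarrow>
      v \<in> sys_map (V i) (\<pi> z) \<Longrightarrow> inj_comp i v \<in> z"
proof -
  interpret S: embedded_curve U C p t "V s" by (rule curve[OF s(1)])
  interpret X: embedded_point W X "point c p" by (rule embedded_point_point[where s = s and c = c, OF s])
  note E = E_notin_point[where s = s and c = c, OF s]
  \<comment> \<open>Linear projection means restricting functionals to the \<open>s\<close>-th
    summand; \<open>E s \<notin> z\<close> keeps the restriction nonzero.\<close>
  define pr where "pr z = {v \<in> V s. inj_comp s v \<in> z}" for z
  have pr_eq: "pr z = sys_map (V s) q"
    if z: "z \<in> Proj W" "E s \<notin> z" and q: "q \<in> C"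
      and van: "\<And>v. v \<in> sys_map (V s) q \<Longrightarrow> inj_comp s v \<in> z" for z q
  proof -
    obtain l where l: "l \<in> functionals W z" using functionals_nonempty[OF subspace_W z(1)] by blast
    have nz: "l (E s) \<noteq> 0" using functional_eq_0_iff[OF l E_W[OF s(1)]] z(2) by simp
    have eq: "e s \<notin> sys_map (V s) q" using van z(2) by blast
    obtain m where m: "m \<in> functionals (V s) (sys_map (V s) q)"
      using functionals_nonempty[OF S.subspace_V S.sys_map_Proj[OF q]] by blast
    have "m (e s) \<noteq> 0" using functional_eq_0_iff[OF m S.e_in_V] eq by simp
    have "inj_comp s v \<in> z \<longleftrightarrow> v \<in> sys_map (V s) q" if v: "v \<in> V s" for v
    proof -
      have "l (inj_comp s v) = m v / m (e s) * l (E s)"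
        using functional_inj[OF z(1) l q van s(1) v S.e_in_V eq]
        unfolding ratio_eq[OF S.subspace_V v S.e_in_V m] .
      then have "l (inj_comp s v) = 0 \<longleftrightarrow> m v = 0" using nz \<open>m (e s) \<noteq> 0\<close> by simp
      then show ?thesis using functional_eq_0_iff[OF m v] functional_eq_0_iff[OF l inj_W[OF s(1) v]] by simp
    qed
    moreover have "sys_map (V s) q \<subseteq> V s" by (auto simp: sys_map_def)
    ultimately show ?thesis unfolding pr_def by blast
  qed
  have pr_p: "pr (point c p) = sys_map (V s) p"
  proof (rule pr_eq[OF X.y_in_Proj E p_in_C])
    fix v assume v: "v \<in> sys_map (V s) p"
    then have vV: "v \<in> V s" by (simp add: sys_map_def)
    have "rel s v p = 0" using rel_eq_0_iff[OF trivial_at_p s(1) vV] v by simp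
    then show "inj_comp s v \<in> point c p"
      using inj_W[OF s(1) vV] by (simp add: point_def combination_inj[OF p_in_C s(1)])
  qed
  \<comment> \<open>The functions \<open>ratio W (inj_comp s v) (E s)\<close> are homogeneous
    coordinates of \<open>pr z\<close> that are regular at the point, as
    \<open>local_ring_pullback\<close> demands.\<close>
  have ev: "\<forall>\<^sub>F z in zariski_nhds W X (point c p). pr z \<in> sys_map (V s) ` C \<and> pr z \<in> Proj (V s) \<and>
      (\<lambda>v. ratio W (inj_comp s v) (E s) z) \<in> functionals (V s) (pr z)"
    using X.eventually_Y X.eventually_Proj X.eventually_not_mem[OF E_W[OF s(1)] E]
  proof eventually_elim
    case (elim z)
    obtain q where q: "q \<in> C" "\<And>i v. i \<in> {1..n} \<Longrightarrow> v \<in> sys_map (V i) q \<Longrightarrow> inj_comp i v \<in> z"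
      using scroll_base_point[OF elim(1)] by blast
    have eq: "pr z = sys_map (V s) q" by (rule pr_eq[OF elim(2,3) q(1) q(2)[OF s(1)]])
    obtain l where l: "l \<in> functionals W z" using functionals_nonempty[OF subspace_W elim(2)] by blast
    have l_lin: "linear_on W l" using l by (simp add: functionals_iff)
    have nz: "l (E s) \<noteq> 0" using functional_eq_0_iff[OF l E_W[OF s(1)]] elim(3) by simp
    have r: "ratio W (inj_comp s v) (E s) z = l (inj_comp s v) / l (E s)" if "v \<in> V s" for v
      by (rule ratio_eq[OF subspace_W inj_W[OF s(1) that] E_W[OF s(1)] l])
    have "linear_on (V s) (\<lambda>v. ratio W (inj_comp s v) (E s) z)"
      unfolding linear_on_def
    proof (intro conjI ballI allI)
      fix u v assume uv: "u \<in> V s" "v \<in> V s"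
      show "ratio W (inj_comp s (u + v)) (E s) z = ratio W (inj_comp s u) (E s) z + ratio W (inj_comp s v) (E s) z"
        unfolding inj_comp_add by (intro ratio_add subspace_W elim(2) inj_W s(1) uv E_W)
    next
      fix a v assume v: "v \<in> V s"
      show "ratio W (inj_comp s (cscale a v)) (E s) z = a * ratio W (inj_comp s v) (E s) z"
        unfolding inj_comp_scale by (intro ratio_scale subspace_W elim(2) inj_W s(1) v E_W)
    qed
    moreover have "{v \<in> V s. ratio W (inj_comp s v) (E s) z = 0} = pr z"
      unfolding pr_def
    proof (intro Collect_cong conj_cong refl)
      fix v assume v: "v \<in> V s"
      show "ratio W (inj_comp s v) (E s) z = 0 \<longleftrightarrow> inj_comp s v \<in> z"
        unfolding r[OF v] using nz functional_eq_0_iff[OF l inj_W[OF s(1) v]] by simp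
    qed
    ultimately have "(\<lambda>v. ratio W (inj_comp s v) (E s) z) \<in> functionals (V s) (pr z)"
      unfolding functionals_iff ..
    then show ?case using eq q(1) S.sys_map_Proj[OF q(1)] by simp
  qed
  have ring: "(\<lambda>z. ratio W (inj_comp s v) (E s) z) \<in> X.R" if "v \<in> V s" for v
    by (rule X.ratio_R[OF inj_W[OF s(1) that] E_W[OF s(1)] E])
  have pull: "f \<circ> pr \<in> X.R" if "f \<in> S.Q.R" for f
    by (rule S.Q.local_ring_pullback(1)[OF X.germ_ring_axioms pr_p ev _ that]) (erule ring)
  have pull_ev: "eventually (\<lambda>z. P (pr z)) (zariski_nhds W X (point c p))"
    if "eventually P (zariski_nhds (V s) (sys_map (V s) ` C) (sys_map (V s) p))" for P
    by (rule S.Q.local_ring_pullback(2)[OF X.germ_ring_axioms pr_p ev _ that]) (erule ring)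
  obtain \<psi> where \<psi>: "\<And>q. q \<in> C \<Longrightarrow> \<psi> (sys_map (V s) q) = q"
    and \<psi>_ring: "\<And>f. f \<in> R \<Longrightarrow> f \<circ> \<psi> \<in> local_ring (V s) (sys_map (V s) ` C) (sys_map (V s) p)"
    and \<psi>_ev: "\<And>P. eventually P (zariski_nhds U C p) \<Longrightarrow>
      eventually (\<lambda>z. P (\<psi> z)) (zariski_nhds (V s) (sys_map (V s) ` C) (sys_map (V s) p))"
    using S.inverse_exists by metis
  \<comment> \<open>\<open>pr z\<close> is the image of the base point under the \<open>s\<close>-th
    embedding, so its inverse \<open>\<psi>\<close> recovers the base point itself. Hence the
    vanishing property holds in all summands, not only in the \<open>s\<close>-th.\<close>
  have base: "\<psi> (pr z) \<in> C \<and> (\<forall>i\<in>{1..n}. \<forall>v\<in>sys_map (V i) (\<psi> (pr z)). inj_comp i v \<in> z)"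
    if z: "z \<in> X" "z \<in> Proj W" "E s \<notin> z" for z
  proof -
    obtain q where q: "q \<in> C" "\<And>i v. i \<in> {1..n} \<Longrightarrow> v \<in> sys_map (V i) q \<Longrightarrow> inj_comp i v \<in> z"
      using scroll_base_point[OF z(1)] by blast
    have "pr z = sys_map (V s) q" by (rule pr_eq[OF z(2,3) q(1) q(2)[OF s(1)]])
    then have "\<psi> (pr z) = q" using \<psi>[OF q(1)] by simp
    then show ?thesis using q by blast
  qed
  show ?thesis
  proof (rule that[of "\<psi> \<circ> pr"])
    show "(\<psi> \<circ> pr) (point c p) = p" using pr_p \<psi>[OF p_in_C] by simp
    show "f \<circ> (\<psi> \<circ> pr) \<in> local_ring W X (point c p)" if "f \<in> R" for f
      using pull[OF \<psi>_ring[OF that]] by (simp add: comp_assoc)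
    show "eventually (\<lambda>z. P ((\<psi> \<circ> pr) z)) (zariski_nhds W X (point c p))"
      if "eventually P (zariski_nhds U C p)" for P
      using pull_ev[OF \<psi>_ev[OF that]] by simp
    show "(\<psi> \<circ> pr) z \<in> C" if "z \<in> X" "z \<in> Proj W" "E s \<notin> z" for z
      using base[OF that] by simp
    show "inj_comp i v \<in> z" if "z \<in> X" "z \<in> Proj W" "E s \<notin> z" "i \<in> {1..n}"
        "v \<in> sys_map (V i) ((\<psi> \<circ> pr) z)" for z i v
      using base[OF that(1-3)] that(4,5) by simp
  qed
qed

text \<open>Restriction to the curve \<open>q \<mapsto> point (u q) q\<close> through \<open>point c p\<close>.\<close>

lemma combination_M3:
  assumes s: "s \<in> {1..n}" "c s \<noteq> 0" and v: "v \<in> W" and M3: "ratio W v (E s) \<in> mpow (local_ring W X (point c p))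
      (zariski_nhds W X (point c p)) (point c p) 3"
    and u: "\<And>i. i \<in> {1..n} \<Longrightarrow> u i \<in> R" and u_p: "\<And>i. u i p = c i"
  shows "(\<lambda>q. \<Sum>i\<in>{1..n}. u i q * rel i (component i v) q) \<in> M 3"
proof -
  interpret X: embedded_point W X "point c p" by (rule embedded_point_point[where s = s and c = c, OF s])
  define \<sigma> where "\<sigma> q = point (\<lambda>i. u i q) q" for q
  have \<sigma>_p: "\<sigma> p = point c p" unfolding \<sigma>_def by (simp add: u_p)
  have ev_u: "\<forall>\<^sub>F q in zariski_nhds U C p. u s q \<noteq> 0"
    by (rule R_nonzero[OF u[OF s(1)]]) (simp add: u_p s(2))
  have ev: "\<forall>\<^sub>F q in zariski_nhds U C p. \<sigma> q \<in> X \<and> \<sigma> q \<in> Proj W \<and>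
      combination (\<lambda>i. u i q) q \<in> functionals W (\<sigma> q)"
    using eventually_trivial_at ev_u
  proof eventually_elim
    case (elim q)
    then have "q \<in> C" by (simp add: trivial_at_def)
    then show ?case unfolding \<sigma>_def
      using point_functional point_scroll[where c = "\<lambda>i. u i q", OF elim(1) s(1) elim(2)]
        point_Proj[where c = "\<lambda>i. u i q", OF elim(1) s(1) elim(2)] by blast
  qed
  have ring: "(\<lambda>q. combination (\<lambda>i. u i q) q w) \<in> R" if "w \<in> W" for w
    unfolding combination_def by (intro R_sum R_mult u rel_R component_V that)
  have "ratio W v (E s) \<circ> \<sigma> \<in> M 3"
  proof (rule mpow_pullback[where \<sigma> = \<sigma>, OF _ _ \<sigma>_p M3])
    show "f \<circ> \<sigma> \<in> R" if "f \<in> X.R" for f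
      by (rule X.local_ring_pullback(1)[OF germ_ring_axioms \<sigma>_p ev _ that]) (erule ring)
    show "\<forall>\<^sub>F q in zariski_nhds U C p. P (\<sigma> q)" if "eventually P (zariski_nhds W X (point c p))" for P
      by (rule X.local_ring_pullback(2)[OF germ_ring_axioms \<sigma>_p ev _ that]) (erule ring)
  qed
  \<comment> \<open>On the curve the denominator of \<open>v / E s\<close> is \<open>u s\<close>,
    the value of the functional on \<open>E s\<close>; multiplication clears it.\<close>
  then have "(\<lambda>q. u s q * (ratio W v (E s) \<circ> \<sigma>) q) \<in> M 3" by (rule M_mult[OF u[OF s(1)]])
  moreover have "\<forall>\<^sub>F q in zariski_nhds U C p. u s q * (ratio W v (E s) \<circ> \<sigma>) q =
      (\<Sum>i\<in>{1..n}. u i q * rel i (component i v) q)"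
    using ev eventually_trivial_at ev_u
  proof eventually_elim
    case (elim q)
    have "ratio W v (E s) (\<sigma> q) = combination (\<lambda>i. u i q) q v / combination (\<lambda>i. u i q) q (E s)"
      by (rule ratio_eq[OF subspace_W v E_W[OF s(1)]]) (use elim in blast)
    also have "combination (\<lambda>i. u i q) q (E s) = u s q" by (rule combination_E[OF elim(2) s(1)])
    finally show ?case using elim(3) by (simp add: combination_def)
  qed
  ultimately show ?thesis by (rule M_cong)
qed

section \<open>Second jets and inflection points of the scroll\<close>

lemma jet_ker_point:
  assumes s: "s \<in> {1..n}" "c s \<noteq> 0"
  shows "jet_ker W X 2 (point c p) = {v \<in> W.
    (\<forall>i\<in>{1..n}. coef (rel i (component i v)) 0 = 0 \<and> coef (rel i (component i v)) 1 = 0) \<and>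
    (\<Sum>i\<in>{1..n}. c i * coef (rel i (component i v)) 2) = 0}"
proof -
  interpret X: embedded_point W X "point c p" by (rule embedded_point_point[where s = s and c = c, OF s])
  note E = E_notin_point[where s = s and c = c, OF s]
  have r: "rel i (component i v) \<in> R" if "v \<in> W" "i \<in> {1..n}" for i v
    by (intro rel_R component_V that)
  have sum_R: "(\<lambda>q. \<Sum>i\<in>{1..n}. c i * rel i (component i v) q) \<in> R" if "v \<in> W" for v
    by (intro R_sum R_scale r that)
  have coef_combination: "coef (\<lambda>q. \<Sum>i\<in>{1..n}. c i * rel i (component i v) q) j =
      (\<Sum>i\<in>{1..n}. c i * coef (rel i (component i v)) j)" if v: "v \<in> W" and j: "j < 3" for v j
  proof -
    have "coef (\<lambda>q. \<Sum>i\<in>{1..n}. c i * rel i (component i v) q) j =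
        (\<Sum>i\<in>{1..n}. coef (\<lambda>q. c i * rel i (component i v) q) j)"
      by (intro coef_sum R_scale r v j)
    also have "\<dots> = (\<Sum>i\<in>{1..n}. c i * coef (rel i (component i v)) j)"
      by (intro sum.cong refl coef_scale r v j)
    finally show ?thesis .
  qed
  have "ratio W v (E s) \<in> X.M 3 \<longleftrightarrow>
      (\<forall>i\<in>{1..n}. coef (rel i (component i v)) 0 = 0 \<and> coef (rel i (component i v)) 1 = 0) \<and>
      (\<Sum>i\<in>{1..n}. c i * coef (rel i (component i v)) 2) = 0" if v: "v \<in> W" for v
  proof
    assume M3: "ratio W v (E s) \<in> X.M 3"
    have base: "(\<lambda>q. \<Sum>i\<in>{1..n}. c i * rel i (component i v) q) \<in> M 3"
      by (rule combination_M3[where u = "\<lambda>i q. c i", OF s v M3 R_const refl])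
    have "coef (rel j (component j v)) 0 = 0 \<and> coef (rel j (component j v)) 1 = 0" if j: "j \<in> {1..n}" for j
    proof (rule t_mult_M3[OF r[OF v j]])
      \<comment> \<open>The constant curve is tilted in the \<open>j\<close>-th fibre direction at
        speed \<open>t\<close>. The difference of the two restrictions is \<open>t * rel j\<close>,
        and cancelling \<open>t\<close> leaves vanishing to order 2.\<close>
      let ?u = "\<lambda>i q. c i + (if i = j then t q else 0)"
      have "?u i \<in> R" for i by (cases "i = j") (auto intro: R_add R_const t_R)
      moreover have "?u i p = c i" for i by (simp add: t_0)
      ultimately have "(\<lambda>q. \<Sum>i\<in>{1..n}. ?u i q * rel i (component i v) q) \<in> M 3"
        by (intro combination_M3[where u = ?u, OF s v M3])
      note diff = M_diff[OF this base]
      have "(\<Sum>i\<in>{1..n}. ?u i q * rel i (component i v) q) - (\<Sum>i\<in>{1..n}. c i * rel i (component i v) q) =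
          t q * rel j (component j v) q" for q
      proof -
        have "(\<Sum>i\<in>{1..n}. ?u i q * rel i (component i v) q) - (\<Sum>i\<in>{1..n}. c i * rel i (component i v) q)
            = (\<Sum>i\<in>{1..n}. if i = j then t q * rel j (component j v) q else 0)"
          unfolding sum_subtractf[symmetric] by (intro sum.cong) (auto simp: algebra_simps)
        then show ?thesis using j by simp
      qed
      then show "(\<lambda>q. t q * rel j (component j v) q) \<in> M 3" using diff by simp
    qed
    moreover have "(\<Sum>i\<in>{1..n}. c i * coef (rel i (component i v)) 2) = 0"
      using coef_M3[OF sum_R[OF v]] base coef_combination[OF v, of 2] by simp
    ultimately show "(\<forall>i\<in>{1..n}. coef (rel i (component i v)) 0 = 0 \<and> coef (rel i (component i v)) 1 = 0) \<and>
      (\<Sum>i\<in>{1..n}. c i * coef (rel i (component i v)) 2) = 0" by blast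
  next
    assume *: "(\<forall>i\<in>{1..n}. coef (rel i (component i v)) 0 = 0 \<and> coef (rel i (component i v)) 1 = 0) \<and>
      (\<Sum>i\<in>{1..n}. c i * coef (rel i (component i v)) 2) = 0"
    let ?F = "\<lambda>q. \<Sum>i\<in>{1..n}. c i * rel i (component i v) q"
    have M2: "rel i (component i v) \<in> M 2" if "i \<in> {1..n}" for i
      using coef_M2[OF r[OF v that]] * that by blast
    have F: "?F \<in> M 3"
      unfolding coef_M3[OF sum_R[OF v]] using * coef_combination[OF v] by simp
    obtain \<pi> where \<pi>_p: "\<pi> (point c p) = p"
      and \<pi>_ring: "\<And>f. f \<in> R \<Longrightarrow> f \<circ> \<pi> \<in> local_ring W X (point c p)"
      and \<pi>_ev: "\<And>P. eventually P (zariski_nhds U C p) \<Longrightarrow>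
        eventually (\<lambda>z. P (\<pi> z)) (zariski_nhds W X (point c p))"
      and \<pi>_C: "\<And>z. z \<in> X \<Longrightarrow> z \<in> Proj W \<Longrightarrow> E s \<notin> z \<Longrightarrow> \<pi> z \<in> C"
      and \<pi>_van: "\<And>z i v. z \<in> X \<Longrightarrow> z \<in> Proj W \<Longrightarrow> E s \<notin> z \<Longrightarrow> i \<in> {1..n} \<Longrightarrow>
        v \<in> sys_map (V i) (\<pi> z) \<Longrightarrow> inj_comp i v \<in> z"
    proof (rule projection_exists[where s = s and c = c, OF s], goal_cases)
      case (1 \<pi>)
      show ?case by (rule 1(1)) (fact 1)+
    qed
    \<comment> \<open>Fibre coordinates normalized by the \<open>s\<close>-th, with values
      \<open>c i / c s\<close> at the point. Expanding \<open>v / E s\<close> about these values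
      leaves the pullback of \<open>?F\<close> divided by \<open>c s\<close>, in m^3, and products
      of an element of m with an element of m^2.\<close>
    define u where "u i = ratio W (E i) (E s)" for i
    have u_R: "u i \<in> X.R" if "i \<in> {1..n}" for i
      unfolding u_def by (rule X.ratio_R[OF E_W[OF that] E_W[OF s(1)] E])
    have u_p: "u i (point c p) = c i / c s" if "i \<in> {1..n}" for i
      unfolding u_def ratio_eq[OF subspace_W E_W[OF that] E_W[OF s(1)] point_functional[OF p_in_C]]
        combination_E[OF trivial_at_p that] combination_E[OF trivial_at_p s(1)] ..
    have "\<forall>\<^sub>F z in zariski_nhds W X (point c p).
        inverse (c s) * (?F \<circ> \<pi>) z + (\<Sum>i\<in>{1..n}. (u i z - c i / c s) * (rel i (component i v) \<circ> \<pi>) z)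
          = ratio W v (E s) z"
      using X.eventually_Y X.eventually_Proj X.eventually_not_mem[OF E_W[OF s(1)] E]
        \<pi>_ev[OF eventually_trivial_at]
    proof eventually_elim
      case (elim z)
      note q = \<pi>_C[OF elim(1-3)]
      obtain l where l: "l \<in> functionals W z" using functionals_nonempty[OF subspace_W elim(2)] by blast
      have l_lin: "linear_on W l" using l by (simp add: functionals_iff)
      have "l v = (\<Sum>i\<in>{1..n}. l (inj_comp i (component i v)))"
        using linear_on_sum[OF subspace_W l_lin, of "{1..n}" "\<lambda>i. inj_comp i (component i v)"]
          inj_W component_V[OF v] direct_sum_eq_sum[OF v] by simp
      also have "\<dots> = (\<Sum>i\<in>{1..n}. rel i (component i v) (\<pi> z) * l (E i))"
      proof (rule sum.cong[OF refl])
        fix i assume i: "i \<in> {1..n}"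
        show "l (inj_comp i (component i v)) = rel i (component i v) (\<pi> z) * l (E i)"
          unfolding rel_fun_def
          by (rule functional_inj[OF elim(2) l q \<pi>_van[OF elim(1-3) i] i component_V[OF v i] e_V[OF i]])
             (use elim(4) i in \<open>auto simp: trivial_at_def\<close>)
      qed
      finally have "ratio W v (E s) z = (\<Sum>i\<in>{1..n}. rel i (component i v) (\<pi> z) * l (E i)) / l (E s)"
        using ratio_eq[OF subspace_W v E_W[OF s(1)] l] by simp
      also have "\<dots> = (\<Sum>i\<in>{1..n}. rel i (component i v) (\<pi> z) * u i z)"
        unfolding sum_divide_distrib
        by (intro sum.cong refl)
           (simp add: u_def ratio_eq[OF subspace_W E_W E_W[OF s(1)] l])
      also have "\<dots> = inverse (c s) * ?F (\<pi> z) + (\<Sum>i\<in>{1..n}. (u i z - c i / c s) * rel i (component i v) (\<pi> z))"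
        unfolding sum_distrib_left sum.distrib[symmetric]
        by (intro sum.cong refl) (simp add: algebra_simps divide_inverse)
      finally show ?case by simp
    qed
    moreover have "(\<lambda>z. inverse (c s) * (?F \<circ> \<pi>) z +
        (\<Sum>i\<in>{1..n}. (u i z - c i / c s) * (rel i (component i v) \<circ> \<pi>) z)) \<in> X.M 3"
    proof (intro X.M_add X.M_scale X.M_sum)
      show "?F \<circ> \<pi> \<in> X.M 3" by (rule mpow_pullback[OF \<pi>_ring \<pi>_ev \<pi>_p F])
      fix i assume i: "i \<in> {1..n}"
      have "(\<lambda>z. (u i z - c i / c s) * (rel i (component i v) \<circ> \<pi>) z) \<in> X.M (Suc 2)"
        by (rule X.M_SucI[OF X.R_diff[OF u_R[OF i] X.R_const] _ mpow_pullback[OF \<pi>_ring \<pi>_ev \<pi>_p M2[OF i]]])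
           (simp add: u_p[OF i])
      then show "(\<lambda>z. (u i z - c i / c s) * (rel i (component i v) \<circ> \<pi>) z) \<in> X.M 3" by simp
    qed
    ultimately show "ratio W v (E s) \<in> X.M 3" by (rule X.M_cong[rotated])
  qed
  then show ?thesis unfolding X.jet_ker_eq[OF E_W[OF s(1)] E] by auto
qed

lemma point_inflection_iff:
  assumes s: "s \<in> {1..n}" "c s \<noteq> 0"
  shows "point c p \<in> infl_locus W n X 2 \<longleftrightarrow>
    (\<forall>i\<in>{1..n}. c i \<noteq> 0 \<longrightarrow> is_flex (V i) 1 (sys_map (V i) ` C) (sys_map (V i) p))"
proof -
  \<comment> \<open>Pairs of a summand and an order 0 or 1: their number \<open>n * 2\<close> is
    exactly the bound in \<open>infl_locus\<close>.\<close>
  define J where "J = {1..n} \<times> {0, 1 :: nat}"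
  define a where "a = (\<lambda>(i, j) v. coef (rel i (component i v)) j)"
  define a' where "a' v = (\<Sum>i\<in>{1..n}. c i * coef (rel i (component i v)) 2)" for v
  define b where "b = (\<lambda>(i, j). inj_comp i
    (if j = (0::nat) then e i else embedded_curve.tangent_section U C p t (V i)))"
  have lin: "linear_on (V i) (\<lambda>v. coef (rel i v) j)" if "i \<in> {1..n}" "j < 3" for i j
    by (rule embedded_curve.coef_rel_linear[OF curve[OF that(1)] that(2)])
  have lin_W: "linear_on W (\<lambda>v. coef (rel i (component i v)) j)" if i: "i \<in> {1..n}" and j: "j < 3" for i j
    unfolding linear_on_def component_add component_scale
    by (intro conjI ballI allI linear_on_add[OF lin[OF i j]] linear_on_scale[OF lin[OF i j]] component_V i)
  have coef_0: "coef (rel i 0) j = 0" if "i \<in> {1..n}" "j < 3" for i j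
    by (rule linear_on_zero[OF subspace_V[OF that(1)] lin[OF that]])
  have "point c p \<in> infl_locus W n X 2 \<longleftrightarrow> (\<forall>v\<in>W. (\<forall>j\<in>J. a j v = 0) \<longrightarrow> a' v = 0)"
  proof (rule mem_infl_locus_iff[OF subspace_W, where b = b])
    show "finite J" "card J = n * 2" by (simp_all add: J_def card_cartesian_product)
    show "point c p \<in> X" by (rule point_scroll[where s = s and c = c, OF trivial_at_p s])
    show "linear_on W (a j)" if "j \<in> J" for j
      using that lin_W by (auto simp: J_def a_def)
    show "linear_on W a'"
      unfolding linear_on_def a'_def
    proof (intro conjI ballI allI)
      fix u v assume uv: "u \<in> W" "v \<in> W"
      show "(\<Sum>i\<in>{1..n}. c i * coef (rel i (component i (u + v))) 2) =
          (\<Sum>i\<in>{1..n}. c i * coef (rel i (component i u)) 2) + (\<Sum>i\<in>{1..n}. c i * coef (rel i (component i v)) 2)"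
        unfolding sum.distrib[symmetric]
        by (intro sum.cong refl) (simp add: linear_on_add[OF lin_W uv] distrib_left)
    next
      fix k v assume v: "v \<in> W"
      show "(\<Sum>i\<in>{1..n}. c i * coef (rel i (component i (cscale k v))) 2) =
          k * (\<Sum>i\<in>{1..n}. c i * coef (rel i (component i v)) 2)"
        unfolding sum_distrib_left
        by (intro sum.cong refl) (simp add: linear_on_scale[OF lin_W v])
    qed
    show "b j \<in> W" if "j \<in> J" for j
      using that by (auto simp: J_def b_def intro!: inj_W e_V embedded_curve.tangent_section(1)[OF curve])
    show "a j (b k) = (if j = k then 1 else 0)" if jk: "j \<in> J" "k \<in> J" for j k
    proof -
      obtain i j' i' k' where ij: "j = (i, j')" "k = (i', k')" by (cases j, cases k)
      have i: "i \<in> {1..n}" "j' = 0 \<or> j' = 1" "k' = 0 \<or> k' = 1" using jk ij by (auto simp: J_def)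
      show ?thesis
      proof (cases "i = i'")
        case True
        then show ?thesis unfolding ij a_def b_def
          using i(2,3) embedded_curve.coef_rel_e[OF curve[OF i(1)]]
            embedded_curve.tangent_section(2,3)[OF curve[OF i(1)]]
          by (auto simp: component_inj_comp)
      next
        case False
        then show ?thesis unfolding ij a_def b_def using i(2) coef_0[OF i(1), of j']
          by (auto simp: component_inj_comp)
      qed
    qed
    have "(\<forall>i\<in>{1..n}. coef (rel i (component i v)) 0 = 0 \<and> coef (rel i (component i v)) 1 = 0) \<longleftrightarrow>
        (\<forall>j\<in>J. a j v = 0)" for v
      by (auto simp: J_def a_def)
    then show "jet_ker W X 2 (point c p) = {v \<in> W. (\<forall>j\<in>J. a j v = 0) \<and> a' v = 0}"
      unfolding jet_ker_point[where s = s and c = c, OF s] a'_def by simp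
  qed
  also have "\<dots> \<longleftrightarrow> (\<forall>i\<in>{1..n}. c i \<noteq> 0 \<longrightarrow> is_flex (V i) 1 (sys_map (V i) ` C) (sys_map (V i) p))"
  proof
    assume van: "\<forall>v\<in>W. (\<forall>j\<in>J. a j v = 0) \<longrightarrow> a' v = 0"
    show "\<forall>i\<in>{1..n}. c i \<noteq> 0 \<longrightarrow> is_flex (V i) 1 (sys_map (V i) ` C) (sys_map (V i) p)"
    proof (intro ballI impI)
      fix i assume i: "i \<in> {1..n}" and ci: "c i \<noteq> 0"
      have "coef (rel i v) 2 = 0" if v: "v \<in> V i" "coef (rel i v) 0 = 0" "coef (rel i v) 1 = 0" for v
      proof -
        \<comment> \<open>A test section supported in one summand isolates a single term of
          \<open>a'\<close>, and \<open>c i \<noteq> 0\<close> can be cancelled.\<close>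
        have "\<forall>j\<in>J. a j (inj_comp i v) = 0"
          using v(2,3) coef_0 by (auto simp: J_def a_def component_inj_comp)
        then have "a' (inj_comp i v) = 0" using van inj_W[OF i v(1)] by blast
        moreover have "a' (inj_comp i v) = (\<Sum>k\<in>{1..n}. if k = i then c i * coef (rel i v) 2 else 0)"
          unfolding a'_def by (intro sum.cong refl) (simp add: component_inj_comp coef_0)
        ultimately show ?thesis using i ci by simp
      qed
      then show "is_flex (V i) 1 (sys_map (V i) ` C) (sys_map (V i) p)"
        unfolding embedded_curve.is_flex_iff[OF curve[OF i]] by blast
    qed
  next
    assume flex: "\<forall>i\<in>{1..n}. c i \<noteq> 0 \<longrightarrow> is_flex (V i) 1 (sys_map (V i) ` C) (sys_map (V i) p)"
    show "\<forall>v\<in>W. (\<forall>j\<in>J. a j v = 0) \<longrightarrow> a' v = 0"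
    proof (intro ballI impI)
      fix v assume v: "v \<in> W" and van: "\<forall>j\<in>J. a j v = 0"
      have "c i * coef (rel i (component i v)) 2 = 0" if i: "i \<in> {1..n}" for i
      proof (cases "c i = 0")
        case False
        have "a (i, 0) v = 0" "a (i, 1) v = 0" using van i by (auto simp: J_def)
        then have "coef (rel i (component i v)) 0 = 0 \<and> coef (rel i (component i v)) 1 = 0"
          by (simp add: a_def)
        then show ?thesis
          using flex i False component_V[OF v i] embedded_curve.is_flex_iff[OF curve[OF i]] by simp
      qed simp
      then show "a' v = 0" unfolding a'_def by (rule sum.neutral[OF ballI])
    qed
  qed
  finally show ?thesis .
qed

section \<open>The fibre over \<open>p\<close>, its vertices and faces in homogeneous
  coordinates\<close>

lemma scroll_pt_eq:
  assumes i: "i \<in> {1..n}"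
  shows "scroll_pt n V p i = point (\<lambda>j. if j = i then 1 else 0) p"
proof -
  have "component i v \<in> sys_map (V i) p \<longleftrightarrow> combination (\<lambda>j. if j = i then 1 else 0) p v = 0"
    if v: "v \<in> W" for v
  proof -
    have "combination (\<lambda>j. if j = i then 1 else 0) p v = (\<Sum>j\<in>{1..n}. if j = i then rel i (component i v) p else 0)"
      unfolding combination_def by (intro sum.cong refl) simp
    then show ?thesis using rel_eq_0_iff[OF trivial_at_p i component_V[OF v i]] i by simp
  qed
  then show ?thesis unfolding scroll_pt_def incl_def point_def by blast
qed

lemma scroll_pt_Proj: "i \<in> {1..n} \<Longrightarrow> scroll_pt n V p i \<in> Proj W"
  unfolding scroll_pt_eq by (rule point_Proj[OF trivial_at_p]) simp_all

lemma span_scroll_pts: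
  assumes A: "A \<subseteq> {1..n}"
  shows "proj_span W (scroll_pt n V p ` A) =
    {H \<in> Proj W. {v \<in> W. \<forall>i\<in>A. component i v \<in> sys_map (V i) p} \<subseteq> H}"
proof -
  have "W \<inter> \<Inter>(scroll_pt n V p ` A) = {v \<in> W. \<forall>i\<in>A. component i v \<in> sys_map (V i) p}"
    unfolding scroll_pt_def incl_def by blast
  moreover have "scroll_pt n V p ` A \<subseteq> Proj W" using scroll_pt_Proj A by blast
  ultimately show ?thesis unfolding lin_def using proj_span_eq[OF subspace_W] by (simp add: lin_def)
qed

lemma scroll_fibre_iff:
  "x \<in> scroll_fibre n V p \<longleftrightarrow> (\<exists>c. (\<exists>s\<in>{1..n}. c s \<noteq> 0) \<and> x = point c p)"
proof
  assume "x \<in> scroll_fibre n V p"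
  then have x: "x \<in> Proj W" and sub: "{v \<in> W. \<forall>i\<in>{1..n}. component i v \<in> sys_map (V i) p} \<subseteq> x"
    unfolding scroll_fibre_def using span_scroll_pts[of "{1..n}"] by auto
  obtain l where l: "l \<in> functionals W x" using functionals_nonempty[OF subspace_W x] by blast
  have l_lin: "linear_on W l" using l by (simp add: functionals_iff)
  have van: "inj_comp i v \<in> x" if i: "i \<in> {1..n}" and v: "v \<in> sys_map (V i) p" for i v
  proof -
    have vV: "v \<in> V i" using v by (simp add: sys_map_def)
    have "component k (inj_comp i v) \<in> sys_map (V k) p" if k: "k \<in> {1..n}" for k
      using v cv.subspace_0[of "sys_map (V k) p"] sys_map_Proj[OF k p_in_C]
      by (auto simp: component_inj_comp Proj_def)
    then show ?thesis using sub inj_W[OF i vV] by blast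
  qed
  \<comment> \<open>The homogeneous coordinates of \<open>x\<close> are the values of its functional
    on the frame \<open>E\<close>.\<close>
  define c where "c i = l (E i)" for i
  have l_eq: "l v = combination c p v" if v: "v \<in> W" for v
  proof -
    have "l v = (\<Sum>i\<in>{1..n}. l (inj_comp i (component i v)))"
      using linear_on_sum[OF subspace_W l_lin, of "{1..n}" "\<lambda>i. inj_comp i (component i v)"]
        inj_W component_V[OF v] direct_sum_eq_sum[OF v] by simp
    also have "\<dots> = combination c p v"
      unfolding combination_def
    proof (rule sum.cong[OF refl])
      fix i assume i: "i \<in> {1..n}"
      have "l (inj_comp i (component i v)) = rel i (component i v) p * l (E i)"
        unfolding rel_fun_def
        by (rule functional_inj[OF x l p_in_C van[OF i] i component_V[OF v i] e_V[OF i]])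
           (use trivial_at_p i in \<open>auto simp: trivial_at_def\<close>)
      then show "l (inj_comp i (component i v)) = c i * rel i (component i v) p" by (simp add: c_def)
    qed
    finally show ?thesis .
  qed
  have x_eq: "x = point c p"
  proof -
    have "x = {v \<in> W. l v = 0}" using l by (simp add: functionals_iff)
    also have "\<dots> = point c p" unfolding point_def using l_eq by (intro Collect_cong conj_cong refl) simp
    finally show ?thesis .
  qed
  moreover have "\<exists>s\<in>{1..n}. c s \<noteq> 0"
  proof (rule ccontr)
    assume "\<not> ?thesis"
    then have "combination c p v = 0" for v by (simp add: combination_def)
    then have "x = W" unfolding x_eq point_def by simp
    then show False using Proj_obtain[OF x] by blast
  qed
  ultimately show "\<exists>c. (\<exists>s\<in>{1..n}. c s \<noteq> 0) \<and> x = point c p" by blast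
next
  assume "\<exists>c. (\<exists>s\<in>{1..n}. c s \<noteq> 0) \<and> x = point c p"
  then obtain c s where s: "s \<in> {1..n}" "c s \<noteq> 0" and x: "x = point c p" by blast
  have "combination c p v = 0"
    if v: "v \<in> W" and van: "\<forall>i\<in>{1..n}. component i v \<in> sys_map (V i) p" for v
    unfolding combination_def
    using rel_eq_0_iff[OF trivial_at_p _ component_V[OF v]] van by (intro sum.neutral ballI) simp
  then have "{v \<in> W. \<forall>i\<in>{1..n}. component i v \<in> sys_map (V i) p} \<subseteq> x"
    unfolding x point_def by blast
  then show "x \<in> scroll_fibre n V p"
    unfolding scroll_fibre_def span_scroll_pts[OF subset_refl]
    using point_Proj[where s = s and c = c, OF trivial_at_p s] x by blast
qed

text \<open>\<open>E k\<close> has zero components outside the \<open>k\<close>-th summand, so it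
  lies in every point of the \<open>k\<close>-th face; its value under
  \<open>combination c p\<close> is \<open>c k\<close>.\<close>

lemma point_face_iff:
  assumes s: "s \<in> {1..n}" "c s \<noteq> 0" and k: "k \<in> {1..n}"
  shows "point c p \<in> scroll_face n V p k \<longleftrightarrow> c k = 0"
proof
  have face: "scroll_face n V p k =
      {H \<in> Proj W. {v \<in> W. \<forall>i\<in>{1..n} - {k}. component i v \<in> sys_map (V i) p} \<subseteq> H}"
    unfolding scroll_face_def by (rule span_scroll_pts) blast
  {
    assume "point c p \<in> scroll_face n V p k"
    then have sub: "{v \<in> W. \<forall>i\<in>{1..n} - {k}. component i v \<in> sys_map (V i) p} \<subseteq> point c p"
      unfolding face by blast
    have "0 \<in> sys_map (V i) p" if "i \<in> {1..n}" for i
      using sys_map_Proj[OF that p_in_C] by (auto simp: Proj_def cv.subspace_0)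
    then have "E k \<in> {v \<in> W. \<forall>i\<in>{1..n} - {k}. component i v \<in> sys_map (V i) p}"
      using E_W[OF k] by (simp add: component_inj_comp)
    then have "E k \<in> point c p" using sub by blast
    then show "c k = 0" using combination_E[OF trivial_at_p k, of c] by (simp add: point_def)
  }
  assume ck: "c k = 0"
  have "combination c p v = 0"
    if v: "v \<in> W" and van: "\<forall>i\<in>{1..n} - {k}. component i v \<in> sys_map (V i) p" for v
    unfolding combination_def
  proof (intro sum.neutral ballI)
    fix i assume i: "i \<in> {1..n}"
    show "c i * rel i (component i v) p = 0"
      using rel_eq_0_iff[OF trivial_at_p i component_V[OF v i]] van ck i by (cases "i = k") auto
  qed
  then have "{v \<in> W. \<forall>i\<in>{1..n} - {k}. component i v \<in> sys_map (V i) p} \<subseteq> point c p"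
    unfolding point_def by blast
  then show "point c p \<in> scroll_face n V p k"
    unfolding face using point_Proj[where s = s and c = c, OF trivial_at_p s] by blast
qed

end

section \<open>The inflectional locus on one fibre\<close>

theorem theorem1p2:
  fixes U :: "'b cvec set" and C :: "'b cvec set set" and n :: nat
    and L :: "nat \<Rightarrow> ('a, 'b cvec set) line_bundle"
    and V :: "nat \<Rightarrow> ('a \<times> 'b cvec set) cvec set"
    and p :: "'b cvec set"
  assumes "smooth_projective_curve U C"
    and "1 \<le> n"
    and "\<And>i. i \<in> {1..n} \<Longrightarrow> very_ample U C (L i)"
    and "\<And>i. i \<in> {1..n} \<Longrightarrow> cv.subspace (V i)"
    and "\<And>i. i \<in> {1..n} \<Longrightarrow> V i \<subseteq> H0 U C (L i)"
    and "\<And>i. i \<in> {1..n} \<Longrightarrow> gives_embedding U C (V i)"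
    and "p \<in> C"
  shows
    "((scroll_fibre n V p - (\<Union>i\<in>{1..n}. scroll_face n V p i)) \<inter>
        infl_locus (direct_sum n V) n (scroll C n L V) 2 \<noteq> {}
      \<longleftrightarrow> (\<forall>i\<in>{1..n}. is_flex (V i) 1 (sys_map (V i) ` C) (sys_map (V i) p)))
   \<and> ((\<forall>i\<in>{1..n}. is_flex (V i) 1 (sys_map (V i) ` C) (sys_map (V i) p))
      \<longleftrightarrow> scroll_fibre n V p \<subseteq> infl_locus (direct_sum n V) n (scroll C n L V) 2)
   \<and> (\<forall>i\<in>{1..n}. scroll_pt n V p i \<in> infl_locus (direct_sum n V) n (scroll C n L V) 2
      \<longleftrightarrow> is_flex (V i) 1 (sys_map (V i) ` C) (sys_map (V i) p))
   \<and> (\<forall>x\<in>infl_locus (direct_sum n V) n (scroll C n L V) 2. \<forall>s\<in>{1..n}.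
        x \<in> scroll_fibre n V p - scroll_face n V p s
        \<longrightarrow> is_flex (V s) 1 (sys_map (V s) ` C) (sys_map (V s) p))"
proof -
  have U: "cv.subspace U" "codim U {0} < \<infinity>" "closedin (zariski U) C"
    and smooth: "codim (max_ideal U C p) (max_ideal_pow U C p 2) = 1"
    using assms(1) \<open>p \<in> C\<close> by (auto simp: smooth_projective_curve_def projective_variety_def)
  have C: "C \<subseteq> Proj U" using closedin_subset[OF U(3)] by (simp add: topspace_zariski)
  interpret P: embedded_point U C p using U(1) C \<open>p \<in> C\<close> by unfold_locales auto
  obtain t where t: "uniformized_germ_ring (local_ring U C p) (zariski_nhds U C p) p t"
    using P.uniformizer_exists[OF U(2) smooth] by blast
  interpret uniformized_germ_ring "local_ring U C p" "zariski_nhds U C p" p t by (rule t)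
  interpret D: decomposable_scroll U C p t n L V
    by unfold_locales (use assms U(1) C in \<open>simp_all add: very_ample_def\<close>)
  define flex where "flex i \<longleftrightarrow> is_flex (V i) 1 (sys_map (V i) ` C) (sys_map (V i) p)" for i
  let ?\<Phi> = "infl_locus (direct_sum n V) n (scroll C n L V) 2"
  have infl: "D.point c p \<in> ?\<Phi> \<longleftrightarrow> (\<forall>i\<in>{1..n}. c i \<noteq> 0 \<longrightarrow> flex i)"
    if "s \<in> {1..n}" "c s \<noteq> 0" for c s
    unfolding flex_def by (rule D.point_inflection_iff[where s = s and c = c, OF that])
  have one: "1 \<in> {1..n}" using \<open>1 \<le> n\<close> by simp
  \<comment> \<open>The point with all coordinates 1 lies on no face, and it is inflectional only if
    all curves have a flex. It is the witness for condition (i) and the test point that leads from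
    (iii) to (ii).\<close>
  have one_fibre: "D.point (\<lambda>_. 1) p \<in> scroll_fibre n V p"
    unfolding D.scroll_fibre_iff using one by (intro exI[of _ "\<lambda>_. 1"]) auto
  have one_infl: "D.point (\<lambda>_. 1) p \<in> ?\<Phi> \<longleftrightarrow> (\<forall>i\<in>{1..n}. flex i)"
    using infl[OF one, of "\<lambda>_. 1"] by simp
  have one_face: "D.point (\<lambda>_. 1) p \<notin> scroll_face n V p k" if "k \<in> {1..n}" for k
    using D.point_face_iff[OF one _ that, of "\<lambda>_. 1"] by simp
  have part3: "flex s"
    if x: "x \<in> ?\<Phi>" "x \<in> scroll_fibre n V p" "x \<notin> scroll_face n V p s" and s: "s \<in> {1..n}" for x s
  proof -
    obtain c r where r: "r \<in> {1..n}" "c r \<noteq> 0" and xc: "x = D.point c p"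
      using x(2) unfolding D.scroll_fibre_iff by blast
    have "c s \<noteq> 0" using x(3) D.point_face_iff[where s = r and c = c, OF r s] unfolding xc by simp
    then show ?thesis using infl[where s = r and c = c, OF r] x(1) s unfolding xc by blast
  qed
  have "(scroll_fibre n V p - (\<Union>i\<in>{1..n}. scroll_face n V p i)) \<inter> ?\<Phi> \<noteq> {} \<longleftrightarrow> (\<forall>i\<in>{1..n}. flex i)"
  proof
    assume "(scroll_fibre n V p - (\<Union>i\<in>{1..n}. scroll_face n V p i)) \<inter> ?\<Phi> \<noteq> {}"
    then obtain x where "x \<in> ?\<Phi>" "x \<in> scroll_fibre n V p" "\<forall>i\<in>{1..n}. x \<notin> scroll_face n V p i"
      by blast
    then show "\<forall>i\<in>{1..n}. flex i" using part3 by blast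
  next
    assume "\<forall>i\<in>{1..n}. flex i"
    then show "(scroll_fibre n V p - (\<Union>i\<in>{1..n}. scroll_face n V p i)) \<inter> ?\<Phi> \<noteq> {}"
      using one_fibre one_infl one_face by blast
  qed
  moreover have "(\<forall>i\<in>{1..n}. flex i) \<longleftrightarrow> scroll_fibre n V p \<subseteq> ?\<Phi>"
  proof
    assume flex: "\<forall>i\<in>{1..n}. flex i"
    show "scroll_fibre n V p \<subseteq> ?\<Phi>"
    proof
      fix x assume "x \<in> scroll_fibre n V p"
      then obtain c r where r: "r \<in> {1..n}" "c r \<noteq> 0" and xc: "x = D.point c p"
        unfolding D.scroll_fibre_iff by blast
      show "x \<in> ?\<Phi>" unfolding xc infl[where s = r and c = c, OF r] using flex by blast
    qed
  next
    assume "scroll_fibre n V p \<subseteq> ?\<Phi>"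
    then show "\<forall>i\<in>{1..n}. flex i" using one_fibre one_infl by blast
  qed
  \<comment> \<open>A unit coordinate vector has one nonzero entry, so the criterion involves the
    \<open>i\<close>-th curve alone.\<close>
  moreover have "scroll_pt n V p i \<in> ?\<Phi> \<longleftrightarrow> flex i" if "i \<in> {1..n}" for i
    unfolding D.scroll_pt_eq[OF that] using infl[OF that, of "\<lambda>j. if j = i then 1 else 0"] that by auto
  ultimately show ?thesis using part3 unfolding flex_def by blast
qed

end
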